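(* Let $\mu\ge0$ be an integer and $g\in C^\infty[-1,1]$. Let $\lambda>-\frac12$; for $\lambda\neq0$ let $\mathcal P_N^{f,Ge}$ be the Gegenbauer orthogonal projection of $f$ with parameter $\lambda$, and let $\mathcal P_N^{f,Ch}$ be the Chebyshev orthogonal projection of $f$. Then, as $N\to\infty$: (a) (Gegenbauer, $\lambda\ne0$) (i) if $f(x)=(1-x)^{\gamma}\ln^{\mu}(1-x)g(x)$ with $\min\{\lambda+\gamma,\lambda+2\gamma\}>-\frac12$, then $\|f-\mathcal P_N^{f,Ge}\|_{L^2_\omega[-1,1]}=O(N^{-\lambda-2\gamma-1/2}\ln^{\mu}(N))$; (ii) if $f(x)=|x-z_0|^{s}\ln^{\mu}|x-z_0|g(x)$ with $z_0\in(-1,1)$, $s>-\frac12$ and $\lambda\ge0$, then $\|f-\mathcal P_N^{f,Ge}\|_{L^2_\omega[-1,1]}=O(N^{-s-1/2}\ln^{\mu}(N))$; (iii) if $f(x)=(1+x)^{\delta}\ln^{\mu}(1+x)g(x)$ with $\min\{\lambda+\delta,\lambda+2\delta\}>-\frac12$, then $\|f-\mathcal P_N^{f,Ge}\|_{L^2_\omega[-1,1]}=O(N^{-\lambda-2\delta-1/2}\ln^{\mu}(N))$. (b) (Chebyshev, corresponding to $\lambda=0$) (i) if $f(x)=(1-x)^{\gamma}\ln^{\mu}(1-x)g(x)$ with $\min\{\gamma,2\gamma\}>-\frac12$, then $\|f-\mathcal P_N^{f,Ch}\|_{L^2_\omega[-1,1]}=O(N^{-1/2-2\gamma}\ln^{\mu}(N))$;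 (ii) if $f(x)=|x-z_0|^{s}\ln^{\mu}|x-z_0|g(x)$ with $z_0\in(-1,1)$ and $s>-\frac12$, then $\|f-\mathcal P_N^{f,Ch}\|_{L^2_\omega[-1,1]}=O(N^{-s-1/2}\ln^{\mu}(N))$; (iii) if $f(x)=(1+x)^{\delta}\ln^{\mu}(1+x)g(x)$ with $\min\{\delta,2\delta\}>-\frac12$, then $\|f-\mathcal P_N^{f,Ch}\|_{L^2_\omega[-1,1]}=O(N^{-1/2-2\delta}\ln^{\mu}(N))$. In particular, if $\mu\ge1$ and $\gamma$ (respectively $\delta$) is an integer, then in cases (a)(i), (b)(i) (respectively (a)(iii), (b)(iii)) the factor $\ln^\mu(N)$ may be replaced by $\ln^{\mu-1}(N)$.
   Context: In part (a), $\omega(x)=(1-x^2)^{\lambda-1/2}$; in part (b), $\omega(x)=(1-x^2)^{-1/2}$; $\|u\|_{L^2_\omega[-1,1]}=\big(\int_{-1}^1\omega u^2dx\big)^{1/2}$. $C_n^{(\lambda)}$ is the Gegenbauer polynomial of degree $n$ and $T_n$ the Chebyshev polynomial of the first kind. $\mathcal P_N^{f,Ge}=\sum_{n=0}^N a_n(\lambda)C_n^{(\lambda)}$ with $a_n(\lambda)=\frac1{h_n}\int_{-1}^1(1-x^2)^{\lambda-1/2}C_n^{(\lambda)}(x)f(x)\,dx$, $h_n=\int_{-1}^1(1-x^2)^{\lambda-1/2}[C_n^{(\lambda)}(x)]^2dx$. $\mathcal P_N^{f,Ch}=\sum_{n=0}^N c_nT_n$, where $f=\sum_{n\ge0} c_nT_n$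 is the Chebyshev expansion, i.e. $c_0=\frac1\pi\int_{-1}^1\frac{f(x)}{\sqrt{1-x^2}}dx$ and $c_n=\frac2\pi\int_{-1}^1\frac{f(x)T_n(x)}{\sqrt{1-x^2}}dx$ for $n\ge1$. The exponents $\gamma,\delta,s$ are real. Constants in the $O$-terms may depend on everything except $N$.
   Formalization: In the "in particular" clause for (a)(i) and (a)(iii), γ (respectively δ) is required to be a nonnegative integer; for negative integers the claim fails, e.g. λ=2, γ=−1, μ=1, g=1, where the error has exact order N^{-1/2} ln N. *)

theory Defs
  imports "HOL-Analysis.Analysis" "HOL-Library.Landau_Symbols"
begin

text \<open>
  \<open>g \<in> C\<^sup>\<infinity>[-1,1]\<close>: derivatives of all orders exist on the closed interval, one-sided at the
  endpoints. The witness \<open>G k\<close> is the \<open>k\<close>-th derivative; values of \<open>g\<close> outside the interval are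
  irrelevant.
\<close>

definition smooth_on_interval :: "(real \<Rightarrow> real) \<Rightarrow> bool" where
  "smooth_on_interval g \<longleftrightarrow>
     (\<exists>G :: nat \<Rightarrow> real \<Rightarrow> real.
        (\<forall>x\<in>{-1..1}. G 0 x = g x) \<and>
        (\<forall>k. \<forall>x\<in>{-1..1}. (G k has_real_derivative G (Suc k) x) (at x within {-1..1})))"

text \<open>
  The standard normalisation, with \<open>C\<^sub>n\<close> having generating function
  \<open>(1 - 2 * x * t + t\<^sup>2) powr (- lam)\<close>.
\<close>

fun gegenbauer :: "real \<Rightarrow> nat \<Rightarrow> real \<Rightarrow> real" where
  "gegenbauer lam 0 x = 1"
| "gegenbauer lam (Suc 0) x = 2 * lam * x"
| "gegenbauer lam (Suc (Suc n)) x =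
     (2 * x * (real n + 1 + lam) * gegenbauer lam (Suc n) x
       - (real n + 2 * lam) * gegenbauer lam n x) / (real n + 2)"

fun chebyshev_T :: "nat \<Rightarrow> real \<Rightarrow> real" where
  "chebyshev_T 0 x = 1"
| "chebyshev_T (Suc 0) x = x"
| "chebyshev_T (Suc (Suc n)) x = 2 * x * chebyshev_T (Suc n) x - chebyshev_T n x"

definition gegenbauer_weight :: "real \<Rightarrow> real \<Rightarrow> real" where
  "gegenbauer_weight lam x = (1 - x\<^sup>2) powr (lam - 1/2)"

definition chebyshev_weight :: "real \<Rightarrow> real" where
  "chebyshev_weight x = (1 - x\<^sup>2) powr (- 1/2)"

definition weighted_L2_norm :: "(real \<Rightarrow> real) \<Rightarrow> (real \<Rightarrow> real) \<Rightarrow> real" where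
  "weighted_L2_norm w u = sqrt (LINT x:{-1..1}|lborel. w x * (u x)\<^sup>2)"

definition gegenbauer_h :: "real \<Rightarrow> nat \<Rightarrow> real" where
  "gegenbauer_h lam n =
     (LINT x:{-1..1}|lborel. (1 - x\<^sup>2) powr (lam - 1/2) * (gegenbauer lam n x)\<^sup>2)"

definition gegenbauer_coeff :: "real \<Rightarrow> (real \<Rightarrow> real) \<Rightarrow> nat \<Rightarrow> real" where
  "gegenbauer_coeff lam f n =
     1 / gegenbauer_h lam n *
       (LINT x:{-1..1}|lborel. (1 - x\<^sup>2) powr (lam - 1/2) * gegenbauer lam n x * f x)"

definition gegenbauer_proj :: "real \<Rightarrow> (real \<Rightarrow> real) \<Rightarrow> nat \<Rightarrow> real \<Rightarrow> real" where
  "gegenbauer_proj lam f N x = (\<Sum>n=0..N. gegenbauer_coeff lam f n * gegenbauer lam n x)"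

definition chebyshev_coeff :: "(real \<Rightarrow> real) \<Rightarrow> nat \<Rightarrow> real" where
  "chebyshev_coeff f n =
     (if n = 0 then 1 / pi * (LINT x:{-1..1}|lborel. f x / sqrt (1 - x\<^sup>2))
      else 2 / pi * (LINT x:{-1..1}|lborel. f x * chebyshev_T n x / sqrt (1 - x\<^sup>2)))"

definition chebyshev_proj :: "(real \<Rightarrow> real) \<Rightarrow> nat \<Rightarrow> real \<Rightarrow> real" where
  "chebyshev_proj f N x = (\<Sum>n=0..N. chebyshev_coeff f n * chebyshev_T n x)"

definition gegenbauer_error :: "real \<Rightarrow> (real \<Rightarrow> real) \<Rightarrow> nat \<Rightarrow> real" where
  "gegenbauer_error lam f N =
     weighted_L2_norm (gegenbauer_weight lam) (\<lambda>x. f x - gegenbauer_proj lam f N x)"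

definition chebyshev_error :: "(real \<Rightarrow> real) \<Rightarrow> nat \<Rightarrow> real" where
  "chebyshev_error f N =
     weighted_L2_norm chebyshev_weight (\<lambda>x. f x - chebyshev_proj f N x)"

end

theory Submission
  imports Defs
begin

text \<open>
  The projection is the best approximation in the weighted \<open>L\<^sup>2\<close> norm, so it suffices to exhibit
  good polynomials. Write \<open>\<omega>\<^sub>\<lambda>\<close> for the weight. The eigenpolynomials of the Sturm--Liouville
  operator have as derivatives the eigenpolynomials for \<open>\<lambda> + 1\<close>; hence, up to an arbitrarily small
  error, a \<open>C\<^sup>m\<close> function has squared distance at most \<open>4 N\<^sup>-\<^sup>2\<^sup>m \<integral> \<omega>\<^sub>\<lambda>\<^sub>+\<^sub>m (f\<^sup>(\<^sup>m\<^sup>))\<^sup>2\<close> from the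
  polynomials of degree \<open>N + m\<close>.

  Near a singularity \<open>c\<close> put \<open>h = N\<^sup>-\<^sup>\<theta>\<close>, with \<open>\<theta> = 2\<close> at an endpoint and \<open>\<theta> = 1\<close> inside, and replace
  the singular factor by a \<open>C\<^sup>m\<close> function on \<open>\<bar>x - c\<bar> \<le> h\<close>. The part cut off is small by direct
  integration, the remaining part by the bound above, and both contributions scale like the same
  power of \<open>h\<close>. Logarithms are handled by \<open>ln \<bar>x - c\<bar> = ln (\<bar>x - c\<bar> / h) + ln h\<close>.
\<close>

section \<open>Gegenbauer weights and Sturm--Liouville families\<close>

text \<open>Best approximation avoids asymptotics of the coefficients of \<open>f\<close>; upper
  bounds for weighted integrals near the singularity suffice. The values of \<theta> come from a
  balance. If the weights for \<open>lam\<close> and \<open>lam + m\<close> have orders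
  \<open>e\<close> and \<open>em\<close> in the distance to \<open>c\<close>, the part cut off has
  squared norm at most of order \<open>h powr (2 * a + e + 1)\<close>, while the remaining part
  costs \<open>h powr (2 * a - 2 * m + em + 1) / N ^ (2 * m)\<close>. At an endpoint
  \<open>em = e + m\<close>, since each derivative brings one more factor 1 - x^2; inside,
  \<open>e = em = 0\<close>. Equating the two terms gives the two choices of \<open>h\<close>.

  Orthogonal expansions are used for polynomials only. Weierstrass approximation of the
  \<open>m\<close>-th derivative carries the estimate over to C^m functions, which is the source of
  the arbitrarily small error.

  In the standard normalisation \<open>gegenbauer 0 n\<close> vanishes for \<open>n > 0\<close>, so
  the Chebyshev polynomials are not the case \<open>lam = 0\<close> of the Gegenbauer ones. The
  estimates are therefore proved for an abstract family of eigenpolynomials, of which both kinds are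
  instances.\<close>

definition gegenbauer_measure :: "real \<Rightarrow> real measure" where
  "gegenbauer_measure lam = density lborel (\<lambda>x. ennreal (indicator {-1..1} x * gegenbauer_weight lam x))"

lemma borel_weight [measurable]: "gegenbauer_weight lam \<in> borel_measurable borel"
  unfolding gegenbauer_weight_def by measurable

lemma weight_nonneg: "0 \<le> gegenbauer_weight lam x"
  by (simp add: gegenbauer_weight_def)

text \<open>The substitution t = (1 + x) / 2 gives 1 - x^2 = 4 t (1 - t), so the weight becomes a
  Beta density with both parameters \<open>lam + 1/2\<close>, which are positive exactly under the
  hypothesis.\<close>

lemma weight_integrable:
  assumes "lam > - 1/2"
  shows "integrable lborel (\<lambda>x. indicator {-1..1} x * gegenbauer_weight lam x)"
proof -
  define b where "b = lam - 1/2"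
  define B where "B = (\<lambda>t::real. indicator {0..1} t *\<^sub>R (t powr b * (1 - t) powr b))"
  have "(\<lambda>t::real. t powr b * (1 - t) powr b) integrable_on {0..1}"
    using has_integral_Beta_real[of "lam + 1/2" "lam + 1/2"] assms
    by (auto simp: has_integral_iff b_def)
  then have "(\<lambda>t::real. t powr b * (1 - t) powr b) absolutely_integrable_on {0..1}"
    by (rule nonnegative_absolutely_integrable_1) auto
  then have "integrable lebesgue B"
    unfolding set_integrable_def B_def .
  then have "integrable lborel B"
    by (subst (asm) integrable_completion) (auto simp: B_def)
  from lborel_integrable_real_affine[OF this, of "1/2" "1/2"]
  have "integrable lborel (\<lambda>x. 4 powr b * B (1/2 + 1/2 * x))" by simp
  also have "(\<lambda>x. 4 powr b * B (1/2 + 1/2 * x)) = (\<lambda>x. indicator {-1..1} x * gegenbauer_weight lam x)"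
  proof
    fix x :: real
    show "4 powr b * B (1/2 + 1/2 * x) = indicator {-1..1} x * gegenbauer_weight lam x"
    proof (cases "x \<in> {-1..1}")
      case True
      have "4 powr b * ((1/2 + 1/2 * x) powr b * (1 - (1/2 + 1/2 * x)) powr b)
        = (4 * ((1/2 + 1/2 * x) * (1 - (1/2 + 1/2 * x)))) powr b"
        using True by (simp only: powr_mult)
      also have "4 * ((1/2 + 1/2 * x) * (1 - (1/2 + 1/2 * x))) = 1 - x\<^sup>2"
        by (simp add: field_simps power2_eq_square)
      finally show ?thesis using True by (simp add: B_def gegenbauer_weight_def b_def)
    next
      case False
      then have "1/2 + 1/2 * x \<notin> {0..1}" by auto
      with False show ?thesis by (simp add: B_def)
    qed
  qed
  finally show ?thesis .
qed

lemma sets_gegenbauer_measure [simp, measurable_cong]: "sets (gegenbauer_measure lam) = sets borel"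
  by (simp add: gegenbauer_measure_def)

lemma space_gegenbauer_measure [simp]: "space (gegenbauer_measure lam) = UNIV"
  by (simp add: gegenbauer_measure_def)

lemma nn_integral_gegenbauer_measure:
  assumes [measurable]: "f \<in> borel_measurable borel"
  shows "(\<integral>\<^sup>+x. f x \<partial>gegenbauer_measure lam) =
    (\<integral>\<^sup>+x. ennreal (indicator {-1..1} x * gegenbauer_weight lam x) * f x \<partial>lborel)"
  unfolding gegenbauer_measure_def by (subst nn_integral_density) auto

lemma integral_gegenbauer_measure:
  assumes [measurable]: "f \<in> borel_measurable borel"
  shows "integral\<^sup>L (gegenbauer_measure lam) f = (LINT x:{-1..1}|lborel. gegenbauer_weight lam x * f x)"
  unfolding gegenbauer_measure_def set_lebesgue_integral_def
  by (subst integral_density) (auto simp: weight_nonneg mult.assoc)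

lemma integrable_gegenbauer_measure:
  fixes f :: "real \<Rightarrow> real"
  assumes [measurable]: "f \<in> borel_measurable borel"
  shows "integrable (gegenbauer_measure lam) f \<longleftrightarrow> set_integrable lborel {-1..1} (\<lambda>x. gegenbauer_weight lam x * f x)"
  unfolding gegenbauer_measure_def set_integrable_def
  by (subst integrable_density) (auto simp: weight_nonneg mult.assoc)

lemma AE_gegenbauer_measure:
  assumes "AE x in lborel. x \<in> {-1..1} \<longrightarrow> P x"
  shows "AE x in gegenbauer_measure lam. P x"
  unfolding gegenbauer_measure_def using assms by (subst AE_density) (auto elim!: eventually_mono simp: indicator_def)

lemma finite_measure_gegenbauer_measure:
  assumes "lam > - 1/2"
  shows "finite_measure (gegenbauer_measure lam)"
proof
  have "emeasure (gegenbauer_measure lam) (space (gegenbauer_measure lam)) = (\<integral>\<^sup>+x. 1 \<partial>gegenbauer_measure lam)" by simp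
  also have "\<dots> = (\<integral>\<^sup>+x. ennreal (indicator {-1..1} x * gegenbauer_weight lam x) \<partial>lborel)"
    by (subst nn_integral_gegenbauer_measure) auto
  also have "\<dots> < \<infinity>"
    using weight_integrable[OF assms] by (simp add: integrable_iff_bounded weight_nonneg)
  finally show "emeasure (gegenbauer_measure lam) (space (gegenbauer_measure lam)) \<noteq> \<infinity>" by simp
qed

lemma integrable_gegenbauer_measure_bounded:
  fixes f :: "real \<Rightarrow> real"
  assumes "lam > - 1/2" and [measurable]: "f \<in> borel_measurable borel"
    and "\<And>x. x \<in> {-1..1} \<Longrightarrow> \<bar>f x\<bar> \<le> B"
  shows "integrable (gegenbauer_measure lam) f"
proof -
  interpret finite_measure "gegenbauer_measure lam" by (rule finite_measure_gegenbauer_measure) fact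
  show ?thesis
    by (rule integrable_const_bound[where B = B]) (auto intro!: AE_gegenbauer_measure simp: assms(3))
qed

lemma borel_poly [measurable]: "poly p \<in> borel_measurable borel" for p :: "real poly"
  by (intro borel_measurable_continuous_onI continuous_intros)

lemma poly_bounded: "\<exists>B. \<forall>x\<in>{-1..1}. \<bar>poly p x\<bar> \<le> B" for p :: "real poly"
proof -
  have "compact (poly p ` {-1..1})"
    by (intro compact_continuous_image continuous_intros) auto
  from compact_imp_bounded[OF this] show ?thesis
    unfolding bounded_iff by (auto simp: real_norm_def)
qed

lemma integrable_gegenbauer_measure_poly:
  fixes p :: "real poly"
  assumes "lam > - 1/2"
  shows "integrable (gegenbauer_measure lam) (poly p)"
  using poly_bounded[of p] by (auto intro!: integrable_gegenbauer_measure_bounded[OF assms])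

section \<open>The weighted inner product on polynomials\<close>

definition poly_inner :: "real \<Rightarrow> real poly \<Rightarrow> real poly \<Rightarrow> real" where
  "poly_inner lam p q = integral\<^sup>L (gegenbauer_measure lam) (poly (p * q))"

lemma poly_inner_commute: "poly_inner lam p q = poly_inner lam q p"
  by (simp add: poly_inner_def mult.commute)

lemma poly_inner_add_left:
  assumes "lam > - 1/2"
  shows "poly_inner lam (p + r) q = poly_inner lam p q + poly_inner lam r q"
proof -
  have "poly ((p + r) * q) = (\<lambda>x. poly (p * q) x + poly (r * q) x)"
    by (simp add: fun_eq_iff algebra_simps)
  then show ?thesis
    using integrable_gegenbauer_measure_poly[OF assms, of "p * q"] integrable_gegenbauer_measure_poly[OF assms, of "r * q"]
    by (simp add: poly_inner_def del: poly_mult)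
qed

lemma poly_inner_smult_left: "poly_inner lam (smult a p) q = a * poly_inner lam p q"
proof -
  have "poly (smult a p * q) = (\<lambda>x. a * poly (p * q) x)"
    by (simp add: fun_eq_iff algebra_simps)
  then show ?thesis by (simp add: poly_inner_def del: poly_mult)
qed

lemma poly_inner_minus_left: "poly_inner lam (- p) q = - poly_inner lam p q"
  using poly_inner_smult_left[of lam "-1" p q] by simp

lemma poly_inner_zero_left [simp]: "poly_inner lam 0 q = 0"
  using poly_inner_smult_left[of lam 0 0 q] by simp

lemma poly_inner_sum_left:
  "lam > - 1/2 \<Longrightarrow> poly_inner lam (sum P S) q = (\<Sum>i\<in>S. poly_inner lam (P i) q)"
  by (induction S rule: infinite_finite_induct) (auto simp: poly_inner_add_left)

lemma poly_inner_smult_right: "poly_inner lam q (smult a p) = a * poly_inner lam q p"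
  by (simp add: poly_inner_smult_left poly_inner_commute[of lam q])

lemma poly_inner_sum_right:
  "lam > - 1/2 \<Longrightarrow> poly_inner lam q (sum P S) = (\<Sum>i\<in>S. poly_inner lam q (P i))"
  by (simp add: poly_inner_sum_left poly_inner_commute[of lam q])

lemma poly_inner_self_nonneg: "poly_inner lam p p \<ge> 0"
  by (auto simp: poly_inner_def intro!: integral_nonneg_AE)

definition sl_op :: "real \<Rightarrow> real poly \<Rightarrow> real poly" where
  "sl_op lam p = [:1, 0, -1:] * pderiv (pderiv p) - smult (2 * lam + 1) ([:0, 1:] * pderiv p)"

lemma poly_sl_op: "poly (sl_op lam p) x =
    (1 - x\<^sup>2) * poly (pderiv (pderiv p)) x - (2 * lam + 1) * x * poly (pderiv p) x"
  by (simp add: sl_op_def algebra_simps power2_eq_square)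

text \<open>Green's identity: \<open>sl_op\<close> is the Sturm--Liouville operator
  \<open>y \<mapsto> \<omega>\<^sub>\<lambda>\<^sup>-\<^sup>1 (\<omega>\<^sub>\<lambda>\<^sub>+\<^sub>1 y')'\<close>, and \<open>\<omega>\<^sub>\<lambda>\<^sub>+\<^sub>1\<close> vanishes at both endpoints.\<close>

lemma poly_inner_sl_op:
  assumes lam: "lam > - 1/2"
  shows "poly_inner lam (sl_op lam p) q = - poly_inner (lam + 1) (pderiv p) (pderiv q)"
proof -
  define F where "F = (\<lambda>x. (1 - x\<^sup>2) powr (lam + 1/2) * (poly (pderiv p) x * poly q x))"
  define u where "u = (\<lambda>x. gegenbauer_weight lam x * poly (sl_op lam p * q) x)"
  define v where "v = (\<lambda>x. gegenbauer_weight (lam + 1) x * poly (pderiv p * pderiv q) x)"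
  have lam1: "lam + 1 > - 1/2" using lam by simp
  have iu: "set_integrable lborel {-1..1} u"
    unfolding u_def by (subst integrable_gegenbauer_measure[symmetric]) (simp_all add: integrable_gegenbauer_measure_poly[OF lam] del: poly_mult)
  have iv: "set_integrable lborel {-1..1} v"
    unfolding v_def by (subst integrable_gegenbauer_measure[symmetric]) (simp_all add: integrable_gegenbauer_measure_poly[OF lam1] del: poly_mult)
  \<comment> \<open>The exponent \<open>lam + 1/2\<close> is positive, so \<open>F\<close> is
    continuous up to the endpoints. Its derivative involves the exponent \<open>lam - 1/2\<close>
    and may blow up there, hence differentiation only in the interior.\<close>
  have cont: "continuous_on {-1..1} F"
    unfolding F_def using lam
    by (intro continuous_intros continuous_on_powr') (auto simp: abs_square_le_1 abs_le_iff power2_eq_1_iff)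
  have der: "(F has_vector_derivative (u x + v x)) (at x)" if "x \<in> {-1<..<1}" for x
  proof -
    have pos: "1 - x\<^sup>2 > 0" using that by (simp add: abs_square_less_1 abs_less_iff)
    have e1: "(1 - x\<^sup>2) powr (lam + 1/2) = (1 - x\<^sup>2) * (1 - x\<^sup>2) powr (lam - 1/2)"
      using powr_add[of "1 - x\<^sup>2" 1 "lam - 1/2"] pos by (simp add: algebra_simps)
    have e2: "lam + 1/2 - 1 = lam - 1/2" "lam + 1 - 1/2 = lam + 1/2" by simp_all
    have "(F has_real_derivative
       ((lam + 1/2) * (1 - x\<^sup>2) powr (lam + 1/2 - 1) * (- 2 * x) * (poly (pderiv p) x * poly q x)
        + (1 - x\<^sup>2) powr (lam + 1/2) * (poly (pderiv (pderiv p)) x * poly q x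
             + poly (pderiv p) x * poly (pderiv q) x))) (at x)"
      unfolding F_def by (rule derivative_eq_intros refl | use pos in simp)+
    also have "((lam + 1/2) * (1 - x\<^sup>2) powr (lam + 1/2 - 1) * (- 2 * x) * (poly (pderiv p) x * poly q x)
        + (1 - x\<^sup>2) powr (lam + 1/2) * (poly (pderiv (pderiv p)) x * poly q x
             + poly (pderiv p) x * poly (pderiv q) x)) = u x + v x"
      unfolding u_def v_def gegenbauer_weight_def poly_mult poly_sl_op e2 e1
      by (simp add: algebra_simps)
    finally show ?thesis by (simp add: has_real_derivative_iff_has_vector_derivative)
  qed
  have i1: "((\<lambda>x. u x + v x) has_integral F 1 - F (-1)) {-1..1}"
    by (rule fundamental_theorem_of_calculus_interior) (use cont der in auto)
  have i2: "((\<lambda>x. u x + v x) has_integral (integral {-1..1} u + integral {-1..1} v)) {-1..1}"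
    using set_borel_integral_eq_integral(1)[OF iu] set_borel_integral_eq_integral(1)[OF iv]
    by (intro has_integral_add integrable_integral)
  have "F 1 = 0" "F (-1) = 0" by (auto simp: F_def)
  then have "integral {-1..1} u + integral {-1..1} v = 0"
    using has_integral_unique[OF i1 i2] by simp
  moreover have "poly_inner lam (sl_op lam p) q = integral {-1..1} u"
    unfolding poly_inner_def by (subst integral_gegenbauer_measure, simp) (use set_borel_integral_eq_integral[OF iu] in \<open>simp add: u_def\<close>)
  moreover have "poly_inner (lam + 1) (pderiv p) (pderiv q) = integral {-1..1} v"
    unfolding poly_inner_def by (subst integral_gegenbauer_measure, simp) (use set_borel_integral_eq_integral[OF iv] in \<open>simp add: v_def\<close>)
  ultimately show ?thesis by linarith
qed

lemma poly_pderiv_sl_op: "poly (pderiv (sl_op lam p)) x =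
    (1 - x\<^sup>2) * poly (pderiv (pderiv (pderiv p))) x - 2 * x * poly (pderiv (pderiv p)) x
      - (2 * lam + 1) * poly (pderiv p) x - (2 * lam + 1) * x * poly (pderiv (pderiv p)) x"
proof -
  have "(poly (sl_op lam p) has_real_derivative
    (1 - x\<^sup>2) * poly (pderiv (pderiv (pderiv p))) x - 2 * x * poly (pderiv (pderiv p)) x
      - (2 * lam + 1) * poly (pderiv p) x - (2 * lam + 1) * x * poly (pderiv (pderiv p)) x) (at x)"
    unfolding poly_sl_op by (auto intro!: derivative_eq_intros simp: algebra_simps)
  then show ?thesis by (rule DERIV_unique[OF poly_DERIV])
qed

text \<open>Exact degree and the eigenvalue equation, but no normalisation: this admits Gegenbauer
  polynomials for \<open>lam \<noteq> 0\<close>, Chebyshev polynomials for \<open>lam = 0\<close>,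
  and the derivatives of any such family.\<close>

definition sl_family :: "real \<Rightarrow> (nat \<Rightarrow> real poly) \<Rightarrow> bool" where
  "sl_family lam P \<longleftrightarrow> (\<forall>n. degree (P n) = n \<and> P n \<noteq> 0 \<and>
     sl_op lam (P n) = smult (- (real n * (real n + 2 * lam))) (P n))"

text \<open>Differentiating the eigenvalue equation gives the operator for \<open>lam + 1\<close> on
  the derivative, minus \<open>2 * lam + 1\<close> times the derivative; and (n + 1)(n + 1 + 2 lam)
  - (2 lam + 1) = n (n + 2 (lam + 1)).\<close>

lemma sl_family_pderiv:
  assumes "sl_family lam P"
  shows "sl_family (lam + 1) (\<lambda>n. pderiv (P (Suc n)))"
  unfolding sl_family_def
proof (intro allI conjI)
  fix n
  have d: "degree (P (Suc n)) = Suc n" using assms by (auto simp: sl_family_def)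
  show "degree (pderiv (P (Suc n))) = n" by (simp add: degree_pderiv d)
  show "pderiv (P (Suc n)) \<noteq> 0" using d by (simp add: pderiv_eq_0_iff)
  let ?p = "P (Suc n)"
  have "sl_op lam ?p = smult (- (real (Suc n) * (real (Suc n) + 2 * lam))) ?p"
    using assms by (auto simp: sl_family_def)
  from arg_cong[OF this, of pderiv]
  have *: "pderiv (sl_op lam ?p) = smult (- (real (Suc n) * (real (Suc n) + 2 * lam))) (pderiv ?p)"
    by (simp add: pderiv_smult pderiv_minus)
  have "poly (sl_op (lam + 1) (pderiv ?p)) x = poly (smult (- (real n * (real n + 2 * (lam + 1)))) (pderiv ?p)) x" for x
    using arg_cong[OF *, of "\<lambda>p. poly p x"]
    by (simp add: poly_sl_op poly_pderiv_sl_op algebra_simps power2_eq_square)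
  then show "sl_op (lam + 1) (pderiv ?p) = smult (- (real n * (real n + 2 * (lam + 1)))) (pderiv ?p)"
    by (simp add: poly_eq_poly_eq_iff[symmetric] fun_eq_iff)
qed

text \<open>The polynomial \<open>q\<close> is arbitrary: \<open>q = P m\<close> yields
  orthogonality, \<open>q = P n\<close> the ratio of the norms in the two families, and general
  \<open>q\<close> relates the expansion of \<open>q\<close> to that of its derivative.\<close>

lemma poly_inner_pderiv_family:
  assumes "sl_family lam P" "lam > - 1/2"
  shows "poly_inner (lam + 1) (pderiv (P n)) (pderiv q) = real n * (real n + 2 * lam) * poly_inner lam (P n) q"
  using poly_inner_sl_op[OF assms(2), of "P n" q] assms(1) by (simp add: sl_family_def poly_inner_smult_left poly_inner_minus_left)

text \<open>Eigenfunctions for distinct eigenvalues. The difference of the eigenvalues is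
  \<open>(n - m) * (n + m + 2 * lam)\<close>, whose second factor is positive because
  \<open>n + m \<ge> 1\<close> and \<open>2 * lam > - 1\<close>.\<close>

lemma poly_inner_orthogonal:
  assumes P: "sl_family lam P" and lam: "lam > - 1/2" and "n \<noteq> m"
  shows "poly_inner lam (P n) (P m) = 0"
proof -
  have "real n * (real n + 2 * lam) * poly_inner lam (P n) (P m) = real m * (real m + 2 * lam) * poly_inner lam (P n) (P m)"
    using poly_inner_pderiv_family[OF P lam, of n "P m"] poly_inner_pderiv_family[OF P lam, of m "P n"]
    by (simp add: poly_inner_commute[of _ "pderiv (P m)"] poly_inner_commute[of _ "P m"])
  then have "(real n - real m) * (real n + real m + 2 * lam) * poly_inner lam (P n) (P m) = 0"
    by (simp add: algebra_simps)
  moreover have "real n + real m \<ge> 1" using \<open>n \<noteq> m\<close> by linarith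
  ultimately show ?thesis using lam \<open>n \<noteq> m\<close> by auto
qed

lemma sl_family_expansion:
  assumes P: "sl_family lam P"
  shows "degree p \<le> N \<Longrightarrow> \<exists>a. p = (\<Sum>n\<le>N. smult (a n) (P n))"
proof (induction N arbitrary: p)
  case 0
  have "degree (P 0) = 0" "P 0 \<noteq> 0" using P by (auto simp: sl_family_def)
  then obtain c where c: "P 0 = [:c:]" "c \<noteq> 0" by (metis degree_eq_zeroE pCons_0_0)
  from 0 obtain d where "p = [:d:]" by (auto elim: degree_eq_zeroE)
  with c show ?case by (intro exI[of _ "\<lambda>_. d / c"]) simp
next
  case (Suc N)
  have d: "degree (P (Suc N)) = Suc N" "P (Suc N) \<noteq> 0" using P by (auto simp: sl_family_def)
  define c where "c = coeff p (Suc N) / lead_coeff (P (Suc N))"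
  have nz: "lead_coeff (P (Suc N)) \<noteq> 0" using d(2) by (rule leading_coeff_neq_0)
  have "degree (p - smult c (P (Suc N))) \<le> Suc N"
    using Suc.prems d by (intro degree_diff_le) auto
  moreover have "coeff (p - smult c (P (Suc N))) (Suc N) = 0"
    using nz unfolding d(1) c_def by simp
  ultimately have "degree (p - smult c (P (Suc N))) \<le> N"
    by (metis degree_0 le_0_eq le_SucE leading_coeff_0_iff not_le zero_le)
  from Suc.IH[OF this] obtain a where a: "p - smult c (P (Suc N)) = (\<Sum>n\<le>N. smult (a n) (P n))" by auto
  define b where "b = (\<lambda>n. if n \<le> N then a n else c)"
  have "p = (\<Sum>n\<le>N. smult (a n) (P n)) + smult c (P (Suc N))" using a by (simp add: algebra_simps)
  also have "\<dots> = (\<Sum>n\<le>Suc N. smult (b n) (P n))" by (simp add: b_def)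
  finally show ?case by blast
qed

lemma poly_inner_expansion_self:
  assumes P: "sl_family lam P" and lam: "lam > - 1/2" and "finite S"
  shows "poly_inner lam (\<Sum>n\<in>S. smult (a n) (P n)) (\<Sum>n\<in>S. smult (a n) (P n)) = (\<Sum>n\<in>S. (a n)\<^sup>2 * poly_inner lam (P n) (P n))"
proof -
  have "poly_inner lam (smult (a n) (P n)) (\<Sum>k\<in>S. smult (a k) (P k)) = (a n)\<^sup>2 * poly_inner lam (P n) (P n)" if "n \<in> S" for n
  proof -
    have "poly_inner lam (smult (a n) (P n)) (\<Sum>k\<in>S. smult (a k) (P k)) =
        (\<Sum>k\<in>S. a n * (a k * poly_inner lam (P k) (P n)))"
      by (simp add: poly_inner_sum_right[OF lam] poly_inner_smult_left poly_inner_smult_right sum_distrib_left poly_inner_commute[of lam "P n"])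
    also have "\<dots> = (\<Sum>k\<in>S. if k = n then (a n)\<^sup>2 * poly_inner lam (P n) (P n) else 0)"
      using poly_inner_orthogonal[OF P lam] by (intro sum.cong) (auto simp: power2_eq_square)
    also have "\<dots> = (a n)\<^sup>2 * poly_inner lam (P n) (P n)" using that \<open>finite S\<close> by simp
    finally show ?thesis .
  qed
  then show ?thesis by (simp add: poly_inner_sum_left[OF lam])
qed

section \<open>Weighted Poincare inequality and Jackson estimate for polynomials\<close>

lemma pderiv_sum: "pderiv (sum f A) = (\<Sum>x\<in>A. pderiv (f x))"
  using higher_pderiv_sum[of 1 f A] by simp

lemma pderiv_surj: "\<exists>Q. pderiv Q = q \<and> degree Q \<le> Suc (degree q)" for q :: "real poly"
proof -
  define Q where "Q = (\<Sum>i\<le>degree q. monom (coeff q i / real (Suc i)) (Suc i))"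
  have "pderiv Q = (\<Sum>i\<le>degree q. monom (coeff q i) i)"
    unfolding Q_def pderiv_sum by (intro sum.cong) (auto simp: pderiv_monom simp del: of_nat_Suc)
  also have "\<dots> = q" by (rule poly_as_sum_of_monoms)
  finally have "pderiv Q = q" .
  moreover have "degree Q \<le> Suc (degree q)"
    unfolding Q_def by (intro degree_sum_le) (auto intro: order_trans[OF degree_monom_le])
  ultimately show ?thesis by blast
qed

text \<open>Here \<open>p\<close> is the truncated expansion of \<open>f\<close>. Passing to the
  derivative family multiplies the squared norm of the n-th term by its eigenvalue, which is at
  least N^2 on the whole tail.\<close>

lemma poincare_step:
  assumes P: "sl_family lam P" and lam: "lam > - 1/2"
  shows "\<exists>p. degree p \<le> Suc N \<and> (real N)\<^sup>2 * poly_inner lam (f - p) (f - p) \<le> poly_inner (lam + 1) (pderiv f) (pderiv f)"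
proof -
  define M where "M = max (degree f) (Suc N)"
  obtain a where a: "f = (\<Sum>n\<le>M. smult (a n) (P n))"
    using sl_family_expansion[OF P, of f M] by (auto simp: M_def)
  define p where "p = (\<Sum>n\<le>Suc N. smult (a n) (P n))"
  have dP: "degree (P n) = n" for n using P by (auto simp: sl_family_def)
  have "{..M} = {..Suc N} \<union> {Suc N<..M}" by (auto simp: M_def)
  with a have "f = (\<Sum>n\<in>{..Suc N} \<union> {Suc N<..M}. smult (a n) (P n))" by metis
  also have "\<dots> = p + (\<Sum>n\<in>{Suc N<..M}. smult (a n) (P n))"
    unfolding p_def by (rule sum.union_disjoint) auto
  finally have r: "f - p = (\<Sum>n\<in>{Suc N<..M}. smult (a n) (P n))"
    by (simp only: add_diff_cancel_left')
  have g0: "poly_inner lam (P n) (P n) \<ge> 0" for n by (rule poly_inner_self_nonneg)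
  \<comment> \<open>Negative \<open>lam\<close> is harmless, because \<open>2 * lam > - 1\<close>
    and \<open>n \<ge> N + 2\<close>.\<close>
  have mu: "(real N)\<^sup>2 \<le> real n * (real n + 2 * lam)" if "n > Suc N" for n
    unfolding power2_eq_square using that lam by (intro mult_mono) auto
  have "(real N)\<^sup>2 * poly_inner lam (f - p) (f - p) = (\<Sum>n\<in>{Suc N<..M}. (real N)\<^sup>2 * ((a n)\<^sup>2 * poly_inner lam (P n) (P n)))"
    unfolding r by (simp add: poly_inner_expansion_self[OF P lam] sum_distrib_left)
  also have "\<dots> \<le> (\<Sum>n\<in>{Suc N<..M}. real n * (real n + 2 * lam) * ((a n)\<^sup>2 * poly_inner lam (P n) (P n)))"
    using mu g0 by (intro sum_mono mult_right_mono) auto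
  also have "\<dots> \<le> (\<Sum>n\<le>M. real n * (real n + 2 * lam) * ((a n)\<^sup>2 * poly_inner lam (P n) (P n)))"
  proof (rule sum_mono2)
    fix n assume "n \<in> {..M} - {Suc N<..M}"
    \<comment> \<open>For \<open>n = 0\<close> the second factor may be negative, but then the
      product is 0.\<close>
    have "real n * (real n + 2 * lam) \<ge> 0" using lam by (cases n) auto
    then show "0 \<le> real n * (real n + 2 * lam) * ((a n)\<^sup>2 * poly_inner lam (P n) (P n))" using g0 by simp
  qed auto
  also have "\<dots> = (\<Sum>n\<le>M. a n * (a n * poly_inner (lam + 1) (pderiv (P n)) (pderiv (P n))))"
    by (intro sum.cong refl) (simp only: poly_inner_pderiv_family[OF P lam] power2_eq_square mult_ac)
  also have "\<dots> = (\<Sum>n\<le>M. a n * poly_inner (lam + 1) (pderiv (P n)) (pderiv f))"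
  proof (rule sum.cong)
    fix n assume n: "n \<in> {..M}"
    have "poly_inner lam (P n) f = (\<Sum>k\<le>M. a k * poly_inner lam (P n) (P k))"
      by (simp add: a poly_inner_sum_right[OF lam] poly_inner_smult_right)
    also have "\<dots> = (\<Sum>k\<le>M. if k = n then a n * poly_inner lam (P n) (P n) else 0)"
      using poly_inner_orthogonal[OF P lam] by (intro sum.cong) auto
    finally have "poly_inner lam (P n) f = a n * poly_inner lam (P n) (P n)" using n by simp
    then show "a n * (a n * poly_inner (lam + 1) (pderiv (P n)) (pderiv (P n))) =
        a n * poly_inner (lam + 1) (pderiv (P n)) (pderiv f)"
      by (simp add: poly_inner_pderiv_family[OF P lam])
  qed simp
  also have "\<dots> = poly_inner (lam + 1) (pderiv f) (pderiv f)"
  proof -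
    have "pderiv f = (\<Sum>n\<le>M. smult (a n) (pderiv (P n)))"
      by (simp add: a pderiv_sum pderiv_smult)
    then have "poly_inner (lam + 1) (pderiv f) r = (\<Sum>n\<le>M. a n * poly_inner (lam + 1) (pderiv (P n)) r)" for r
      using lam by (simp add: poly_inner_sum_left poly_inner_smult_left)
    then show ?thesis by simp
  qed
  finally have "(real N)\<^sup>2 * poly_inner lam (f - p) (f - p) \<le> poly_inner (lam + 1) (pderiv f) (pderiv f)" .
  moreover have "degree p \<le> Suc N"
    unfolding p_def using dP by (intro degree_sum_le) (auto intro: order_trans[OF degree_smult_le])
  ultimately show ?thesis by blast
qed

text \<open>Each induction step trades one derivative for a factor \<open>1 / N\<close> in the norm
  and raises \<open>lam\<close> by 1: approximate the derivative of \<open>f\<close> by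
  \<open>q\<close>, integrate \<open>q\<close> to \<open>Q\<close>, and apply the Poincare
  inequality to \<open>f - Q\<close>, whose derivative is the error just estimated. Every
  integration raises the degree by one, hence \<open>N + m\<close>.\<close>

lemma jackson_poly:
  assumes "sl_family lam P" and "lam > - 1/2"
  shows "\<exists>p. degree p \<le> N + m \<and>
    real N ^ (2 * m) * poly_inner lam (f - p) (f - p) \<le> poly_inner (lam + m) ((pderiv ^^ m) f) ((pderiv ^^ m) f)"
  using assms
proof (induction m arbitrary: lam P f)
  case 0
  then show ?case by (intro exI[of _ 0]) auto
next
  case (Suc m)
  have lam1: "lam + 1 > - 1/2" using Suc.prems by simp
  obtain q where q: "degree q \<le> N + m"
    and qb: "real N ^ (2 * m) * poly_inner (lam + 1) (pderiv f - q) (pderiv f - q)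
       \<le> poly_inner (lam + 1 + m) ((pderiv ^^ m) (pderiv f)) ((pderiv ^^ m) (pderiv f))"
    using Suc.IH[OF sl_family_pderiv[OF Suc.prems(1)] lam1] by blast
  obtain Q where Q: "pderiv Q = q" "degree Q \<le> Suc (degree q)" using pderiv_surj by blast
  obtain p where p: "degree p \<le> Suc (N + m)"
    and pb: "(real (N + m))\<^sup>2 * poly_inner lam (f - Q - p) (f - Q - p) \<le> poly_inner (lam + 1) (pderiv (f - Q)) (pderiv (f - Q))"
    using poincare_step[OF Suc.prems] by blast
  have "real N ^ (2 * Suc m) * poly_inner lam (f - (Q + p)) (f - (Q + p))
      = real N ^ (2 * m) * ((real N)\<^sup>2 * poly_inner lam (f - Q - p) (f - Q - p))"
    by (simp add: algebra_simps power2_eq_square diff_diff_eq)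
  also have "\<dots> \<le> real N ^ (2 * m) * ((real (N + m))\<^sup>2 * poly_inner lam (f - Q - p) (f - Q - p))"
    by (intro mult_left_mono mult_right_mono power_mono poly_inner_self_nonneg) auto
  also have "\<dots> \<le> real N ^ (2 * m) * poly_inner (lam + 1) (pderiv f - q) (pderiv f - q)"
    using pb by (intro mult_left_mono) (auto simp: pderiv_diff Q)
  also note qb
  also have "poly_inner (lam + 1 + m) ((pderiv ^^ m) (pderiv f)) ((pderiv ^^ m) (pderiv f))
     = poly_inner (lam + Suc m) ((pderiv ^^ Suc m) f) ((pderiv ^^ Suc m) f)"
    by (simp add: funpow_Suc_right add.assoc add.commute[of 1] del: funpow.simps)
  finally have "real N ^ (2 * Suc m) * poly_inner lam (f - (Q + p)) (f - (Q + p)) \<le> \<dots>" .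
  moreover have "degree (Q + p) \<le> N + Suc m"
    using Q(2) q p by (intro degree_add_le) auto
  ultimately show ?case by blast
qed

section \<open>Jackson inequalities\<close>

text \<open>A C^m function with its derivatives as explicit data. They are taken within
  \<open>S\<close>, hence one-sided at the ends of an interval, and the Leibniz and chain rules
  produce new chains by formulas.\<close>

definition deriv_chain :: "nat \<Rightarrow> real set \<Rightarrow> (nat \<Rightarrow> real \<Rightarrow> real) \<Rightarrow> bool" where
  "deriv_chain m S F \<longleftrightarrow>
     (\<forall>j<m. \<forall>x\<in>S. (F j has_real_derivative F (Suc j) x) (at x within S)) \<and> continuous_on S (F m)"

lemma real_polynomial_function_poly:
  assumes "real_polynomial_function f"
  obtains p :: "real poly" where "\<And>x. f x = poly p x"
proof -
  obtain a n where f: "f = (\<lambda>x. \<Sum>i\<le>n. a i * x ^ i)"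
    using real_polynomial_function_imp_sum[OF assms] by blast
  show ?thesis
    by (rule that[of "\<Sum>i\<le>n. monom (a i) i"]) (simp add: f poly_sum poly_monom)
qed

text \<open>Approximating \<open>F 0\<close> directly would say nothing about derivatives, so the
  top derivative is approximated and integrated \<open>m\<close> times. The interval has length 2,
  so every integration at most doubles the error; hence \<open>e/2\<close> in the induction
  hypothesis.\<close>

lemma weierstrass_deriv_chain:
  assumes "deriv_chain m {-1..1} F" and "e > 0"
  shows "\<exists>Q. \<forall>x\<in>{-1..1}. \<bar>F 0 x - poly Q x\<bar> \<le> e \<and> \<bar>F m x - poly ((pderiv ^^ m) Q) x\<bar> \<le> e"
  using assms
proof (induction m arbitrary: F e)
  case 0
  then have "continuous_on {-1..1} (F 0)" by (simp add: deriv_chain_def)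
  then obtain g where g: "real_polynomial_function g" "\<And>x. x \<in> {-1..1} \<Longrightarrow> \<bar>F 0 x - g x\<bar> < e"
    using Stone_Weierstrass_real_polynomial_function[of "{-1..1::real}" "F 0" e] 0 by auto
  obtain p where "\<And>x. g x = poly p x" using real_polynomial_function_poly[OF g(1)] by blast
  with g(2) show ?case by (intro exI[of _ p]) (auto intro: less_imp_le)
next
  case (Suc m)
  have "deriv_chain m {-1..1} (\<lambda>j. F (Suc j))" using Suc.prems by (auto simp: deriv_chain_def)
  then have "\<exists>q. \<forall>x\<in>{-1..1}. \<bar>F (Suc 0) x - poly q x\<bar> \<le> e/2 \<and> \<bar>F (Suc m) x - poly ((pderiv ^^ m) q) x\<bar> \<le> e/2"
    by (rule Suc.IH) (use Suc.prems(2) in simp)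
  then obtain q where q: "\<And>x. x \<in> {-1..1} \<Longrightarrow> \<bar>F (Suc 0) x - poly q x\<bar> \<le> e/2"
      "\<And>x. x \<in> {-1..1} \<Longrightarrow> \<bar>F (Suc m) x - poly ((pderiv ^^ m) q) x\<bar> \<le> e/2"
    by blast
  obtain Q0 where Q0: "pderiv Q0 = q" using pderiv_surj by blast
  \<comment> \<open>The constant of integration makes \<open>Q\<close> agree with \<open>F 0\<close>
    at the left endpoint, from where the mean value bound is taken.\<close>
  define Q where "Q = Q0 + [:F 0 (-1) - poly Q0 (-1):]"
  have Q: "pderiv Q = q" "poly Q (-1) = F 0 (-1)" by (auto simp: Q_def pderiv_add Q0)
  have d: "((\<lambda>x. F 0 x - poly Q x) has_real_derivative (F (Suc 0) x - poly q x)) (at x within {-1..1})"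
    if "x \<in> {-1..1}" for x
    using Suc.prems(1) that unfolding deriv_chain_def Q(1)[symmetric]
    by (intro DERIV_diff) (auto intro: has_field_derivative_at_within)
  have "\<bar>F 0 x - poly Q x\<bar> \<le> e" if x: "x \<in> {-1..1}" for x
  proof -
    have "norm ((F 0 x - poly Q x) - (F 0 (-1) - poly Q (-1))) \<le> e/2 * norm (x - (-1))"
      by (rule field_differentiable_bound[where S = "{-1..1}"]) (use d q x in auto)
    also have "\<dots> \<le> e/2 * 2" using x Suc.prems(2) by (intro mult_left_mono) auto
    finally show ?thesis by (simp add: Q)
  qed
  moreover have "\<bar>F (Suc m) x - poly ((pderiv ^^ Suc m) Q) x\<bar> \<le> e" if "x \<in> {-1..1}" for x
    using q(2)[OF that] Suc.prems(2) by (simp add: funpow_Suc_right Q del: funpow.simps)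
  ultimately show ?case by blast
qed

lemma nn_integral_gegenbauer_measure_poly_square:
  assumes "lam > - 1/2"
  shows "(\<integral>\<^sup>+x. ennreal ((poly p x)\<^sup>2) \<partial>gegenbauer_measure lam) = ennreal (poly_inner lam p p)"
  unfolding poly_inner_def power2_eq_square using integrable_gegenbauer_measure_poly[OF assms, of "p * p"]
  by (subst nn_integral_eq_integral[symmetric]) auto

lemma nn_integral_const_add:
  assumes "(\<integral>\<^sup>+x. ennreal (f x) \<partial>M) \<le> ennreal B" "f \<in> borel_measurable M" "\<And>x. f x \<ge> 0" "B \<ge> 0"
    and "emeasure M (space M) \<le> ennreal W" "a \<ge> 0" "c \<ge> 0" "W \<ge> 0"
  shows "(\<integral>\<^sup>+x. ennreal (a + c * f x) \<partial>M) \<le> ennreal (a * W + c * B)"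
proof -
  have "(\<integral>\<^sup>+x. ennreal (a + c * f x) \<partial>M) = (\<integral>\<^sup>+x. (ennreal a + ennreal c * ennreal (f x)) \<partial>M)"
    using assms by (simp add: ennreal_plus ennreal_mult)
  also have "\<dots> = ennreal a * emeasure M (space M) + ennreal c * (\<integral>\<^sup>+x. ennreal (f x) \<partial>M)"
    using assms(2) by (simp add: nn_integral_add nn_integral_cmult)
  also have "\<dots> \<le> ennreal a * ennreal W + ennreal c * ennreal B"
    by (intro add_mono mult_left_mono assms) auto
  also have "\<dots> = ennreal (a * W + c * B)"
    using assms by (simp add: ennreal_plus ennreal_mult)
  finally show ?thesis .
qed

lemma gegenbauer_measure_mass:
  assumes "lam > - 1/2"
  obtains W where "W \<ge> 0" "emeasure (gegenbauer_measure lam) (space (gegenbauer_measure lam)) \<le> ennreal W"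
  using finite_measure.emeasure_eq_measure[OF finite_measure_gegenbauer_measure[OF assms]] by (metis measure_nonneg order_refl)

lemma square_add_le: "(x + y)\<^sup>2 \<le> 2 * x\<^sup>2 + 2 * y\<^sup>2" for x y :: real
  using zero_le_power2[of "x - y"] by (simp add: power2_eq_square algebra_simps)

text \<open>The polynomial estimate is applied to a polynomial \<open>Q\<close> close to
  \<open>F 0\<close> whose \<open>m\<close>-th derivative is close to \<open>F m\<close>. The factor
  4 arises from two uses of \<open>square_add_le\<close>, one for each weight. As \<open>F m\<close>
  is controlled on the interval only, a majorant \<open>G\<close> that is Borel on the whole line is
  integrated instead.\<close>

lemma jackson_smooth:
  assumes P: "sl_family lam P" and lam: "lam > - 1/2" and F: "deriv_chain m {-1..1} F"
    and N: "N > 0" and eta: "eta > 0"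
    and G: "G \<in> borel_measurable borel" "\<And>x. G x \<ge> 0" "\<And>x. x \<in> {-1..1} \<Longrightarrow> (F m x)\<^sup>2 \<le> G x"
    and B: "(\<integral>\<^sup>+x. ennreal (G x) \<partial>gegenbauer_measure (lam + m)) \<le> ennreal B" "B \<ge> 0"
  shows "\<exists>p. degree p \<le> N + m \<and>
    (\<integral>\<^sup>+x. ennreal ((F 0 x - poly p x)\<^sup>2) \<partial>gegenbauer_measure lam) \<le> ennreal (4 * B / real N ^ (2 * m) + eta)"
proof -
  have lamm: "lam + m > - 1/2" using lam by simp
  obtain W1 where W1: "W1 \<ge> 0" "emeasure (gegenbauer_measure lam) (space (gegenbauer_measure lam)) \<le> ennreal W1"
    using gegenbauer_measure_mass[OF lam] .
  obtain W2 where W2: "W2 \<ge> 0" "emeasure (gegenbauer_measure (lam + m)) (space (gegenbauer_measure (lam + m))) \<le> ennreal W2"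
    using gegenbauer_measure_mass[OF lamm] .
  \<comment> \<open>The uniform errors contribute \<open>e\<^sup>2 * (2 * W1 + 4 * W2)\<close> in
    total; the additional 1 keeps the denominator positive.\<close>
  define e where "e = sqrt (eta / (2 * W1 + 4 * W2 + 1))"
  have e: "e > 0" and e2: "e\<^sup>2 = eta / (2 * W1 + 4 * W2 + 1)"
    using eta W1 W2 by (auto simp: e_def)
  obtain Q where Q: "\<And>x. x \<in> {-1..1} \<Longrightarrow> \<bar>F 0 x - poly Q x\<bar> \<le> e"
      "\<And>x. x \<in> {-1..1} \<Longrightarrow> \<bar>F m x - poly ((pderiv ^^ m) Q) x\<bar> \<le> e"
    using weierstrass_deriv_chain[OF F e] by blast
  let ?Q = "(pderiv ^^ m) Q"
  obtain p where p: "degree p \<le> N + m"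
    and pb: "real N ^ (2 * m) * poly_inner lam (Q - p) (Q - p) \<le> poly_inner (lam + m) ?Q ?Q"
    using jackson_poly[OF P lam] by blast
  have sq: "y\<^sup>2 \<le> 2 * e\<^sup>2 + 2 * z\<^sup>2" if "\<bar>z - y\<bar> \<le> e \<or> \<bar>y - z\<bar> \<le> e" for y z
  proof -
    have "(y - z)\<^sup>2 \<le> e\<^sup>2" using that e by (intro power2_le_iff_abs_le[THEN iffD2]) auto
    with square_add_le[of "y - z" z] show ?thesis by simp
  qed
  have "ennreal (poly_inner (lam + m) ?Q ?Q) = (\<integral>\<^sup>+x. ennreal ((poly ?Q x)\<^sup>2) \<partial>gegenbauer_measure (lam + m))"
    by (simp add: nn_integral_gegenbauer_measure_poly_square[OF lamm])
  also have "\<dots> \<le> (\<integral>\<^sup>+x. ennreal (2 * e\<^sup>2 + 2 * G x) \<partial>gegenbauer_measure (lam + m))"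
  proof (intro nn_integral_mono_AE AE_gegenbauer_measure AE_I2 impI ennreal_leI)
    fix x :: real assume x: "x \<in> {-1..1}"
    show "(poly ?Q x)\<^sup>2 \<le> 2 * e\<^sup>2 + 2 * G x"
      using sq[of "F m x" "poly ?Q x"] Q(2)[OF x] G(3)[OF x] by auto
  qed
  also have "\<dots> \<le> ennreal (2 * e\<^sup>2 * W2 + 2 * B)"
    using B G W2 by (intro nn_integral_const_add) auto
  finally have gQ: "poly_inner (lam + m) ?Q ?Q \<le> 2 * e\<^sup>2 * W2 + 2 * B"
    using W2 B by (subst (asm) ennreal_le_iff) auto
  have N1: "real N ^ (2 * m) \<ge> 1" using N by simp
  have "poly_inner lam (Q - p) (Q - p) \<le> (2 * e\<^sup>2 * W2 + 2 * B) / real N ^ (2 * m)"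
    using pb gQ N by (simp add: field_simps)
  also have "\<dots> \<le> 2 * e\<^sup>2 * W2 + 2 * B / real N ^ (2 * m)"
    using divide_left_mono[of 1 "real N ^ (2 * m)" "2 * e\<^sup>2 * W2"] N1 N W2 by (simp add: add_divide_distrib)
  finally have gp: "poly_inner lam (Q - p) (Q - p) \<le> 2 * e\<^sup>2 * W2 + 2 * B / real N ^ (2 * m)" .
  have "(\<integral>\<^sup>+x. ennreal ((F 0 x - poly p x)\<^sup>2) \<partial>gegenbauer_measure lam)
      \<le> (\<integral>\<^sup>+x. ennreal (2 * e\<^sup>2 + 2 * (poly (Q - p) x)\<^sup>2) \<partial>gegenbauer_measure lam)"
  proof (intro nn_integral_mono_AE AE_gegenbauer_measure AE_I2 impI ennreal_leI)
    fix x :: real assume x: "x \<in> {-1..1}"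
    show "(F 0 x - poly p x)\<^sup>2 \<le> 2 * e\<^sup>2 + 2 * (poly (Q - p) x)\<^sup>2"
      using Q(1)[OF x] by (intro sq) auto
  qed
  also have "\<dots> \<le> ennreal (2 * e\<^sup>2 * W1 + 2 * poly_inner lam (Q - p) (Q - p))"
    using W1 by (intro nn_integral_const_add)
      (auto simp: nn_integral_gegenbauer_measure_poly_square[OF lam] poly_inner_self_nonneg simp del: poly_diff)
  also have "\<dots> \<le> ennreal (4 * B / real N ^ (2 * m) + eta)"
  proof (rule ennreal_leI)
    have "2 * e\<^sup>2 * W1 + 2 * poly_inner lam (Q - p) (Q - p) \<le> 4 * B / real N ^ (2 * m) + e\<^sup>2 * (2 * W1 + 4 * W2)"
    proof -
      have "4 * B / real N ^ (2 * m) = 2 * (2 * B / real N ^ (2 * m))" by simp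
      moreover have "e\<^sup>2 * (2 * W1 + 4 * W2) = 2 * e\<^sup>2 * W1 + 2 * (2 * e\<^sup>2 * W2)" by algebra
      ultimately show ?thesis using gp by linarith
    qed
    also have "e\<^sup>2 * (2 * W1 + 4 * W2) \<le> e\<^sup>2 * (2 * W1 + 4 * W2 + 1)" by (simp add: mult_left_mono)
    also have "\<dots> = eta" using W1 W2 by (simp add: e2)
    finally show "2 * e\<^sup>2 * W1 + 2 * poly_inner lam (Q - p) (Q - p) \<le> 4 * B / real N ^ (2 * m) + eta" by simp
  qed
  finally show ?thesis using p by blast
qed

section \<open>Smooth regularisation of a power-logarithm\<close>

lemma deriv_chain_mult:
  assumes "deriv_chain m S A" "deriv_chain m S B"
  shows "deriv_chain m S (\<lambda>j x. \<Sum>k\<le>j. real (j choose k) * (A k x * B (j - k) x))"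
proof -
  have cont: "continuous_on S (A k)" if "deriv_chain m S A" "k \<le> m" for k and A :: "nat \<Rightarrow> real \<Rightarrow> real"
  proof (cases "k = m")
    case False
    then show ?thesis using that unfolding deriv_chain_def
      by (intro DERIV_continuous_on[of S "A k" "A (Suc k)"]) auto
  qed (use that in \<open>auto simp: deriv_chain_def\<close>)
  note cA = cont[OF assms(1)] and cB = cont[OF assms(2)]
  have "((\<lambda>x. \<Sum>k\<le>j. real (j choose k) * (A k x * B (j - k) x)) has_real_derivative
      (\<Sum>k\<le>Suc j. real (Suc j choose k) * (A k x * B (Suc j - k) x))) (at x within S)"
    if "j < m" "x \<in> S" for j x
  proof -
    have dA: "(A k has_real_derivative A (Suc k) x) (at x within S)" if "k \<le> j" for k
      using assms(1) that \<open>j < m\<close> \<open>x \<in> S\<close> by (auto simp: deriv_chain_def)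
    have dB: "(B (j - k) has_real_derivative B (Suc j - k) x) (at x within S)" if "k \<le> j" for k
      using assms(2) that \<open>j < m\<close> \<open>x \<in> S\<close> by (auto simp: deriv_chain_def Suc_diff_le)
    have "((\<lambda>x. \<Sum>k\<le>j. real (j choose k) * (A k x * B (j - k) x)) has_real_derivative
       (\<Sum>k\<le>j. real (j choose k) * (A (Suc k) x * B (j - k) x + B (Suc j - k) x * A k x))) (at x within S)"
      by (intro DERIV_sum DERIV_cmult DERIV_mult dA dB) auto
    also have "(\<Sum>k\<le>j. real (j choose k) * (A (Suc k) x * B (j - k) x + B (Suc j - k) x * A k x))
      = (\<Sum>k\<le>j. real (j choose k) * (A (Suc k) x * B (j - k) x))
        + (\<Sum>k\<le>j. real (j choose k) * (A k x * B (Suc j - k) x))"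
      by (simp add: sum.distrib[symmetric] algebra_simps)
    \<comment> \<open>The added term has the coefficient \<open>j choose Suc j\<close>, which is 0.
      It allows the index shift after which Pascal's rule combines the two sums.\<close>
    also have "(\<Sum>k\<le>j. real (j choose k) * (A k x * B (Suc j - k) x))
      = (\<Sum>k\<le>Suc j. real (j choose k) * (A k x * B (Suc j - k) x))" by simp
    also have "\<dots> = A 0 x * B (Suc j) x + (\<Sum>k\<le>j. real (j choose Suc k) * (A (Suc k) x * B (j - k) x))"
      by (subst sum.atMost_Suc_shift) simp
    also have "(\<Sum>k\<le>j. real (j choose k) * (A (Suc k) x * B (j - k) x)) + \<dots>
      = A 0 x * B (Suc j) x + (\<Sum>k\<le>j. real (Suc j choose Suc k) * (A (Suc k) x * B (j - k) x))"
      by (simp add: sum.distrib[symmetric] algebra_simps)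
    also have "\<dots> = (\<Sum>k\<le>Suc j. real (Suc j choose k) * (A k x * B (Suc j - k) x))"
      by (subst sum.atMost_Suc_shift) simp
    finally show ?thesis .
  qed
  then show ?thesis
    unfolding deriv_chain_def by (auto intro!: continuous_intros cA cB)
qed

lemma deriv_chain_affine:
  assumes "deriv_chain m UNIV F"
  shows "deriv_chain m S (\<lambda>j x. a ^ j * F j (a * x + b))"
proof -
  have "((\<lambda>x. a ^ j * F j (a * x + b)) has_real_derivative a ^ Suc j * F (Suc j) (a * x + b)) (at x within S)"
    if "j < m" for j x
  proof -
    have "(F j has_real_derivative F (Suc j) (a * x + b)) (at (a * x + b))"
      using assms that by (auto simp: deriv_chain_def)
    then have "((\<lambda>x. F j (a * x + b)) has_real_derivative F (Suc j) (a * x + b) * a) (at x within S)"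
      by (rule DERIV_chain2) (auto intro!: derivative_eq_intros)
    from DERIV_cmult[OF this, of "a ^ j"] show ?thesis by (simp add: mult_ac)
  qed
  moreover have "continuous_on S (\<lambda>x. a ^ m * F m (a * x + b))"
    using assms by (auto simp: deriv_chain_def intro!: continuous_intros continuous_on_compose2[of UNIV "F m"])
  ultimately show ?thesis by (auto simp: deriv_chain_def)
qed

section \<open>Gluing of derivatives and two-point Hermite interpolation\<close>

lemma deriv_glue:
  fixes A B :: "real \<Rightarrow> real"
  assumes "(A has_real_derivative D) (at c)" "(B has_real_derivative D) (at c)" "A c = B c"
  shows "((\<lambda>x. if x \<le> c then A x else B x) has_real_derivative D) (at c)"
proof -
  let ?f = "\<lambda>x. if x \<le> c then A x else B x"
  have "((\<lambda>x. (?f x - ?f c) / (x - c)) \<longlongrightarrow> D) (at_left c)"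
  proof (rule Lim_transform_eventually)
    show "((\<lambda>x. (A x - A c) / (x - c)) \<longlongrightarrow> D) (at_left c)"
      using assms(1) unfolding has_field_derivative_iff by (rule tendsto_mono[OF at_le, rotated]) auto
  qed (auto simp: eventually_at_filter)
  moreover have "((\<lambda>x. (?f x - ?f c) / (x - c)) \<longlongrightarrow> D) (at_right c)"
  proof (rule Lim_transform_eventually)
    show "((\<lambda>x. (B x - B c) / (x - c)) \<longlongrightarrow> D) (at_right c)"
      using assms(2) unfolding has_field_derivative_iff by (rule tendsto_mono[OF at_le, rotated]) auto
  qed (auto simp: eventually_at_filter assms)
  ultimately show ?thesis
    unfolding has_field_derivative_iff by (rule filterlim_split_at)
qed

lemma deriv_if_open:
  assumes "(A has_real_derivative D) (at x)" "open S" "x \<in> S" "\<And>y. y \<in> S \<Longrightarrow> f y = A y"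
  shows "(f has_real_derivative D) (at x)"
  using DERIV_cong_ev[of x x f A D D] assms eventually_nhds by (metis (mono_tags, lifting))

text \<open>Each differentiation lowers the order of the root by at most one.\<close>

lemma root_power_higher_pderiv:
  "[:- c, 1:] ^ n dvd p \<Longrightarrow> k < n \<Longrightarrow> poly ((pderiv ^^ k) p) c = 0" for c :: real
proof (induction k arbitrary: n p)
  case 0
  then obtain q where "p = [:- c, 1:] ^ n * q" by (auto elim: dvdE)
  with 0 show ?case by (simp add: power_0_left)
next
  case (Suc k)
  then obtain n' where n: "n = Suc n'" by (cases n) auto
  obtain q where q: "p = [:- c, 1:] ^ Suc n' * q" using Suc.prems n by (auto elim: dvdE)
  have "pderiv p = [:- c, 1:] ^ n' * ([:- c, 1:] * pderiv q + smult (real (Suc n')) q)"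
    unfolding q pderiv_mult pderiv_power_Suc by (simp add: pderiv_pCons algebra_simps)
  then have "[:- c, 1:] ^ n' dvd pderiv p" by (metis dvd_triv_left)
  with Suc.IH[of n' "pderiv p"] Suc.prems n show ?case by (simp add: funpow_Suc_right del: funpow.simps)
qed

text \<open>Integrating an interpolant of the derivative data leaves one free constant for the two
  values at 1 and -1. The second degree of freedom is a multiple of \<open>U\<close>, whose
  derivative \<open>w\<close> is a power of x^2 - 1 and vanishes to high order at both nodes, so
  that adding it disturbs no derivative data.\<close>

lemma hermite_interpolation:
  fixes al be :: "nat \<Rightarrow> real"
  shows "\<exists>T. \<forall>k\<le>m. poly ((pderiv ^^ k) T) 1 = al k \<and> poly ((pderiv ^^ k) T) (-1) = be k"
proof (induction m arbitrary: al be)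
  case 0
  show ?case
    by (intro exI[of _ "[:(al 0 + be 0) / 2, (al 0 - be 0) / 2:]"]) (simp add: field_simps)
next
  case (Suc m)
  obtain T1 where T1: "\<And>k. k \<le> m \<Longrightarrow> poly ((pderiv ^^ k) T1) 1 = al (Suc k)"
      "\<And>k. k \<le> m \<Longrightarrow> poly ((pderiv ^^ k) T1) (-1) = be (Suc k)"
    using Suc.IH[of "\<lambda>k. al (Suc k)" "\<lambda>k. be (Suc k)"] by auto
  obtain T0 where T0: "pderiv T0 = T1" using pderiv_surj by blast
  \<comment> \<open>The even exponent makes \<open>w\<close> positive between the nodes, so
    \<open>U\<close> takes different values at them.\<close>
  define w where "w = ([:-1, 1:] * [:- (-1), 1:] :: real poly) ^ (2 * Suc m)"
  obtain U where U: "pderiv U = w" using pderiv_surj by blast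
  have "[:- c, 1:] ^ (2 * Suc m) dvd w" if "c = 1 \<or> c = -1" for c
    using that unfolding w_def power_mult_distrib by (metis dvd_triv_left dvd_triv_right)
  from root_power_higher_pderiv[OF this]
  have w0: "poly ((pderiv ^^ k) w) 1 = 0" "poly ((pderiv ^^ k) w) (-1) = 0" if "k \<le> m" for k
    using that by auto
  have "poly U (-1) < poly U 1"
  proof -
    obtain x where x: "-1 < x" "x < 1" "poly U 1 - poly U (-1) = 2 * poly w x"
      using poly_MVT[of "-1" 1 U] U by auto
    have "poly w x = ((x - 1) * (x + 1)) ^ (2 * Suc m)" by (simp add: w_def algebra_simps)
    also have "\<dots> > 0" using x by (subst zero_less_power_eq) auto
    finally show ?thesis using x by linarith
  qed
  then obtain t where t: "t * (poly U 1 - poly U (-1)) = al 0 - be 0 - (poly T0 1 - poly T0 (-1))"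
    by (metis diff_gt_0_iff_gt nonzero_divide_eq_eq order_less_irrefl)
  define T where "T = T0 + smult t U + [:al 0 - poly T0 1 - t * poly U 1:]"
  have dT: "pderiv T = T1 + smult t w" by (simp add: T_def pderiv_add pderiv_smult T0 U)
  have "poly ((pderiv ^^ k) T) 1 = al k \<and> poly ((pderiv ^^ k) T) (-1) = be k" if "k \<le> Suc m" for k
  proof (cases k)
    case 0
    then show ?thesis using t by (simp add: T_def algebra_simps)
  next
    case (Suc k')
    then show ?thesis using that T1[of k'] w0[of k']
      by (simp add: funpow_Suc_right dT higher_pderiv_add higher_pderiv_smult del: funpow.simps)
  qed
  then show ?case by blast
qed

text \<open>\<open>powlog_poly a i k\<close> is the polynomial \<open>p\<close> for which the \<open>k\<close>-th derivative of
  \<open>u powr a * ln u ^ i\<close> on the positive axis is \<open>u powr (a - k) * p (ln u)\<close>.\<close>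

primrec powlog_poly :: "real \<Rightarrow> nat \<Rightarrow> nat \<Rightarrow> real poly" where
  "powlog_poly a i 0 = monom 1 i"
| "powlog_poly a i (Suc k) = smult (a - k) (powlog_poly a i k) + pderiv (powlog_poly a i k)"

definition powlog :: "real \<Rightarrow> nat \<Rightarrow> nat \<Rightarrow> real \<Rightarrow> real" where
  "powlog a i k u = u powr (a - k) * poly (powlog_poly a i k) (ln u)"

lemma powlog_0: "powlog a i 0 u = u powr a * ln u ^ i"
  by (simp add: powlog_def poly_monom)

lemma deriv_powlog:
  assumes "u > 0"
  shows "(powlog a i k has_real_derivative powlog a i (Suc k) u) (at u)"
proof -
  have e: "u powr (a - k - 1) * u = u powr (a - k)" "a - real (Suc k) = a - k - 1"
    using powr_add[of u "a - k - 1" 1] assms by simp_all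
  have "((\<lambda>u. u powr (a - k) * poly (powlog_poly a i k) (ln u)) has_real_derivative
     ((a - k) * u powr (a - k - 1) * poly (powlog_poly a i k) (ln u) +
       poly (pderiv (powlog_poly a i k)) (ln u) * (1 / u) * u powr (a - k))) (at u)"
    using assms by (auto intro!: derivative_eq_intros)
  also have "((a - k) * u powr (a - k - 1) * poly (powlog_poly a i k) (ln u) +
       poly (pderiv (powlog_poly a i k)) (ln u) * (1 / u) * u powr (a - k)) = powlog a i (Suc k) u"
    unfolding powlog_def e(2) e(1)[symmetric] using assms by (simp add: field_simps)
  finally show ?thesis by (simp add: powlog_def[abs_def])
qed

text \<open>Horner form: the outer factor \<open>ln u\<close> costs half of the exponent, and the
  rest of the polynomial is bounded with the other half.\<close>

lemma poly_ln_bound: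
  fixes p :: "real poly"
  shows "e > 0 \<Longrightarrow> \<exists>C\<ge>0. \<forall>u\<ge>1. \<bar>poly p (ln u)\<bar> \<le> C * u powr e"
proof (induction p arbitrary: e rule: pCons_induct)
  case 0
  then show ?case by (intro exI[of _ 0]) auto
next
  case (pCons a p)
  from pCons.IH[of "e/2"] pCons.prems obtain C where C: "C \<ge> 0"
    "\<And>u. u \<ge> 1 \<Longrightarrow> \<bar>poly p (ln u)\<bar> \<le> C * u powr (e/2)" by auto
  have "\<bar>poly (pCons a p) (ln u)\<bar> \<le> (\<bar>a\<bar> + 2 / e * C) * u powr e" if u: "u \<ge> 1" for u
  proof -
    have l: "0 \<le> ln u" "ln u \<le> 2 / e * u powr (e/2)"
      using ln_powr_bound[of u "e/2"] u pCons.prems by (auto simp: field_simps)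
    have "\<bar>ln u * poly p (ln u)\<bar> \<le> (2 / e * u powr (e/2)) * (C * u powr (e/2))"
      unfolding abs_mult using l C u pCons.prems by (intro mult_mono) auto
    also have "\<dots> = 2 / e * C * u powr e"
      using powr_add[of u "e/2" "e/2"] by simp
    finally have "\<bar>ln u * poly p (ln u)\<bar> \<le> 2 / e * C * u powr e" .
    moreover have "\<bar>a\<bar> \<le> \<bar>a\<bar> * u powr e"
      using u pCons.prems ge_one_powr_ge_zero[of u e] by (intro mult_le_cancel_left1[THEN iffD2]) auto
    moreover have "\<bar>poly (pCons a p) (ln u)\<bar> \<le> \<bar>a\<bar> + \<bar>ln u * poly p (ln u)\<bar>"
      by (simp add: abs_triangle_ineq)
    ultimately show ?thesis by (simp add: algebra_simps)
  qed
  moreover have "\<bar>a\<bar> + 2 / e * C \<ge> 0" using C pCons.prems by simp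
  ultimately show ?case by blast
qed

text \<open>A whole unit of exponent is spent on the logarithms. This is affordable because the
  decay for large \<open>u\<close> is later secured by taking \<open>m\<close> large.\<close>

lemma powlog_bound: "\<exists>C\<ge>0. \<forall>u\<ge>1. \<bar>powlog a i k u\<bar> \<le> C * u powr (a + 1 - k)"
proof -
  obtain C where C: "C \<ge> 0" "\<And>u. u \<ge> 1 \<Longrightarrow> \<bar>poly (powlog_poly a i k) (ln u)\<bar> \<le> C * u powr 1"
    using poly_ln_bound[of 1 "powlog_poly a i k"] by auto
  have "\<bar>powlog a i k u\<bar> \<le> C * u powr (a + 1 - k)" if "u \<ge> 1" for u
  proof -
    have "\<bar>powlog a i k u\<bar> \<le> u powr (a - k) * (C * u powr 1)"
      unfolding powlog_def abs_mult using C(2)[OF that] by (intro mult_mono) auto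
    also have "\<dots> = C * u powr (a + 1 - k)"
      using powr_add[of u "a - k" 1] by (simp add: algebra_simps)
    finally show ?thesis .
  qed
  with C(1) show ?thesis by blast
qed

text \<open>In the scaled variable u = (x - c) / h the singular factor is kept for |u| > 1 and
  replaced by a polynomial on [-1, 1]. Treating both signs of \<open>u\<close> makes it usable for
  interior and endpoint singularities alike.\<close>

lemma regularised_powlog:
  "\<exists>\<Phi> C. C \<ge> 0 \<and> deriv_chain m UNIV \<Phi> \<and>
     (\<forall>u. \<bar>u\<bar> > 1 \<longrightarrow> \<Phi> 0 u = \<bar>u\<bar> powr a * ln \<bar>u\<bar> ^ i) \<and>
     (\<forall>k\<le>m. \<forall>u. \<bar>\<Phi> k u\<bar> \<le> C * max 1 \<bar>u\<bar> powr (a + 1 - k))"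
proof -
  \<comment> \<open>Matching to order \<open>Suc m\<close> makes \<open>\<Phi> m\<close>
    differentiable and therefore continuous. The signs \<open>(-1) ^ k\<close> are the parity of the
    derivatives of an even function.\<close>
  obtain T where T: "\<And>k. k \<le> Suc m \<Longrightarrow> poly ((pderiv ^^ k) T) 1 = powlog a i k 1"
      "\<And>k. k \<le> Suc m \<Longrightarrow> poly ((pderiv ^^ k) T) (-1) = (-1) ^ k * powlog a i k 1"
    using hermite_interpolation[of "Suc m" "\<lambda>k. powlog a i k 1" "\<lambda>k. (-1) ^ k * powlog a i k 1"] by blast
  define L where "L = (\<lambda>k u. (-1) ^ k * powlog a i k (-u))"
  define M where "M = (\<lambda>k. poly ((pderiv ^^ k) T))"
  define \<Phi> where "\<Phi> = (\<lambda>k u. if u \<le> 1 then if u \<le> -1 then L k u else M k u else powlog a i k u)"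
  have dL: "(L k has_real_derivative L (Suc k) u) (at u)" if "u < 0" for k u
  proof -
    have "((\<lambda>u. powlog a i k (-u)) has_real_derivative powlog a i (Suc k) (-u) * (-1)) (at u)"
      by (rule DERIV_chain2[OF deriv_powlog]) (use that in \<open>auto intro!: derivative_eq_intros\<close>)
    from DERIV_cmult[OF this, of "(-1) ^ k"] show ?thesis by (simp add: L_def)
  qed
  have dM: "(M k has_real_derivative M (Suc k) u) (at u)" for k u
    by (simp add: M_def)
  have d: "(\<Phi> k has_real_derivative \<Phi> (Suc k) u) (at u)" if k: "k \<le> m" for k u
  proof -
    have e1: "L k (-1) = M k (-1)" "L (Suc k) (-1) = M (Suc k) (-1)"
      using T(2)[of k] T(2)[of "Suc k"] k by (simp_all add: L_def M_def)
    have e2: "M k 1 = powlog a i k 1" "M (Suc k) 1 = powlog a i (Suc k) 1"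
      using T(1)[of k] T(1)[of "Suc k"] k by (simp_all add: M_def)
    consider "u < -1" | "u = -1" | "-1 < u" "u < 1" | "u = 1" | "u > 1" by linarith
    then show ?thesis
    proof cases
      case 1
      have "(\<Phi> k has_real_derivative L (Suc k) u) (at u)"
        by (rule deriv_if_open[OF dL, where S = "{..<-1}"]) (use 1 in \<open>auto simp: \<Phi>_def\<close>)
      with 1 show ?thesis by (simp add: \<Phi>_def)
    next
      case 2
      have "((\<lambda>u. if u \<le> -1 then L k u else M k u) has_real_derivative L (Suc k) (-1)) (at (-1))"
        using dL[of "-1" k] dM[of k "-1"] e1 by (intro deriv_glue) auto
      then have "(\<Phi> k has_real_derivative L (Suc k) (-1)) (at (-1))"
        by (rule deriv_if_open[where S = "{..<1}"]) (auto simp: \<Phi>_def)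
      with 2 show ?thesis by (simp add: \<Phi>_def)
    next
      case 3
      have "(\<Phi> k has_real_derivative M (Suc k) u) (at u)"
        by (rule deriv_if_open[OF dM, where S = "{-1<..<1}"]) (use 3 in \<open>auto simp: \<Phi>_def\<close>)
      with 3 show ?thesis by (simp add: \<Phi>_def)
    next
      case 4
      have "((\<lambda>u. if u \<le> 1 then M k u else powlog a i k u) has_real_derivative M (Suc k) 1) (at 1)"
        using deriv_powlog[of 1 a i k] dM[of k 1] e2 by (intro deriv_glue) auto
      then have "(\<Phi> k has_real_derivative M (Suc k) 1) (at 1)"
        by (rule deriv_if_open[where S = "{-1<..}"]) (auto simp: \<Phi>_def)
      with 4 show ?thesis by (simp add: \<Phi>_def)
    next
      case 5
      have "(\<Phi> k has_real_derivative powlog a i (Suc k) u) (at u)"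
        by (rule deriv_if_open[OF deriv_powlog, where S = "{1<..}"]) (use 5 in \<open>auto simp: \<Phi>_def\<close>)
      with 5 show ?thesis by (simp add: \<Phi>_def)
    qed
  qed
  have "deriv_chain m UNIV \<Phi>"
    unfolding deriv_chain_def using d by (auto intro: DERIV_continuous_on)
  moreover have "\<Phi> 0 u = \<bar>u\<bar> powr a * ln \<bar>u\<bar> ^ i" if "\<bar>u\<bar> > 1" for u
    using that by (auto simp: \<Phi>_def L_def powlog_0)
  moreover have "\<exists>C\<ge>0. \<forall>u. \<bar>\<Phi> k u\<bar> \<le> C * max 1 \<bar>u\<bar> powr (a + 1 - k)" for k
  proof -
    obtain C where C: "C \<ge> 0" "\<And>u. u \<ge> 1 \<Longrightarrow> \<bar>powlog a i k u\<bar> \<le> C * u powr (a + 1 - k)"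
      using powlog_bound[of a i k] by blast
    obtain B where B: "\<And>u. u \<in> {-1..1} \<Longrightarrow> \<bar>M k u\<bar> \<le> B"
      using poly_bounded[of "(pderiv ^^ k) T"] unfolding M_def by blast
    have B0: "B \<ge> 0" using B[of 0] by simp
    have "\<bar>\<Phi> k u\<bar> \<le> (B + C) * max 1 \<bar>u\<bar> powr (a + 1 - k)" for u
    proof -
      consider "u \<le> -1" | "-1 < u" "u \<le> 1" | "u > 1" by linarith
      then show ?thesis
      proof cases
        case 1
        then have "\<bar>\<Phi> k u\<bar> \<le> C * (-u) powr (a + 1 - k)"
          using C(2)[of "-u"] by (simp add: \<Phi>_def L_def abs_mult power_abs)
        also have "\<dots> \<le> (B + C) * max 1 \<bar>u\<bar> powr (a + 1 - k)"
          using 1 B0 by (auto simp: max_def intro!: mult_right_mono)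
        finally show ?thesis .
      next
        case 2
        then have "max 1 \<bar>u\<bar> = 1" by auto
        then show ?thesis using B[of u] C(1) 2 by (auto simp: \<Phi>_def)
      next
        case 3
        then have "\<bar>\<Phi> k u\<bar> \<le> C * u powr (a + 1 - k)"
          using C(2)[of u] by (simp add: \<Phi>_def)
        also have "\<dots> \<le> (B + C) * max 1 \<bar>u\<bar> powr (a + 1 - k)"
          using 3 B0 by (auto simp: max_def intro!: mult_right_mono)
        finally show ?thesis .
      qed
    qed
    then show ?thesis using B0 C(1) by (intro exI[of _ "B + C"]) auto
  qed
  then obtain C where C: "\<And>k. C k \<ge> 0" "\<And>k u. \<bar>\<Phi> k u\<bar> \<le> C k * max 1 \<bar>u\<bar> powr (a + 1 - real k)"
    by metis
  have "\<bar>\<Phi> k u\<bar> \<le> (\<Sum>k\<le>m. C k) * max 1 \<bar>u\<bar> powr (a + 1 - k)" if "k \<le> m" for k u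
  proof -
    have "C k \<le> (\<Sum>k\<le>m. C k)" using that C by (intro member_le_sum) auto
    then have "C k * max 1 \<bar>u\<bar> powr (a + 1 - k) \<le> (\<Sum>k\<le>m. C k) * max 1 \<bar>u\<bar> powr (a + 1 - k)"
      by (rule mult_right_mono) simp
    with C(2)[of k u] show ?thesis by linarith
  qed
  moreover have "(\<Sum>k\<le>m. C k) \<ge> 0" using C by (intro sum_nonneg) auto
  ultimately show ?thesis by blast
qed

text \<open>The bound for large arguments, applied to \<open>1 / u\<close>: an arbitrarily small
  loss in the exponent absorbs the logarithm at 0.\<close>

lemma powlog_near_zero:
  fixes a b :: real
  assumes "b < a"
  shows "\<exists>C\<ge>0. \<forall>u. 0 < u \<and> u \<le> 1 \<longrightarrow> \<bar>u powr a * ln u ^ i\<bar> \<le> C * u powr b"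
proof -
  obtain C where C: "C \<ge> 0" "\<And>u. u \<ge> 1 \<Longrightarrow> \<bar>poly (monom 1 i) (ln u)\<bar> \<le> C * u powr (a - b)"
    using poly_ln_bound[of "a - b" "monom 1 i"] assms by auto
  have "\<bar>u powr a * ln u ^ i\<bar> \<le> C * u powr b" if u: "0 < u" "u \<le> 1" for u
  proof -
    have "(1 / u) powr (a - b) = u powr (b - a)"
      using powr_minus_divide[of u "a - b"] u by (simp add: powr_divide)
    then have "\<bar>ln u ^ i\<bar> \<le> C * u powr (b - a)"
      using C(2)[of "1 / u"] u by (simp add: poly_monom ln_div power_abs)
    then have "\<bar>u powr a * ln u ^ i\<bar> \<le> u powr a * (C * u powr (b - a))"
      unfolding abs_mult by (intro mult_mono) auto
    also have "\<dots> = C * u powr b" using powr_add[of u a "b - a"] by simp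
    finally show ?thesis .
  qed
  with C(1) show ?thesis by blast
qed

section \<open>Approximation of algebraic-logarithmic singularities\<close>

lemma nn_integral_abs_shift:
  fixes c :: real
  assumes [measurable]: "\<phi> \<in> borel_measurable borel"
  shows "(\<integral>\<^sup>+x. \<phi> \<bar>x - c\<bar> \<partial>lborel) \<le> 2 * (\<integral>\<^sup>+y. \<phi> y * indicator {0..} y \<partial>lborel)"
proof -
  define \<psi> where "\<psi> = (\<lambda>y. \<phi> y * indicator {0..} y)"
  have [measurable]: "\<psi> \<in> borel_measurable borel" by (simp add: \<psi>_def)
  have "(\<integral>\<^sup>+x. \<phi> \<bar>x - c\<bar> \<partial>lborel) \<le> (\<integral>\<^sup>+x. (\<psi> (- c + 1 * x) + \<psi> (c + (-1) * x)) \<partial>lborel)"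
    by (intro nn_integral_mono) (auto simp: \<psi>_def abs_if indicator_def)
  also have "\<dots> = (\<integral>\<^sup>+x. \<psi> (- c + 1 * x) \<partial>lborel) + (\<integral>\<^sup>+x. \<psi> (c + (-1) * x) \<partial>lborel)"
    by (intro nn_integral_add) auto
  also have "\<dots> = 2 * (\<integral>\<^sup>+y. \<psi> y \<partial>lborel)"
    using nn_integral_real_affine[of \<psi> 1 "- c"] nn_integral_real_affine[of \<psi> "-1" c] by (simp add: mult_2)
  finally show ?thesis by (simp add: \<psi>_def)
qed

lemma nn_integral_powr_near:
  fixes b c h :: real
  assumes "b > -1" "h > 0"
  shows "(\<integral>\<^sup>+x. ennreal (\<bar>x - c\<bar> powr b) * indicator {..h} \<bar>x - c\<bar> \<partial>lborel) \<le> ennreal (2 / (b + 1) * h powr (b + 1))"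
proof -
  have "(\<integral>\<^sup>+x. ennreal (\<bar>x - c\<bar> powr b) * indicator {..h} \<bar>x - c\<bar> \<partial>lborel)
    \<le> 2 * (\<integral>\<^sup>+y. ennreal (y powr b) * indicator {..h} y * indicator {0..} y \<partial>lborel)"
    by (rule nn_integral_abs_shift[where \<phi> = "\<lambda>y. ennreal (y powr b) * indicator {..h} y"]) measurable
  also have "(\<integral>\<^sup>+y. ennreal (y powr b) * indicator {..h} y * indicator {0..} y \<partial>lborel)
    = (\<integral>\<^sup>+y. ennreal (y powr b) * indicator {0..h} y \<partial>lborel)"
    by (intro nn_integral_cong) (auto simp: indicator_def)
  also have "\<dots> = ennreal (h powr (b + 1) / (b + 1))"
    using assms by (intro nn_integral_has_integral_lebesgue' has_integral_powr_from_0) auto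
  also have "2 * \<dots> = ennreal (2 / (b + 1) * h powr (b + 1))"
    using assms by (simp add: ennreal_mult'[symmetric] flip: ennreal_numeral)
  finally show ?thesis .
qed

lemma nn_integral_powr_far:
  fixes b c h :: real
  assumes "b < -1" "h > 0"
  shows "(\<integral>\<^sup>+x. ennreal (\<bar>x - c\<bar> powr b) * indicator {h..} \<bar>x - c\<bar> \<partial>lborel) \<le> ennreal (2 / (- (b + 1)) * h powr (b + 1))"
proof -
  have "(\<integral>\<^sup>+x. ennreal (\<bar>x - c\<bar> powr b) * indicator {h..} \<bar>x - c\<bar> \<partial>lborel)
    \<le> 2 * (\<integral>\<^sup>+y. ennreal (y powr b) * indicator {h..} y * indicator {0..} y \<partial>lborel)"
    by (rule nn_integral_abs_shift[where \<phi> = "\<lambda>y. ennreal (y powr b) * indicator {h..} y"]) measurable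
  also have "(\<integral>\<^sup>+y. ennreal (y powr b) * indicator {h..} y * indicator {0..} y \<partial>lborel)
    = (\<integral>\<^sup>+y. ennreal (y powr b) * indicator {h..} y \<partial>lborel)"
    using assms by (intro nn_integral_cong) (auto simp: indicator_def)
  also have "\<dots> = ennreal (- (h powr (b + 1)) / (b + 1))"
    using assms by (intro nn_integral_has_integral_lebesgue' has_integral_powr_to_inf) auto
  also have "2 * \<dots> = ennreal (2 / (- (b + 1)) * h powr (b + 1))"
  proof -
    have "2 / (- (b + 1)) * h powr (b + 1) = 2 * (- (h powr (b + 1)) / (b + 1))"
      using assms by (simp add: field_simps)
    then show ?thesis
      using assms by (simp add: ennreal_mult'[symmetric] divide_nonpos_neg flip: ennreal_numeral)
  qed
  finally show ?thesis .
qed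

text \<open>The point \<open>c\<close> itself has to be excluded because of \<open>0 powr 0 = 0\<close>.\<close>

lemma nn_integral_gegenbauer_measure_restrict_le:
  fixes c :: real
  assumes S [measurable]: "S \<in> sets borel"
    and w: "\<And>x. x \<in> {-1..1} \<Longrightarrow> x \<noteq> c \<Longrightarrow> \<bar>x - c\<bar> \<in> S \<Longrightarrow> gegenbauer_weight lam x \<le> K * \<bar>x - c\<bar> powr e"
    and int: "(\<integral>\<^sup>+x. ennreal (\<bar>x - c\<bar> powr (e + b)) * indicator S \<bar>x - c\<bar> \<partial>lborel) \<le> ennreal I"
    and "D \<ge> 0" "K \<ge> 0" "I \<ge> 0"
  shows "(\<integral>\<^sup>+x. ennreal (D * \<bar>x - c\<bar> powr b * indicator S \<bar>x - c\<bar>) \<partial>gegenbauer_measure lam) \<le> ennreal (D * K * I)"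
proof -
  have "(\<integral>\<^sup>+x. ennreal (D * \<bar>x - c\<bar> powr b * indicator S \<bar>x - c\<bar>) \<partial>gegenbauer_measure lam)
    = (\<integral>\<^sup>+x. ennreal (indicator {-1..1} x * gegenbauer_weight lam x) *
         ennreal (D * \<bar>x - c\<bar> powr b * indicator S \<bar>x - c\<bar>) \<partial>lborel)"
    by (rule nn_integral_gegenbauer_measure) measurable
  also have "\<dots> \<le> (\<integral>\<^sup>+x. ennreal (D * K) * (ennreal (\<bar>x - c\<bar> powr (e + b)) * indicator S \<bar>x - c\<bar>) \<partial>lborel)"
  proof (rule nn_integral_mono_AE)
    show "AE x in lborel. ennreal (indicator {-1..1} x * gegenbauer_weight lam x) *
         ennreal (D * \<bar>x - c\<bar> powr b * indicator S \<bar>x - c\<bar>)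
        \<le> ennreal (D * K) * (ennreal (\<bar>x - c\<bar> powr (e + b)) * indicator S \<bar>x - c\<bar>)"
      using AE_lborel_singleton[of c]
    proof eventually_elim
      case (elim x)
      show ?case
      proof (cases "x \<in> {-1..1} \<and> \<bar>x - c\<bar> \<in> S")
        case True
        then have xs: "x \<in> {-1..1}" "\<bar>x - c\<bar> \<in> S" by auto
        have "gegenbauer_weight lam x * (D * \<bar>x - c\<bar> powr b) \<le> (K * \<bar>x - c\<bar> powr e) * (D * \<bar>x - c\<bar> powr b)"
          using w[OF xs(1) elim xs(2)] \<open>D \<ge> 0\<close> by (intro mult_right_mono) auto
        also have "\<dots> = D * K * \<bar>x - c\<bar> powr (e + b)" by (simp add: powr_add)
        finally have "ennreal (gegenbauer_weight lam x * (D * \<bar>x - c\<bar> powr b)) \<le> ennreal (D * K * \<bar>x - c\<bar> powr (e + b))"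
          by (rule ennreal_leI)
        with xs \<open>D \<ge> 0\<close> \<open>K \<ge> 0\<close> show ?thesis
          by (simp add: ennreal_mult'[symmetric] ennreal_mult''[symmetric] weight_nonneg)
      qed (auto simp: indicator_def)
    qed
  qed
  also have "\<dots> = ennreal (D * K) * (\<integral>\<^sup>+x. ennreal (\<bar>x - c\<bar> powr (e + b)) * indicator S \<bar>x - c\<bar> \<partial>lborel)"
    by (intro nn_integral_cmult) measurable
  also have "\<dots> \<le> ennreal (D * K) * ennreal I" using int by (rule mult_left_mono) simp
  also have "\<dots> = ennreal (D * K * I)" using assms by (simp add: ennreal_mult')
  finally show ?thesis .
qed

lemma nn_integral_square_add_le:
  fixes u v :: "real \<Rightarrow> real"
  assumes "(\<integral>\<^sup>+x. ennreal ((u x)\<^sup>2) \<partial>M) \<le> ennreal A" "(\<integral>\<^sup>+x. ennreal ((v x)\<^sup>2) \<partial>M) \<le> ennreal B"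
    "A \<ge> 0" "B \<ge> 0" and [measurable]: "u \<in> borel_measurable M" "v \<in> borel_measurable M"
  shows "(\<integral>\<^sup>+x. ennreal ((u x + v x)\<^sup>2) \<partial>M) \<le> ennreal (2 * A + 2 * B)"
proof -
  have "(\<integral>\<^sup>+x. ennreal ((u x + v x)\<^sup>2) \<partial>M) \<le> (\<integral>\<^sup>+x. ennreal (2 * (u x)\<^sup>2 + 2 * (v x)\<^sup>2) \<partial>M)"
    by (intro nn_integral_mono ennreal_leI square_add_le)
  also have "\<dots> = (\<integral>\<^sup>+x. (ennreal 2 * ennreal ((u x)\<^sup>2) + ennreal 2 * ennreal ((v x)\<^sup>2)) \<partial>M)"
    by (simp add: ennreal_plus ennreal_mult)
  also have "\<dots> = ennreal 2 * (\<integral>\<^sup>+x. ennreal ((u x)\<^sup>2) \<partial>M) + ennreal 2 * (\<integral>\<^sup>+x. ennreal ((v x)\<^sup>2) \<partial>M)"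
    by (simp add: nn_integral_add nn_integral_cmult)
  also have "\<dots> \<le> ennreal 2 * ennreal A + ennreal 2 * ennreal B"
    by (intro add_mono mult_left_mono assms) auto
  also have "\<dots> = ennreal (2 * A + 2 * B)" using assms by (simp add: ennreal_mult' ennreal_plus)
  finally show ?thesis .
qed

text \<open>Differentiability within the interval says nothing about \<open>G 0\<close> elsewhere;
  measurability on the whole line is included because all integrands are Borel functions on the
  line.\<close>

definition smooth_chain :: "(nat \<Rightarrow> real \<Rightarrow> real) \<Rightarrow> bool" where
  "smooth_chain G \<longleftrightarrow> G 0 \<in> borel_measurable borel \<and>
     (\<forall>k. \<forall>x\<in>{-1..1}. (G k has_real_derivative G (Suc k) x) (at x within {-1..1}))"

lemma smooth_chain_deriv_chain:
  assumes "smooth_chain G"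
  shows "deriv_chain m {-1..1} G"
  using assms unfolding deriv_chain_def smooth_chain_def
  by (auto intro: DERIV_continuous_on[of "{-1..1}" "G m" "G (Suc m)"])

lemma smooth_chain_bounded:
  assumes "smooth_chain G"
  shows "\<exists>M\<ge>0. \<forall>k\<le>m. \<forall>x\<in>{-1..1}. \<bar>G k x\<bar> \<le> M"
proof -
  have "\<exists>M\<ge>0. \<forall>x\<in>{-1..1}. \<bar>G k x\<bar> \<le> M" for k
  proof -
    have "continuous_on {-1..1} (G k)"
      using smooth_chain_deriv_chain[OF assms, of k] by (simp add: deriv_chain_def)
    then have "bounded (G k ` {-1..1})" by (intro compact_imp_bounded compact_continuous_image) auto
    then show ?thesis unfolding bounded_pos by (auto simp: real_norm_def intro!: less_imp_le)
  qed
  then obtain M where M: "\<And>k. M k \<ge> 0" "\<And>k x. x \<in> {-1..1} \<Longrightarrow> \<bar>G k x\<bar> \<le> M k" by metis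
  have "\<bar>G k x\<bar> \<le> (\<Sum>k\<le>m. M k)" if "k \<le> m" "x \<in> {-1..1}" for k x
    using M(2)[OF that(2), of k] member_le_sum[of k "{..m}" M] M(1) that(1) by force
  moreover have "(\<Sum>k\<le>m. M k) \<ge> 0" using M by (intro sum_nonneg) auto
  ultimately show ?thesis by blast
qed

lemma deriv_chain_cmult:
  assumes "deriv_chain m S F"
  shows "deriv_chain m S (\<lambda>j x. a * F j x)"
  using assms unfolding deriv_chain_def by (auto intro!: DERIV_cmult continuous_intros)

text \<open>These are the Leibniz terms for a scaled function times a smooth one; in the application
  \<open>v = max 1 \<bar>(x - c) / h\<bar>\<close>. Moving a derivative to the smooth factor changes
  the bound by the factor \<open>h * v\<close>, which is at most the length 2 of the interval. So,
  up to \<open>2 ^ m\<close>, the term \<open>k = m\<close> dominates, and the binomial sum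
  contributes the other \<open>2 ^ m\<close>.\<close>

lemma scaled_product_bound:
  fixes a h M C v :: real and \<phi> \<gamma> :: "nat \<Rightarrow> real"
  assumes h: "h > 0" and v: "v \<ge> 1" "h * v \<le> 2" and "C \<ge> 0" "M \<ge> 0"
    and \<phi>: "\<And>k. k \<le> m \<Longrightarrow> \<bar>\<phi> k\<bar> \<le> C * v powr (a + 1 - k)"
    and \<gamma>: "\<And>k. k \<le> m \<Longrightarrow> \<bar>\<gamma> k\<bar> \<le> M"
  shows "(h powr a * (\<Sum>k\<le>m. real (m choose k) * ((1 / h) ^ k * \<phi> k * \<gamma> (m - k))))\<^sup>2
    \<le> (4 ^ m * C * M)\<^sup>2 * h powr (2 * a - 2 * real m) * v powr (2 * a + 2 - 2 * real m)"
proof -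
  define Z where "Z = (1 / h) ^ m * v powr (a + 1 - m)"
  have Z0: "Z \<ge> 0" using h by (simp add: Z_def)
  have t: "\<bar>(1 / h) ^ k * \<phi> k * \<gamma> (m - k)\<bar> \<le> 2 ^ m * C * M * Z" if k: "k \<le> m" for k
  proof -
    have e1: "(1 / h) ^ k = (1 / h) ^ m * h ^ (m - k)"
      using h k by (simp add: power_diff field_simps)
    have e2: "v powr (a + 1 - k) = v powr (a + 1 - m) * v ^ (m - k)"
      using v k by (simp add: powr_realpow[symmetric] powr_add[symmetric] of_nat_diff algebra_simps)
    have "\<bar>(1 / h) ^ k * \<phi> k * \<gamma> (m - k)\<bar> = (1 / h) ^ k * \<bar>\<phi> k\<bar> * \<bar>\<gamma> (m - k)\<bar>"
      using h by (simp add: abs_mult power_abs)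
    also have "\<dots> \<le> (1 / h) ^ k * (C * v powr (a + 1 - k)) * M"
      using h v \<phi>[OF k] \<gamma>[of "m - k"] assms(4,5) by (intro mult_mono mult_nonneg_nonneg) auto
    also have "\<dots> = C * M * Z * (h * v) ^ (m - k)"
      unfolding e1 e2 by (simp add: Z_def power_mult_distrib)
    also have "\<dots> \<le> C * M * Z * 2 ^ m"
    proof (rule mult_left_mono)
      have "(h * v) ^ (m - k) \<le> 2 ^ (m - k)" using h v by (intro power_mono) auto
      also have "(2::real) ^ (m - k) \<le> 2 ^ m" by (intro power_increasing) auto
      finally show "(h * v) ^ (m - k) \<le> 2 ^ m" .
    qed (use assms(4,5) Z0 in simp)
    finally show ?thesis by (simp add: mult_ac)
  qed
  have "\<bar>\<Sum>k\<le>m. real (m choose k) * ((1 / h) ^ k * \<phi> k * \<gamma> (m - k))\<bar>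
    \<le> (\<Sum>k\<le>m. real (m choose k) * (2 ^ m * C * M * Z))"
  proof (rule order_trans[OF sum_abs], rule sum_mono)
    fix k assume k: "k \<in> {..m}"
    show "\<bar>real (m choose k) * ((1 / h) ^ k * \<phi> k * \<gamma> (m - k))\<bar> \<le> real (m choose k) * (2 ^ m * C * M * Z)"
      unfolding abs_mult[of "real (m choose k)"] abs_of_nat using t[of k] k by (intro mult_left_mono) auto
  qed
  also have "\<dots> = 2 ^ m * (2 ^ m * C * M * Z)"
    using choose_row_sum[of m] by (simp add: sum_distrib_right[symmetric] of_nat_sum[symmetric] del: of_nat_sum)
  also have "\<dots> = 4 ^ m * C * M * Z"
    by (simp add: power_mult_distrib[symmetric])
  finally have s: "\<bar>\<Sum>k\<le>m. real (m choose k) * ((1 / h) ^ k * \<phi> k * \<gamma> (m - k))\<bar> \<le> 4 ^ m * C * M * Z" .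
  have "(h powr a * (\<Sum>k\<le>m. real (m choose k) * ((1 / h) ^ k * \<phi> k * \<gamma> (m - k))))\<^sup>2
    \<le> (h powr a * (4 ^ m * C * M * Z))\<^sup>2"
    using s by (intro power2_le_iff_abs_le[THEN iffD2]) (auto simp: abs_mult mult_left_mono assms(4,5) Z0)
  also have "\<dots> = (4 ^ m * C * M)\<^sup>2 * (h powr a * (1 / h) ^ m)\<^sup>2 * (v powr (a + 1 - m))\<^sup>2"
    by (simp add: Z_def power_mult_distrib)
  also have "h powr a * (1 / h) ^ m = h powr (a - m)"
    using h by (simp add: powr_diff powr_realpow power_inverse divide_inverse)
  also have "(h powr (a - m))\<^sup>2 = h powr (2 * a - 2 * real m)"
    by (simp add: power2_eq_square powr_add[symmetric])
  also have "(v powr (a + 1 - m))\<^sup>2 = v powr (2 * a + 2 - 2 * real m)"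
    by (simp add: power2_eq_square powr_add[symmetric] algebra_simps)
  finally show ?thesis .
qed

text \<open>The two functions differ only for \<open>\<bar>x - c\<bar> \<le> h\<close>. There both
  are bounded by multiples of \<open>\<bar>u\<bar> powr b\<close>: the singular one by
  \<open>C1\<close>, the bounded one because \<open>b \<le> 0\<close> makes this power at least
  1.\<close>

lemma singular_near_bound:
  fixes a b h c x :: real
  assumes \<Phi>1: "\<And>u. \<bar>u\<bar> > 1 \<Longrightarrow> \<Phi> u = \<bar>u\<bar> powr a * ln \<bar>u\<bar> ^ i"
    and \<Phi>2: "\<And>u. \<bar>u\<bar> \<le> 1 \<Longrightarrow> \<bar>\<Phi> u\<bar> \<le> C0" "C0 \<ge> 0"
    and C1: "\<And>u. 0 < u \<Longrightarrow> u \<le> 1 \<Longrightarrow> \<bar>u powr a * ln u ^ i\<bar> \<le> C1 * u powr b" "C1 \<ge> 0"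
    and "b \<le> 0" "h > 0" "x \<noteq> c" "\<bar>y\<bar> \<le> M"
  shows "(\<bar>x - c\<bar> powr a * ln (\<bar>x - c\<bar> / h) ^ i * y - h powr a * \<Phi> ((x - c) / h) * y)\<^sup>2
    \<le> ((C0 + C1) * M)\<^sup>2 * h powr (2 * a - 2 * b) * \<bar>x - c\<bar> powr (2 * b) * indicator {..h} \<bar>x - c\<bar>"
proof -
  define u where "u = (x - c) / h"
  have au: "\<bar>u\<bar> = \<bar>x - c\<bar> / h" "\<bar>u\<bar> > 0" using assms(7,8) by (simp_all add: u_def)
  have xc: "\<bar>x - c\<bar> = h * \<bar>u\<bar>" using assms(7) by (simp add: au)
  have eq: "\<bar>x - c\<bar> powr a * ln (\<bar>x - c\<bar> / h) ^ i * y - h powr a * \<Phi> ((x - c) / h) * y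
    = h powr a * (\<bar>u\<bar> powr a * ln \<bar>u\<bar> ^ i - \<Phi> u) * y"
    unfolding au(1)[symmetric] u_def[symmetric] unfolding xc using assms(7) by (simp add: powr_mult algebra_simps)
  show ?thesis
  proof (cases "\<bar>u\<bar> > 1")
    case True
    then show ?thesis unfolding eq by (simp add: \<Phi>1)
  next
    case False
    then have ind: "\<bar>x - c\<bar> \<le> h" using assms(7) by (simp add: xc)
    have "1 = \<bar>u\<bar> powr 0" using au(2) by simp
    also have "\<dots> \<le> \<bar>u\<bar> powr b" using False au(2) assms(6) by (intro powr_mono') auto
    finally have "C0 * 1 \<le> C0 * \<bar>u\<bar> powr b" using \<Phi>2(2) by (rule mult_left_mono)
    then have "\<bar>\<bar>u\<bar> powr a * ln \<bar>u\<bar> ^ i - \<Phi> u\<bar> \<le> (C0 + C1) * \<bar>u\<bar> powr b"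
      using \<Phi>2(1)[OF False[unfolded not_less]] C1(1)[OF au(2) False[unfolded not_less]]
        abs_triangle_ineq4[of "\<bar>u\<bar> powr a * ln \<bar>u\<bar> ^ i" "\<Phi> u"]
      unfolding distrib_right by linarith
    then have "\<bar>h powr a * (\<bar>u\<bar> powr a * ln \<bar>u\<bar> ^ i - \<Phi> u) * y\<bar> \<le> h powr a * ((C0 + C1) * \<bar>u\<bar> powr b) * M"
      unfolding abs_mult using assms(9) \<Phi>2 C1(2) by (intro mult_mono) auto
    also have "\<bar>u\<bar> powr b = \<bar>x - c\<bar> powr b * h powr (- b)"
      unfolding au(1) using assms(7) by (simp add: powr_divide powr_minus_divide)
    finally have "(h powr a * (\<bar>u\<bar> powr a * ln \<bar>u\<bar> ^ i - \<Phi> u) * y)\<^sup>2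
       \<le> (h powr a * ((C0 + C1) * (\<bar>x - c\<bar> powr b * h powr (- b))) * M)\<^sup>2"
      by (meson abs_le_square_iff abs_ge_self order_trans)
    also have "\<dots> = ((C0 + C1) * M)\<^sup>2 * (h powr a * h powr (- b))\<^sup>2 * (\<bar>x - c\<bar> powr b)\<^sup>2"
      by (simp add: power_mult_distrib)
    also have "(h powr a * h powr (- b))\<^sup>2 = h powr (2 * a - 2 * b)"
      by (simp add: power2_eq_square powr_add[symmetric])
    also have "(\<bar>x - c\<bar> powr b)\<^sup>2 = \<bar>x - c\<bar> powr (2 * b)"
      by (simp add: power2_eq_square powr_add[symmetric])
    finally show ?thesis unfolding eq using ind by simp
  qed
qed

lemma AE_gegenbauer_measure_neq: "AE x in gegenbauer_measure lam. x \<in> {-1..1} \<and> x \<noteq> c"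
  using AE_lborel_singleton[of c] by (intro AE_gegenbauer_measure) (auto elim!: eventually_mono)

text \<open>Here \<open>e\<close> is the order of the weight for \<open>lam\<close> near
  \<open>c\<close>, and \<open>em\<close> that of the weight for \<open>lam + m\<close> on the whole
  interval. The condition on \<open>2 * a + e + 1\<close> makes the part cut off square integrable.
  The last condition makes the squared \<open>m\<close>-th derivative integrable away from
  \<open>c\<close>, even on an unbounded range, so that its integral is governed by the scale
  \<open>h\<close>.\<close>

lemma singular_approximation:
  fixes a e em c r :: real
  assumes P: "sl_family lam P" and lam: "lam > - 1/2" and G: "smooth_chain G" and c: "c \<in> {-1..1}"
    and w0: "\<And>x. x \<in> {-1..1} \<Longrightarrow> x \<noteq> c \<Longrightarrow> \<bar>x - c\<bar> \<le> r \<Longrightarrow> gegenbauer_weight lam x \<le> K * \<bar>x - c\<bar> powr e" "K \<ge> 0"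
    and wm: "\<And>x. x \<in> {-1..1} \<Longrightarrow> x \<noteq> c \<Longrightarrow> gegenbauer_weight (lam + m) x \<le> Km * \<bar>x - c\<bar> powr em" "Km \<ge> 0"
    and e: "e > -1" "2 * a + e + 1 > 0" and em: "em > -1" "em + 2 * a + 2 - 2 * real m < -1"
  shows "\<exists>C\<ge>0. \<forall>h N. 0 < h \<and> h \<le> r \<and> h \<le> 1 \<and> N > 0 \<longrightarrow> (\<exists>p. degree p \<le> N + m \<and>
    (\<integral>\<^sup>+x. ennreal ((\<bar>x - c\<bar> powr a * ln (\<bar>x - c\<bar> / h) ^ i * G 0 x - poly p x)\<^sup>2) \<partial>gegenbauer_measure lam)
      \<le> ennreal (C * (h powr (2 * a + e + 1) + h powr (2 * a - 2 * real m + em + 1) / real N ^ (2 * m))))"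
proof -
  \<comment> \<open>The midpoint between \<open>min a 0\<close> and \<open>- (e + 1) / 2\<close>;
    the hypotheses on \<open>e\<close> say that the former is larger.\<close>
  define b where "b = (min a 0 - (e + 1) / 2) / 2"
  have b: "b < a" "b \<le> 0" "e + 2 * b > -1" using e by (auto simp: b_def min_def field_simps)
  obtain \<Phi> C0 where C0: "C0 \<ge> 0" and \<Phi>c: "deriv_chain m UNIV \<Phi>"
    and \<Phi>1: "\<And>u. \<bar>u\<bar> > 1 \<Longrightarrow> \<Phi> 0 u = \<bar>u\<bar> powr a * ln \<bar>u\<bar> ^ i"
    and \<Phi>2: "\<And>k u. k \<le> m \<Longrightarrow> \<bar>\<Phi> k u\<bar> \<le> C0 * max 1 \<bar>u\<bar> powr (a + 1 - k)"
    using regularised_powlog[of m a i] by blast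
  obtain C1 where C1: "C1 \<ge> 0" "\<And>u. 0 < u \<Longrightarrow> u \<le> 1 \<Longrightarrow> \<bar>u powr a * ln u ^ i\<bar> \<le> C1 * u powr b"
    using powlog_near_zero[OF b(1)] by blast
  obtain M where M: "M \<ge> 0" "\<And>k x. k \<le> m \<Longrightarrow> x \<in> {-1..1} \<Longrightarrow> \<bar>G k x\<bar> \<le> M"
    using smooth_chain_bounded[OF G] by blast
  have [measurable]: "G 0 \<in> borel_measurable borel" using G by (simp add: smooth_chain_def)
  have "continuous_on UNIV (\<Phi> 0)"
    using \<Phi>c by (cases "m = 0") (auto simp: deriv_chain_def intro!: DERIV_continuous_on[of UNIV "\<Phi> 0" "\<Phi> (Suc 0)"])
  then have [measurable]: "\<Phi> 0 \<in> borel_measurable borel" by (rule borel_measurable_continuous_onI)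
  define q where "q = 2 * a + 2 - 2 * real m"
  define D0 where "D0 = ((C0 + C1) * M)\<^sup>2"
  define D1 where "D1 = (4 ^ m * C0 * M)\<^sup>2"
  define E0 where "E0 = D0 * K * (2 / (e + 2 * b + 1))"
  define E1 where "E1 = D1 * Km * (2 / (em + 1) + 2 / (- (em + q + 1)))"
  have E: "E0 \<ge> 0" "E1 \<ge> 0" using w0(2) wm(2) b e em by (auto simp: E0_def E1_def D0_def D1_def q_def)
  define C where "C = 2 * E0 + 8 * E1 + 2"
  show ?thesis
  proof (rule exI[of _ C], intro conjI allI impI)
    show "C \<ge> 0" using E by (simp add: C_def)
    fix h :: real and N :: nat
    assume "0 < h \<and> h \<le> r \<and> h \<le> 1 \<and> N > 0"
    then have h: "h > 0" "h \<le> r" "h \<le> 1" and N: "N > 0" by auto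
    define f where "f = (\<lambda>x. \<bar>x - c\<bar> powr a * ln (\<bar>x - c\<bar> / h) ^ i * G 0 x)"
    define f2 where "f2 = (\<lambda>x. h powr a * \<Phi> 0 ((x - c) / h) * G 0 x)"
    have [measurable]: "f \<in> borel_measurable borel" "f2 \<in> borel_measurable borel"
      unfolding f_def f2_def by measurable

    have "(\<integral>\<^sup>+x. ennreal ((f x - f2 x)\<^sup>2) \<partial>gegenbauer_measure lam)
      \<le> (\<integral>\<^sup>+x. ennreal (D0 * h powr (2 * a - 2 * b) * \<bar>x - c\<bar> powr (2 * b) * indicator {..h} \<bar>x - c\<bar>) \<partial>gegenbauer_measure lam)"
    proof (rule nn_integral_mono_AE)
      show "AE x in gegenbauer_measure lam. ennreal ((f x - f2 x)\<^sup>2)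
        \<le> ennreal (D0 * h powr (2 * a - 2 * b) * \<bar>x - c\<bar> powr (2 * b) * indicator {..h} \<bar>x - c\<bar>)"
        using AE_gegenbauer_measure_neq[of c lam]
      proof eventually_elim
        case (elim x)
        have "\<bar>\<Phi> 0 u\<bar> \<le> C0" if "\<bar>u\<bar> \<le> 1" for u
          using \<Phi>2[of 0 u] that by (simp add: max_def split: if_splits)
        then show ?case
          unfolding D0_def f_def f2_def using elim C0 C1 h b M(2)[of 0 x]
          by (intro ennreal_leI singular_near_bound \<Phi>1) auto
      qed
    qed
    also have "\<dots> \<le> ennreal (D0 * h powr (2 * a - 2 * b) * K * (2 / (e + 2 * b + 1) * h powr (e + 2 * b + 1)))"
      using w0 h b by (intro nn_integral_gegenbauer_measure_restrict_le[where e = e] nn_integral_powr_near) (auto simp: D0_def)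
    also have "D0 * h powr (2 * a - 2 * b) * K * (2 / (e + 2 * b + 1) * h powr (e + 2 * b + 1))
        = E0 * (h powr (2 * a - 2 * b) * h powr (e + 2 * b + 1))"
      by (simp add: E0_def)
    also have "h powr (2 * a - 2 * b) * h powr (e + 2 * b + 1) = h powr (2 * a + e + 1)"
      by (simp add: powr_add[symmetric] algebra_simps)
    finally have near: "(\<integral>\<^sup>+x. ennreal ((f x - f2 x)\<^sup>2) \<partial>gegenbauer_measure lam) \<le> ennreal (E0 * h powr (2 * a + e + 1))" .

    define F where "F = (\<lambda>j x. h powr a * (\<Sum>k\<le>j. real (j choose k) *
        ((1 / h) ^ k * \<Phi> k (1 / h * x + (- c / h)) * G (j - k) x)))"
    have F: "deriv_chain m {-1..1} F"
      unfolding F_def by (intro deriv_chain_cmult deriv_chain_mult deriv_chain_affine \<Phi>c smooth_chain_deriv_chain G)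
    have F0: "F 0 x = f2 x" for x by (simp add: F_def f2_def diff_divide_distrib)
    define Gb where "Gb = (\<lambda>x. D1 * h powr (2 * a - 2 * real m) * max 1 \<bar>(x - c) / h\<bar> powr q)"
    have [measurable]: "Gb \<in> borel_measurable borel" unfolding Gb_def by measurable
    have Gb0: "Gb x \<ge> 0" for x by (simp add: Gb_def D1_def)
    have FG: "(F m x)\<^sup>2 \<le> Gb x" if x: "x \<in> {-1..1}" for x
    proof -
      have "h * max 1 \<bar>(x - c) / h\<bar> = max h \<bar>x - c\<bar>" using h by (simp add: max_def field_simps)
      also have "\<dots> \<le> 2" using h x c by auto
      finally have "h * max 1 \<bar>(x - c) / h\<bar> \<le> 2" .
      moreover have u: "1 / h * x + (- c / h) = (x - c) / h" by (simp add: diff_divide_distrib)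
      ultimately show ?thesis
        unfolding F_def Gb_def D1_def q_def u
        by (intro scaled_product_bound h(1) C0 M(1) \<Phi>2 M(2) x) auto
    qed
    define B where "B = E1 * h powr (2 * a - 2 * real m + em + 1)"
    have B0: "B \<ge> 0" using E by (simp add: B_def)
    \<comment> \<open>The majorant is split at distance \<open>h\<close> from \<open>c\<close> into
      a constant and a pure power. The factor \<open>\<bar>x - c\<bar> powr 0\<close> brings the
      constant into the form of the general integral estimate.\<close>
    let ?p1 = "\<lambda>x. D1 * h powr (2 * a - 2 * real m) * \<bar>x - c\<bar> powr 0 * indicator {..h} \<bar>x - c\<bar>"
    let ?p2 = "\<lambda>x. D1 * h powr (2 * a - 2 * real m - q) * \<bar>x - c\<bar> powr q * indicator {h..} \<bar>x - c\<bar>"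
    have "(\<integral>\<^sup>+x. ennreal (Gb x) \<partial>gegenbauer_measure (lam + m)) \<le> (\<integral>\<^sup>+x. (ennreal (?p1 x) + ennreal (?p2 x)) \<partial>gegenbauer_measure (lam + m))"
    proof (rule nn_integral_mono_AE)
      show "AE x in gegenbauer_measure (lam + m). ennreal (Gb x) \<le> ennreal (?p1 x) + ennreal (?p2 x)"
        using AE_gegenbauer_measure_neq[of c "lam + m"]
      proof eventually_elim
        case (elim x)
        have "Gb x \<le> ?p1 x + ?p2 x"
        proof (cases "\<bar>x - c\<bar> \<le> h")
          case True
          then have "max 1 \<bar>(x - c) / h\<bar> = 1" using h by (simp add: max_def field_simps)
          then show ?thesis using True elim by (simp add: Gb_def D1_def)
        next
          case False
          then have "max 1 \<bar>(x - c) / h\<bar> = \<bar>x - c\<bar> / h" using h by (simp add: max_def field_simps)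
          then show ?thesis using False h by (simp add: Gb_def D1_def powr_divide powr_diff mult_ac)
        qed
        then show ?case by (simp add: ennreal_plus[symmetric] D1_def ennreal_leI del: ennreal_plus)
      qed
    qed
    also have "\<dots> = (\<integral>\<^sup>+x. ennreal (?p1 x) \<partial>gegenbauer_measure (lam + m)) + (\<integral>\<^sup>+x. ennreal (?p2 x) \<partial>gegenbauer_measure (lam + m))"
      by (intro nn_integral_add) measurable
    also have "\<dots> \<le> ennreal (D1 * h powr (2 * a - 2 * real m) * Km * (2 / (em + 0 + 1) * h powr (em + 0 + 1)))
       + ennreal (D1 * h powr (2 * a - 2 * real m - q) * Km * (2 / (- (em + q + 1)) * h powr (em + q + 1)))"
    proof (rule add_mono)
      show "(\<integral>\<^sup>+x. ennreal (?p1 x) \<partial>gegenbauer_measure (lam + m))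
          \<le> ennreal (D1 * h powr (2 * a - 2 * real m) * Km * (2 / (em + 0 + 1) * h powr (em + 0 + 1)))"
        using wm h em by (intro nn_integral_gegenbauer_measure_restrict_le[where e = em] nn_integral_powr_near) (auto simp: D1_def)
      show "(\<integral>\<^sup>+x. ennreal (?p2 x) \<partial>gegenbauer_measure (lam + m))
          \<le> ennreal (D1 * h powr (2 * a - 2 * real m - q) * Km * (2 / (- (em + q + 1)) * h powr (em + q + 1)))"
        using wm h em by (intro nn_integral_gegenbauer_measure_restrict_le[where e = em] nn_integral_powr_far) (auto simp: D1_def q_def)
    qed
    also have "\<dots> = ennreal (D1 * h powr (2 * a - 2 * real m) * Km * (2 / (em + 0 + 1) * h powr (em + 0 + 1))
       + D1 * h powr (2 * a - 2 * real m - q) * Km * (2 / (- (em + q + 1)) * h powr (em + q + 1)))"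
      using wm em by (intro ennreal_plus[symmetric]) (auto simp: D1_def q_def)
    also have "D1 * h powr (2 * a - 2 * real m) * Km * (2 / (em + 0 + 1) * h powr (em + 0 + 1))
       + D1 * h powr (2 * a - 2 * real m - q) * Km * (2 / (- (em + q + 1)) * h powr (em + q + 1))
       = D1 * Km * (2 / (em + 1) * (h powr (2 * a - 2 * real m) * h powr (em + 1))
          + 2 / (- (em + q + 1)) * (h powr (2 * a - 2 * real m - q) * h powr (em + q + 1)))"
      by (simp add: distrib_left mult_ac)
    also have "h powr (2 * a - 2 * real m) * h powr (em + 1) = h powr (2 * a - 2 * real m + em + 1)"
      by (simp add: powr_add[symmetric] algebra_simps)
    also have "h powr (2 * a - 2 * real m - q) * h powr (em + q + 1) = h powr (2 * a - 2 * real m + em + 1)"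
      by (simp add: powr_add[symmetric] algebra_simps)
    also have "D1 * Km * (2 / (em + 1) * h powr (2 * a - 2 * real m + em + 1)
        + 2 / (- (em + q + 1)) * h powr (2 * a - 2 * real m + em + 1)) = B"
      unfolding B_def E1_def by (simp only: distrib_right[symmetric] mult.assoc)
    finally have BI: "(\<integral>\<^sup>+x. ennreal (Gb x) \<partial>gegenbauer_measure (lam + m)) \<le> ennreal B" .
    \<comment> \<open>The free error is set to the order of the part cut off, so it only affects the
      constant.\<close>
    have "\<exists>p. degree p \<le> N + m \<and> (\<integral>\<^sup>+x. ennreal ((F 0 x - poly p x)\<^sup>2) \<partial>gegenbauer_measure lam)
        \<le> ennreal (4 * B / real N ^ (2 * m) + h powr (2 * a + e + 1))"
      using h Gb0 FG BI B0 by (intro jackson_smooth[OF P lam F N, where G = Gb]) auto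
    then obtain p where p: "degree p \<le> N + m" "(\<integral>\<^sup>+x. ennreal ((f2 x - poly p x)\<^sup>2) \<partial>gegenbauer_measure lam)
        \<le> ennreal (4 * B / real N ^ (2 * m) + h powr (2 * a + e + 1))"
      unfolding F0 by blast
    have "(\<integral>\<^sup>+x. ennreal ((f x - poly p x)\<^sup>2) \<partial>gegenbauer_measure lam)
      = (\<integral>\<^sup>+x. ennreal (((f x - f2 x) + (f2 x - poly p x))\<^sup>2) \<partial>gegenbauer_measure lam)" by simp
    also have "\<dots> \<le> ennreal (2 * (E0 * h powr (2 * a + e + 1)) + 2 * (4 * B / real N ^ (2 * m) + h powr (2 * a + e + 1)))"
      using E B0 by (intro nn_integral_square_add_le near p(2)) auto
    also have "\<dots> \<le> ennreal (C * (h powr (2 * a + e + 1) + h powr (2 * a - 2 * real m + em + 1) / real N ^ (2 * m)))"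
    proof (rule ennreal_leI)
      define X Y where "X = h powr (2 * a + e + 1)" and "Y = h powr (2 * a - 2 * real m + em + 1) / real N ^ (2 * m)"
      have XY: "X \<ge> 0" "Y \<ge> 0" by (auto simp: X_def Y_def)
      have "2 * (E0 * X) + 2 * (4 * B / real N ^ (2 * m) + X) = (2 * E0 + 2) * X + 8 * E1 * Y"
        by (simp add: B_def Y_def algebra_simps)
      also have "\<dots> \<le> C * X + C * Y"
        using XY E by (intro add_mono mult_right_mono) (auto simp: C_def)
      finally show "2 * (E0 * h powr (2 * a + e + 1)) + 2 * (4 * B / real N ^ (2 * m) + h powr (2 * a + e + 1))
        \<le> C * (h powr (2 * a + e + 1) + h powr (2 * a - 2 * real m + em + 1) / real N ^ (2 * m))"
        by (simp add: X_def Y_def algebra_simps)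
    qed
    finally show "\<exists>p. degree p \<le> N + m \<and>
      (\<integral>\<^sup>+x. ennreal ((\<bar>x - c\<bar> powr a * ln (\<bar>x - c\<bar> / h) ^ i * G 0 x - poly p x)\<^sup>2) \<partial>gegenbauer_measure lam)
      \<le> ennreal (C * (h powr (2 * a + e + 1) + h powr (2 * a - 2 * real m + em + 1) / real N ^ (2 * m)))"
      using p(1) unfolding f_def by blast
  qed
qed

text \<open>The target may vary with \<open>N\<close>, because the scale \<open>h\<close> inside the
  logarithms does. \<open>R\<close> bounds squared errors, and the nonnegative integral spares
  integrability conditions on the target.\<close>

definition approx_rate :: "real \<Rightarrow> (nat \<Rightarrow> real \<Rightarrow> real) \<Rightarrow> (nat \<Rightarrow> real) \<Rightarrow> bool" where
  "approx_rate lam f R \<longleftrightarrow> (\<exists>C\<ge>0. \<forall>\<^sub>F N in sequentially. \<exists>p. degree p \<le> N \<and>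
     (\<integral>\<^sup>+x. ennreal ((f N x - poly p x)\<^sup>2) \<partial>gegenbauer_measure lam) \<le> ennreal (C * R N))"

lemma approx_rate_cong_AE:
  assumes "approx_rate lam f R" "\<forall>\<^sub>F N in sequentially. AE x in gegenbauer_measure lam. f N x = f' N x"
  shows "approx_rate lam f' R"
proof -
  obtain C where C: "C \<ge> 0" "\<forall>\<^sub>F N in sequentially. \<exists>p. degree p \<le> N \<and>
     (\<integral>\<^sup>+x. ennreal ((f N x - poly p x)\<^sup>2) \<partial>gegenbauer_measure lam) \<le> ennreal (C * R N)"
    using assms(1) by (auto simp: approx_rate_def)
  from C(2) assms(2) have "\<forall>\<^sub>F N in sequentially. \<exists>p. degree p \<le> N \<and>
     (\<integral>\<^sup>+x. ennreal ((f' N x - poly p x)\<^sup>2) \<partial>gegenbauer_measure lam) \<le> ennreal (C * R N)"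
  proof eventually_elim
    case (elim N)
    have "(\<integral>\<^sup>+x. ennreal ((f N x - poly p x)\<^sup>2) \<partial>gegenbauer_measure lam) = (\<integral>\<^sup>+x. ennreal ((f' N x - poly p x)\<^sup>2) \<partial>gegenbauer_measure lam)" for p
      using elim(2) by (intro nn_integral_cong_AE) (auto elim: eventually_mono)
    with elim(1) show ?case by simp
  qed
  with C(1) show ?thesis by (auto simp: approx_rate_def)
qed

lemma approx_rate_scale:
  assumes f: "approx_rate lam f R"
    and b: "\<forall>\<^sub>F N in sequentially. (b N)\<^sup>2 * R N \<le> D * R' N" "D \<ge> 0"
    and m [measurable]: "\<And>N. f N \<in> borel_measurable borel"
  shows "approx_rate lam (\<lambda>N x. b N * f N x) R'"
proof -
  obtain C where C: "C \<ge> 0" "\<forall>\<^sub>F N in sequentially. \<exists>p. degree p \<le> N \<and>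
     (\<integral>\<^sup>+x. ennreal ((f N x - poly p x)\<^sup>2) \<partial>gegenbauer_measure lam) \<le> ennreal (C * R N)"
    using f by (auto simp: approx_rate_def)
  have "\<forall>\<^sub>F N in sequentially. \<exists>p. degree p \<le> N \<and>
     (\<integral>\<^sup>+x. ennreal ((b N * f N x - poly p x)\<^sup>2) \<partial>gegenbauer_measure lam) \<le> ennreal (C * D * R' N)"
    using C(2) b(1)
  proof eventually_elim
    case (elim N)
    then obtain p where p: "degree p \<le> N"
      "(\<integral>\<^sup>+x. ennreal ((f N x - poly p x)\<^sup>2) \<partial>gegenbauer_measure lam) \<le> ennreal (C * R N)" by blast
    have "(\<integral>\<^sup>+x. ennreal ((b N * f N x - poly (smult (b N) p) x)\<^sup>2) \<partial>gegenbauer_measure lam)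
       = (\<integral>\<^sup>+x. ennreal ((b N)\<^sup>2) * ennreal ((f N x - poly p x)\<^sup>2) \<partial>gegenbauer_measure lam)"
      by (simp add: ennreal_mult'[symmetric] power_mult_distrib[symmetric] right_diff_distrib)
    also have "\<dots> = ennreal ((b N)\<^sup>2) * (\<integral>\<^sup>+x. ennreal ((f N x - poly p x)\<^sup>2) \<partial>gegenbauer_measure lam)"
      by (intro nn_integral_cmult) measurable
    also have "\<dots> \<le> ennreal ((b N)\<^sup>2) * ennreal (C * R N)" by (intro mult_left_mono p) auto
    also have "\<dots> = ennreal ((b N)\<^sup>2 * (C * R N))" by (rule ennreal_mult'[symmetric]) simp
    also have "(b N)\<^sup>2 * (C * R N) = C * ((b N)\<^sup>2 * R N)" by (simp only: mult_ac)
    also have "\<dots> \<le> ennreal (C * D * R' N)"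
      using mult_left_mono[OF elim(2) C(1)] by (intro ennreal_leI) (simp add: mult_ac)
    finally show ?case using p(1) by (intro exI[of _ "smult (b N) p"]) (auto intro: order_trans[OF degree_smult_le])
  qed
  then show ?thesis unfolding approx_rate_def using C(1) b(2) by (intro exI[of _ "C * D"]) auto
qed

lemma approx_rate_sum:
  assumes "finite I" and "\<And>i. i \<in> I \<Longrightarrow> approx_rate lam (f i) R"
    and "\<And>i N. i \<in> I \<Longrightarrow> f i N \<in> borel_measurable borel" and R: "\<And>N. R N \<ge> 0"
  shows "approx_rate lam (\<lambda>N x. \<Sum>i\<in>I. f i N x) R"
  using assms(1-3)
proof (induction I)
  case empty
  show ?case unfolding approx_rate_def by (intro exI[of _ 0] conjI always_eventually allI exI[of _ "0 :: real poly"]) auto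
next
  case (insert i I)
  obtain C1 where C1: "C1 \<ge> 0" "\<forall>\<^sub>F N in sequentially. \<exists>p. degree p \<le> N \<and>
     (\<integral>\<^sup>+x. ennreal ((f i N x - poly p x)\<^sup>2) \<partial>gegenbauer_measure lam) \<le> ennreal (C1 * R N)"
    using insert.prems(1)[of i] by (auto simp: approx_rate_def)
  obtain C2 where C2: "C2 \<ge> 0" "\<forall>\<^sub>F N in sequentially. \<exists>p. degree p \<le> N \<and>
     (\<integral>\<^sup>+x. ennreal (((\<Sum>i\<in>I. f i N x) - poly p x)\<^sup>2) \<partial>gegenbauer_measure lam) \<le> ennreal (C2 * R N)"
    using insert by (auto simp: approx_rate_def)
  have "\<forall>\<^sub>F N in sequentially. \<exists>p. degree p \<le> N \<and>
     (\<integral>\<^sup>+x. ennreal (((\<Sum>i\<in>insert i I. f i N x) - poly p x)\<^sup>2) \<partial>gegenbauer_measure lam) \<le> ennreal ((2 * C1 + 2 * C2) * R N)"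
    using C1(2) C2(2)
  proof eventually_elim
    case (elim N)
    have [measurable]: "f i N \<in> borel_measurable borel" "(\<lambda>x. \<Sum>i\<in>I. f i N x) \<in> borel_measurable borel"
      using insert.prems(2) by auto
    obtain p where p: "degree p \<le> N" "(\<integral>\<^sup>+x. ennreal ((f i N x - poly p x)\<^sup>2) \<partial>gegenbauer_measure lam) \<le> ennreal (C1 * R N)"
      using elim by blast
    obtain q where q: "degree q \<le> N" "(\<integral>\<^sup>+x. ennreal (((\<Sum>i\<in>I. f i N x) - poly q x)\<^sup>2) \<partial>gegenbauer_measure lam) \<le> ennreal (C2 * R N)"
      using elim by blast
    have "(\<integral>\<^sup>+x. ennreal (((\<Sum>i\<in>insert i I. f i N x) - poly (p + q) x)\<^sup>2) \<partial>gegenbauer_measure lam)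
      = (\<integral>\<^sup>+x. ennreal (((f i N x - poly p x) + ((\<Sum>i\<in>I. f i N x) - poly q x))\<^sup>2) \<partial>gegenbauer_measure lam)"
      using insert.hyps by (simp add: algebra_simps)
    also have "\<dots> \<le> ennreal (2 * (C1 * R N) + 2 * (C2 * R N))"
      using C1(1) C2(1) R by (intro nn_integral_square_add_le p q) auto
    also have "2 * (C1 * R N) + 2 * (C2 * R N) = (2 * C1 + 2 * C2) * R N" by (simp add: algebra_simps)
    finally show ?case using p q by (intro exI[of _ "p + q"]) (auto intro: degree_add_le)
  qed
  then show ?case unfolding approx_rate_def using C1(1) C2(1) by (intro exI[of _ "2 * C1 + 2 * C2"]) auto
qed

text \<open>The Jackson estimate at \<open>N\<close> has degree \<open>N + m\<close>, so it is used
  at \<open>N - m\<close> to stay within degree \<open>N\<close>; this bounds the price of the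
  shift.\<close>

lemma inverse_power_diff_le:
  assumes "N > 2 * m"
  shows "1 / real (N - m) ^ (2 * m) \<le> 4 ^ m * real N powr (- (2 * real m))"
proof -
  have "(real N / 2) ^ (2 * m) \<le> real (N - m) ^ (2 * m)"
    using assms by (intro power_mono) (auto simp: of_nat_diff)
  then have "1 / real (N - m) ^ (2 * m) \<le> 1 / (real N / 2) ^ (2 * m)"
    using assms by (intro divide_left_mono) auto
  also have "(real N / 2) ^ (2 * m) = real N powr (2 * real m) / 4 ^ m"
    using assms powr_realpow[of "real N" "2 * m"] by (simp add: power_divide power_mult)
  also have "1 / (real N powr (2 * real m) / 4 ^ m) = 4 ^ m * real N powr (- (2 * real m))"
    by (simp add: powr_minus_divide)
  finally show ?thesis .
qed

text \<open>Smooth functions are approximated faster than any power of \<open>N\<close>, since the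
  order \<open>m\<close> of the Jackson estimate is free.\<close>

lemma approx_rate_smooth:
  fixes q :: real
  assumes P: "sl_family lam P" and lam: "lam > - 1/2" and G: "smooth_chain G"
  shows "approx_rate lam (\<lambda>N. G 0) (\<lambda>N. real N powr (- q))"
proof -
  obtain m :: nat where m: "q \<le> 2 * real m"
    using real_arch_simple[of "q / 2"] by (auto simp: field_simps)
  obtain M where M: "M \<ge> 0" "\<And>k x. k \<le> m \<Longrightarrow> x \<in> {-1..1} \<Longrightarrow> \<bar>G k x\<bar> \<le> M"
    using smooth_chain_bounded[OF G] by blast
  have lamm: "lam + m > - 1/2" using lam by simp
  obtain W where W: "W \<ge> 0" "emeasure (gegenbauer_measure (lam + m)) (space (gegenbauer_measure (lam + m))) \<le> ennreal W"
    using gegenbauer_measure_mass[OF lamm] .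
  have B: "(\<integral>\<^sup>+x. ennreal (M\<^sup>2) \<partial>gegenbauer_measure (lam + m)) \<le> ennreal (M\<^sup>2 * W)"
    using W by (simp add: ennreal_mult mult_left_mono)
  have "\<forall>\<^sub>F N in sequentially. \<exists>p. degree p \<le> N \<and>
     (\<integral>\<^sup>+x. ennreal ((G 0 x - poly p x)\<^sup>2) \<partial>gegenbauer_measure lam) \<le> ennreal (((4 * (M\<^sup>2 * W)) * 4 ^ m + 1) * real N powr (- q))"
    using eventually_gt_at_top[of "2 * m"] eventually_ge_at_top[of 1]
  proof eventually_elim
    case (elim N)
    have Nm: "N - m > 0" using elim by linarith
    obtain p where p: "degree p \<le> (N - m) + m" "(\<integral>\<^sup>+x. ennreal ((G 0 x - poly p x)\<^sup>2) \<partial>gegenbauer_measure lam)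
        \<le> ennreal (4 * (M\<^sup>2 * W) / real (N - m) ^ (2 * m) + real N powr (- q))"
      using jackson_smooth[OF P lam smooth_chain_deriv_chain[OF G] Nm, of "real N powr (- q)" "\<lambda>_. M\<^sup>2" m "M\<^sup>2 * W"]
        elim M W B by (auto simp: abs_le_square_iff[symmetric])
    have "degree p \<le> N" using p(1) elim by linarith
    moreover have "4 * (M\<^sup>2 * W) / real (N - m) ^ (2 * m) + real N powr (- q)
        \<le> ((4 * (M\<^sup>2 * W)) * 4 ^ m + 1) * real N powr (- q)"
    proof -
      have "1 / real (N - m) ^ (2 * m) \<le> 4 ^ m * real N powr (- (2 * real m))"
        by (rule inverse_power_diff_le) (use elim in auto)
      also have "\<dots> \<le> 4 ^ m * real N powr (- q)"
        using elim m by (intro mult_left_mono powr_mono) auto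
      finally have "4 * (M\<^sup>2 * W) * (1 / real (N - m) ^ (2 * m)) \<le> 4 * (M\<^sup>2 * W) * (4 ^ m * real N powr (- q))"
        using W by (intro mult_left_mono) auto
      then show ?thesis by (simp add: algebra_simps)
    qed
    ultimately show ?case using order_trans[OF p(2) ennreal_leI] by blast
  qed
  then show ?thesis unfolding approx_rate_def using W by (intro exI[of _ "(4 * (M\<^sup>2 * W)) * 4 ^ m + 1"]) auto
qed

text \<open>The equation for \<theta> says exactly that for \<open>h = N powr - \<theta>\<close> the
  two terms of \<open>singular_approximation\<close> are the same power of \<open>N\<close>.\<close>

lemma approx_rate_powlog_scaled:
  fixes a e em c r \<theta> :: real
  assumes P: "sl_family lam P" and lam: "lam > - 1/2" and G: "smooth_chain G" and c: "c \<in> {-1..1}"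
    and w0: "\<And>x. x \<in> {-1..1} \<Longrightarrow> x \<noteq> c \<Longrightarrow> \<bar>x - c\<bar> \<le> r \<Longrightarrow> gegenbauer_weight lam x \<le> K * \<bar>x - c\<bar> powr e" "K \<ge> 0" "r > 0"
    and wm: "\<And>x. x \<in> {-1..1} \<Longrightarrow> x \<noteq> c \<Longrightarrow> gegenbauer_weight (lam + m) x \<le> Km * \<bar>x - c\<bar> powr em" "Km \<ge> 0"
    and e: "e > -1" "2 * a + e + 1 > 0" and em: "em > -1" "em + 2 * a + 2 - 2 * real m < -1"
    and th: "\<theta> > 0" "\<theta> * (2 * real m + e - em) = 2 * real m"
  shows "approx_rate lam (\<lambda>N x. \<bar>x - c\<bar> powr a * ln (\<bar>x - c\<bar> / real N powr (- \<theta>)) ^ i * G 0 x)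
    (\<lambda>N. real N powr (- \<theta> * (2 * a + e + 1)))"
proof -
  have "\<exists>C\<ge>0. \<forall>h N. 0 < h \<and> h \<le> r \<and> h \<le> 1 \<and> N > 0 \<longrightarrow> (\<exists>p. degree p \<le> N + m \<and>
    (\<integral>\<^sup>+x. ennreal ((\<bar>x - c\<bar> powr a * ln (\<bar>x - c\<bar> / h) ^ i * G 0 x - poly p x)\<^sup>2) \<partial>gegenbauer_measure lam)
      \<le> ennreal (C * (h powr (2 * a + e + 1) + h powr (2 * a - 2 * real m + em + 1) / real N ^ (2 * m))))"
    by (rule singular_approximation[OF P lam G c]) (fact w0 wm e em)+
  then obtain C where C: "C \<ge> 0" "\<forall>h N. 0 < h \<and> h \<le> r \<and> h \<le> 1 \<and> N > 0 \<longrightarrow> (\<exists>p. degree p \<le> N + m \<and>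
    (\<integral>\<^sup>+x. ennreal ((\<bar>x - c\<bar> powr a * ln (\<bar>x - c\<bar> / h) ^ i * G 0 x - poly p x)\<^sup>2) \<partial>gegenbauer_measure lam)
      \<le> ennreal (C * (h powr (2 * a + e + 1) + h powr (2 * a - 2 * real m + em + 1) / real N ^ (2 * m))))"
    by (elim exE conjE)
  have "((\<lambda>N. real N powr (- \<theta>)) \<longlongrightarrow> 0) sequentially"
    using th by (intro tendsto_neg_powr filterlim_real_sequentially) auto
  then have "\<forall>\<^sub>F N in sequentially. real N powr (- \<theta>) < min r 1"
    using w0(3) by (intro order_tendstoD) auto
  then have "\<forall>\<^sub>F N in sequentially. \<exists>p. degree p \<le> N \<and>
     (\<integral>\<^sup>+x. ennreal ((\<bar>x - c\<bar> powr a * ln (\<bar>x - c\<bar> / real N powr (- \<theta>)) ^ i * G 0 x - poly p x)\<^sup>2) \<partial>gegenbauer_measure lam)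
      \<le> ennreal (C * (1 + 4 ^ m) * real N powr (- \<theta> * (2 * a + e + 1)))"
    using eventually_gt_at_top[of "2 * m"]
  proof eventually_elim
    case (elim N)
    define h where "h = real N powr (- \<theta>)"
    define k where "k = - \<theta> * (2 * a + e + 1)"
    have h: "0 < h" "h \<le> r" "h \<le> 1" using elim by (auto simp: h_def)
    obtain p where p: "degree p \<le> (N - m) + m"
      "(\<integral>\<^sup>+x. ennreal ((\<bar>x - c\<bar> powr a * ln (\<bar>x - c\<bar> / h) ^ i * G 0 x - poly p x)\<^sup>2) \<partial>gegenbauer_measure lam)
      \<le> ennreal (C * (h powr (2 * a + e + 1) + h powr (2 * a - 2 * real m + em + 1) / real (N - m) ^ (2 * m)))"
      using C(2)[rule_format, of h "N - m"] h elim by auto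
    have "h powr (2 * a + e + 1) = real N powr k" by (simp add: h_def k_def powr_powr)
    moreover have "h powr (2 * a - 2 * real m + em + 1) / real (N - m) ^ (2 * m) \<le> 4 ^ m * real N powr k"
    proof -
      have "h powr (2 * a - 2 * real m + em + 1) / real (N - m) ^ (2 * m)
          = h powr (2 * a - 2 * real m + em + 1) * (1 / real (N - m) ^ (2 * m))" by simp
      also have "\<dots> \<le> h powr (2 * a - 2 * real m + em + 1) * (4 ^ m * real N powr (- (2 * real m)))"
        using inverse_power_diff_le[OF elim(2)] by (intro mult_left_mono) auto
      also have "\<dots> = 4 ^ m * real N powr (- \<theta> * (2 * a - 2 * real m + em + 1) + (- (2 * real m)))"
        by (subst powr_add[of _ _ "- (2 * real m)"]) (simp add: h_def powr_powr)
      also have "- \<theta> * (2 * a - 2 * real m + em + 1) + (- (2 * real m)) = k"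
        using th(2) by (simp add: k_def algebra_simps)
      finally show ?thesis .
    qed
    ultimately have "C * (h powr (2 * a + e + 1) + h powr (2 * a - 2 * real m + em + 1) / real (N - m) ^ (2 * m))
        \<le> C * (real N powr k + 4 ^ m * real N powr k)"
      using C(1) by (intro mult_left_mono) auto
    also have "\<dots> = C * (1 + 4 ^ m) * real N powr k" by (simp add: algebra_simps)
    finally have le: "C * (h powr (2 * a + e + 1) + h powr (2 * a - 2 * real m + em + 1) / real (N - m) ^ (2 * m)) \<le> \<dots>" .
    have "degree p \<le> N" using p(1) elim by simp
    with order_trans[OF p(2) ennreal_leI[OF le]] show ?case unfolding h_def k_def by blast
  qed
  then show ?thesis unfolding approx_rate_def using C(1) by (intro exI[of _ "C * (1 + 4 ^ m)"]) auto
qed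

text \<open>With \<open>h = N powr - \<theta>\<close>, expand \<open>ln \<bar>x - c\<bar> = ln (\<bar>x - c\<bar> / h) + ln h\<close>: every power of \<open>ln h\<close>
  costs a factor \<open>ln N\<close>, and the scaled terms carry none. If \<open>\<bar>x - c\<bar> powr a * g\<close> is smooth, the top
  power \<open>ln h ^ mu\<close> multiplies a smooth function, whose error is negligible.\<close>

lemma approx_rate_singular:
  fixes a e em c r \<theta> :: real and f :: "real \<Rightarrow> real"
  assumes P: "sl_family lam P" and lam: "lam > - 1/2" and G: "smooth_chain G" and c: "c \<in> {-1..1}"
    and w0: "\<And>x. x \<in> {-1..1} \<Longrightarrow> x \<noteq> c \<Longrightarrow> \<bar>x - c\<bar> \<le> r \<Longrightarrow> gegenbauer_weight lam x \<le> K * \<bar>x - c\<bar> powr e" "K \<ge> 0" "r > 0"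
    and wm: "\<And>x. x \<in> {-1..1} \<Longrightarrow> x \<noteq> c \<Longrightarrow> gegenbauer_weight (lam + m) x \<le> Km * \<bar>x - c\<bar> powr em" "Km \<ge> 0"
    and e: "e > -1" "2 * a + e + 1 > 0" and em: "em > -1" "em + 2 * a + 2 - 2 * real m < -1"
    and th: "\<theta> > 0" "\<theta> * (2 * real m + e - em) = 2 * real m"
    and f: "\<And>x. x \<in> {-1..1} \<Longrightarrow> x \<noteq> c \<Longrightarrow> f x = \<bar>x - c\<bar> powr a * ln \<bar>x - c\<bar> ^ mu * G 0 x"
    and nu: "nu = mu \<or> (mu = Suc nu \<and> smooth_chain G' \<and>
        (\<forall>x\<in>{-1..1}. x \<noteq> c \<longrightarrow> \<bar>x - c\<bar> powr a * G 0 x = G' 0 x))"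
  shows "approx_rate lam (\<lambda>N. f) (\<lambda>N. real N powr (- \<theta> * (2 * a + e + 1)) * ln (real N) ^ (2 * nu))"
proof -
  define k where "k = - \<theta> * (2 * a + e + 1)"
  define F where "F = (\<lambda>i N x. \<bar>x - c\<bar> powr a * ln (\<bar>x - c\<bar> / real N powr (- \<theta>)) ^ i * G 0 x)"
  \<comment> \<open>The coefficients of the binomial expansion, with
    \<open>ln h = - \<theta> * ln N\<close>.\<close>
  define b where "b = (\<lambda>i N. real (mu choose i) * (- \<theta> * ln (real N)) ^ (mu - i))"
  have [measurable]: "G 0 \<in> borel_measurable borel" using G by (simp add: smooth_chain_def)
  have F_meas [measurable]: "F i N \<in> borel_measurable borel" for i N
    unfolding F_def by measurable
  have b2: "(b i N)\<^sup>2 = (real (mu choose i) * \<theta> ^ (mu - i))\<^sup>2 * ln (real N) ^ (2 * (mu - i))" for i N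
  proof -
    have "(- \<theta> * ln (real N)) ^ (mu - i) = (-1) ^ (mu - i) * (\<theta> ^ (mu - i) * ln (real N) ^ (mu - i))"
      by (simp add: power_mult_distrib[symmetric])
    moreover have "((-1 :: real) ^ (mu - i))\<^sup>2 = 1" by (simp flip: power_mult)
    ultimately show ?thesis by (simp add: b_def power_mult_distrib power_even_eq)
  qed
  have rate_i: "approx_rate lam (\<lambda>N x. b i N * F i N x) (\<lambda>N. real N powr k * ln (real N) ^ (2 * nu))"
    if i: "i \<le> mu" for i
  proof (cases "mu - i \<le> nu")
    case True
    have "approx_rate lam (F i) (\<lambda>N. real N powr k)"
      unfolding F_def k_def by (rule approx_rate_powlog_scaled[OF P lam G c]) (fact w0 wm e em th)+
    moreover have "\<forall>\<^sub>F N in sequentially. (b i N)\<^sup>2 * real N powr k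
        \<le> (real (mu choose i) * \<theta> ^ (mu - i))\<^sup>2 * (real N powr k * ln (real N) ^ (2 * nu))"
      using eventually_ge_at_top[of 3]
    proof eventually_elim
      case (elim N)
      \<comment> \<open>From \<open>N = 3\<close> on the logarithm is at least 1, so that a larger
        exponent gives a larger power.\<close>
      have "1 \<le> ln (real N)" using elim ln3_gt_1 by (auto intro: order_trans[OF less_imp_le ln_le_cancel_iff[THEN iffD2]])
      then have "ln (real N) ^ (2 * (mu - i)) \<le> ln (real N) ^ (2 * nu)"
        using True by (intro power_increasing) auto
      then have "(real (mu choose i) * \<theta> ^ (mu - i))\<^sup>2 * real N powr k * ln (real N) ^ (2 * (mu - i))
        \<le> (real (mu choose i) * \<theta> ^ (mu - i))\<^sup>2 * real N powr k * ln (real N) ^ (2 * nu)"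
        by (intro mult_left_mono) auto
      then show ?case unfolding b2 by (simp add: mult_ac)
    qed
    ultimately show ?thesis by (rule approx_rate_scale) auto
  next
    case False
    \<comment> \<open>Only the term \<open>i = 0\<close> of the improved case carries more than
      \<open>nu\<close> factors \<open>ln N\<close>. It contains no logarithm of the distance and
      equals the smooth \<open>G' 0\<close> away from \<open>c\<close>.\<close>
    with nu i have G': "mu = Suc nu" "i = 0" "smooth_chain G'"
      and eq: "\<And>x. x \<in> {-1..1} \<Longrightarrow> x \<noteq> c \<Longrightarrow> \<bar>x - c\<bar> powr a * G 0 x = G' 0 x" by auto
    \<comment> \<open>The additional factor \<open>N powr -2\<close> in this rate pays for the
      surplus \<open>(ln N)\<^sup>2\<close>.\<close>
    have "approx_rate lam (\<lambda>N. G' 0) (\<lambda>N. real N powr (- (2 - k)))"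
      by (rule approx_rate_smooth[OF P lam G'(3)])
    moreover have "AE x in gegenbauer_measure lam. G' 0 x = F i N x" for N
      using AE_gegenbauer_measure_neq[of c lam] by eventually_elim (simp add: F_def G'(2) eq)
    then have "\<forall>\<^sub>F N in sequentially. AE x in gegenbauer_measure lam. G' 0 x = F i N x" by simp
    ultimately have "approx_rate lam (F i) (\<lambda>N. real N powr (- (2 - k)))"
      by (rule approx_rate_cong_AE)
    moreover have "\<forall>\<^sub>F N in sequentially. (b i N)\<^sup>2 * real N powr (- (2 - k))
        \<le> (real (mu choose i) * \<theta> ^ (mu - i))\<^sup>2 * (real N powr k * ln (real N) ^ (2 * nu))"
      using eventually_ge_at_top[of 1]
    proof eventually_elim
      case (elim N)
      have "(ln (real N))\<^sup>2 \<le> (real N)\<^sup>2"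
        using elim ln_bound[of "real N"] by (intro power_mono) auto
      then have "real N powr (-2) * (ln (real N))\<^sup>2 \<le> 1"
        using elim by (simp add: powr_minus_divide powr_realpow[symmetric] divide_le_eq flip: powr_numeral)
      then have "ln (real N) ^ (2 * nu) * real N powr k * (real N powr (-2) * (ln (real N))\<^sup>2)
          \<le> ln (real N) ^ (2 * nu) * real N powr k * 1"
        using elim by (intro mult_left_mono) auto
      moreover have "ln (real N) ^ (2 * (mu - i)) * real N powr (- (2 - k))
          = ln (real N) ^ (2 * nu) * real N powr k * (real N powr (-2) * (ln (real N))\<^sup>2)"
        by (simp add: G' powr_diff powr_minus_divide power_add power2_eq_square)
      ultimately have "ln (real N) ^ (2 * (mu - i)) * real N powr (- (2 - k)) \<le> real N powr k * ln (real N) ^ (2 * nu)"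
        by (simp add: mult_ac)
      then have "(real (mu choose i) * \<theta> ^ (mu - i))\<^sup>2 * (ln (real N) ^ (2 * (mu - i)) * real N powr (- (2 - k)))
         \<le> (real (mu choose i) * \<theta> ^ (mu - i))\<^sup>2 * (real N powr k * ln (real N) ^ (2 * nu))"
        by (rule mult_left_mono) simp
      then show ?case unfolding b2 by (simp only: mult_ac)
    qed
    ultimately show ?thesis by (rule approx_rate_scale) auto
  qed
  have "approx_rate lam (\<lambda>N x. \<Sum>i\<le>mu. b i N * F i N x) (\<lambda>N. real N powr k * ln (real N) ^ (2 * nu))"
    by (rule approx_rate_sum) (use rate_i in auto)
  moreover have "\<forall>\<^sub>F N in sequentially. AE x in gegenbauer_measure lam. (\<Sum>i\<le>mu. b i N * F i N x) = f x"
    using eventually_gt_at_top[of 0]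
  proof eventually_elim
    case (elim N)
    show ?case
      using AE_gegenbauer_measure_neq[of c lam]
    proof eventually_elim
      case (elim x)
      have "ln \<bar>x - c\<bar> = ln (\<bar>x - c\<bar> / real N powr (- \<theta>)) + (- \<theta> * ln (real N))"
        using \<open>N > 0\<close> elim by (simp add: ln_div ln_powr)
      then have "f x = \<bar>x - c\<bar> powr a *
          (ln (\<bar>x - c\<bar> / real N powr (- \<theta>)) + (- \<theta> * ln (real N))) ^ mu * G 0 x"
        using f[of x] elim by simp
      also have "\<dots> = (\<Sum>i\<le>mu. b i N * F i N x)"
        unfolding binomial_ring sum_distrib_left sum_distrib_right b_def F_def
        by (intro sum.cong) auto
      finally show ?case by simp
    qed
  qed
  ultimately show ?thesis unfolding k_def[symmetric] by (rule approx_rate_cong_AE)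
qed

section \<open>Orthogonal projections\<close>

lemma poly_inner_self_pos:
  assumes "lam > - 1/2" "p \<noteq> 0"
  shows "poly_inner lam p p > 0"
proof (rule ccontr)
  assume "\<not> poly_inner lam p p > 0"
  then have "poly_inner lam p p = 0" using poly_inner_self_nonneg[of lam p] by simp
  then have "AE x in gegenbauer_measure lam. poly (p * p) x = 0"
    unfolding poly_inner_def using integrable_gegenbauer_measure_poly[OF assms(1), of "p * p"]
    by (subst (asm) integral_nonneg_eq_0_iff_AE) auto
  then have "AE x in lborel. 0 < ennreal (indicator {-1..1} x * gegenbauer_weight lam x) \<longrightarrow> poly p x = 0"
    unfolding gegenbauer_measure_def by (subst (asm) AE_density) auto
  moreover have "AE x in lborel. x \<notin> {x. poly p x = 0}"
    by (rule AE_not_in) (simp add: finite_imp_null_set_lborel poly_roots_finite assms(2))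
  ultimately have "AE x in lborel. x \<notin> {-1<..<1::real}"
  proof eventually_elim
    case (elim x)
    have "0 < gegenbauer_weight lam x" if "x \<in> {-1<..<1}"
    proof -
      have "1 - x\<^sup>2 > 0" using that by (simp add: abs_square_less_1 abs_less_iff)
      then show ?thesis by (simp add: gegenbauer_weight_def)
    qed
    with elim show ?case by (auto simp: indicator_def)
  qed
  then have "{-1<..<1::real} \<in> null_sets lborel" by (subst (asm) AE_iff_null_sets[symmetric]) auto
  then show False by (simp add: null_sets_def)
qed

lemma integrable_square_prod:
  fixes u v :: "real \<Rightarrow> real"
  assumes "integrable M (\<lambda>x. (u x)\<^sup>2)" "integrable M (\<lambda>x. (v x)\<^sup>2)"
    and [measurable]: "u \<in> borel_measurable M" "v \<in> borel_measurable M"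
  shows "integrable M (\<lambda>x. u x * v x)"
proof (rule Bochner_Integration.integrable_bound)
  show "integrable M (\<lambda>x. (u x)\<^sup>2 + (v x)\<^sup>2)" using assms by simp
  have "\<bar>u x * v x\<bar> \<le> (u x)\<^sup>2 + (v x)\<^sup>2" for x
  proof -
    have "2 * \<bar>u x\<bar> * \<bar>v x\<bar> \<le> (u x)\<^sup>2 + (v x)\<^sup>2"
      using sum_squares_bound[of "\<bar>u x\<bar>" "\<bar>v x\<bar>"] by simp
    moreover have "\<bar>u x\<bar> * \<bar>v x\<bar> \<ge> 0" by simp
    ultimately show ?thesis unfolding abs_mult by linarith
  qed
  then show "AE x in M. norm (u x * v x) \<le> norm ((u x)\<^sup>2 + (v x)\<^sup>2)" by simp
qed simp

text \<open>Pythagoras: \<open>d = f - p\<close> is the sum of the projection error and the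
  polynomial \<open>S - p\<close>, which are orthogonal. All square integrability is drawn from
  \<open>d\<close>, whose squared norm is finite by assumption.\<close>

lemma projection_error_le:
  assumes P: "sl_family lam P" and lam: "lam > - 1/2"
    and f [measurable]: "f \<in> borel_measurable borel"
    and a: "\<And>n. n \<le> N \<Longrightarrow> a n = integral\<^sup>L (gegenbauer_measure lam) (\<lambda>x. f x * poly (P n) x) / poly_inner lam (P n) (P n)"
    and p: "degree p \<le> N" "(\<integral>\<^sup>+x. ennreal ((f x - poly p x)\<^sup>2) \<partial>gegenbauer_measure lam) \<le> ennreal B" "B \<ge> 0"
  shows "integral\<^sup>L (gegenbauer_measure lam) (\<lambda>x. (f x - (\<Sum>n\<le>N. a n * poly (P n) x))\<^sup>2) \<le> B"
proof -
  let ?M = "gegenbauer_measure lam"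
  define S where "S = (\<Sum>n\<le>N. smult (a n) (P n))"
  define d where "d = (\<lambda>x. f x - poly p x)"
  have [measurable]: "d \<in> borel_measurable borel" by (simp add: d_def)
  have P0: "degree (P n) = n" "P n \<noteq> 0" for n using P by (auto simp: sl_family_def)
  have "(\<integral>\<^sup>+x. ennreal ((d x)\<^sup>2) \<partial>?M) < \<infinity>" using p(2) by (auto simp: d_def intro: le_less_trans)
  then have d2: "integrable ?M (\<lambda>x. (d x)\<^sup>2)" by (intro integrableI_bounded) auto
  have q2: "integrable ?M (\<lambda>x. (poly q x)\<^sup>2)" for q
  proof -
    have "poly (q\<^sup>2) = (\<lambda>x. (poly q x)\<^sup>2)" by (simp add: fun_eq_iff)
    with integrable_gegenbauer_measure_poly[OF lam, of "q\<^sup>2"] show ?thesis by simp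
  qed
  have dq: "integrable ?M (\<lambda>x. d x * poly q x)" for q
    by (rule integrable_square_prod[OF d2 q2]) auto
  have qq: "integrable ?M (\<lambda>x. poly q x * poly r x)" for q r
    by (rule integrable_square_prod[OF q2 q2]) auto
  have poly_inner: "poly_inner lam q r = integral\<^sup>L ?M (\<lambda>x. poly q x * poly r x)" for q r
    by (auto simp: poly_inner_def intro: Bochner_Integration.integral_cong)
  \<comment> \<open>In other words, the projection error \<open>d - (S - p)\<close> is orthogonal to
    \<open>P n\<close>.\<close>
  have orth: "integral\<^sup>L ?M (\<lambda>x. d x * poly (P n) x) = poly_inner lam (S - p) (P n)" if n: "n \<le> N" for n
  proof -
    have "poly_inner lam S (P n) = (\<Sum>k\<le>N. if k = n then a n * poly_inner lam (P n) (P n) else 0)"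
      unfolding S_def poly_inner_sum_left[OF lam] poly_inner_smult_left
      using poly_inner_orthogonal[OF P lam] by (intro sum.cong) auto
    also have "\<dots> = integral\<^sup>L ?M (\<lambda>x. f x * poly (P n) x)"
      using n a[OF n] poly_inner_self_pos[OF lam P0(2)[of n]] by simp
    also have "\<dots> = integral\<^sup>L ?M (\<lambda>x. d x * poly (P n) x + poly p x * poly (P n) x)"
      by (simp add: d_def algebra_simps)
    also have "\<dots> = integral\<^sup>L ?M (\<lambda>x. d x * poly (P n) x) + poly_inner lam p (P n)"
      unfolding poly_inner by (intro Bochner_Integration.integral_add dq qq)
    finally have "poly_inner lam S (P n) = integral\<^sup>L ?M (\<lambda>x. d x * poly (P n) x) + poly_inner lam p (P n)" .
    moreover have "poly_inner lam S (P n) = poly_inner lam (S - p) (P n) + poly_inner lam p (P n)"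
      using poly_inner_add_left[OF lam, of "S - p" p "P n"] by simp
    ultimately show ?thesis by simp
  qed
  have "degree S \<le> N"
    unfolding S_def by (intro degree_sum_le) (auto simp: P0 intro: order_trans[OF degree_smult_le])
  then have "degree (S - p) \<le> N" using p(1) by (intro degree_diff_le)
  then obtain c where c: "S - p = (\<Sum>n\<le>N. smult (c n) (P n))"
    using sl_family_expansion[OF P] by blast
  have "integral\<^sup>L ?M (\<lambda>x. d x * poly (S - p) x) = integral\<^sup>L ?M (\<lambda>x. \<Sum>n\<le>N. c n * (d x * poly (P n) x))"
    by (simp only: c poly_sum poly_smult sum_distrib_left mult.left_commute)
  also have "\<dots> = (\<Sum>n\<le>N. c n * integral\<^sup>L ?M (\<lambda>x. d x * poly (P n) x))"
    by (subst Bochner_Integration.integral_sum) (auto simp: dq)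
  also have "\<dots> = (\<Sum>n\<le>N. c n * poly_inner lam (S - p) (P n))"
    by (intro sum.cong) (auto simp: orth)
  also have "\<dots> = poly_inner lam (S - p) (\<Sum>n\<le>N. smult (c n) (P n))"
    by (simp only: poly_inner_sum_right[OF lam] poly_inner_smult_right)
  also have "\<dots> = poly_inner lam (S - p) (S - p)" by (simp only: c)
  finally have cross: "integral\<^sup>L ?M (\<lambda>x. d x * poly (S - p) x) = poly_inner lam (S - p) (S - p)" .
  have "integral\<^sup>L ?M (\<lambda>x. (f x - (\<Sum>n\<le>N. a n * poly (P n) x))\<^sup>2)
      = integral\<^sup>L ?M (\<lambda>x. (d x)\<^sup>2 - 2 * (d x * poly (S - p) x) + poly (S - p) x * poly (S - p) x)"
    by (intro Bochner_Integration.integral_cong)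
      (simp_all add: d_def S_def poly_sum power2_eq_square algebra_simps)
  also have "\<dots> = integral\<^sup>L ?M (\<lambda>x. (d x)\<^sup>2) - 2 * integral\<^sup>L ?M (\<lambda>x. d x * poly (S - p) x) + poly_inner lam (S - p) (S - p)"
    unfolding poly_inner
    by (subst Bochner_Integration.integral_add Bochner_Integration.integral_diff;
        (intro Bochner_Integration.integrable_diff integrable_mult_right d2 dq qq)?)+ simp
  also have "\<dots> \<le> integral\<^sup>L ?M (\<lambda>x. (d x)\<^sup>2)" using cross poly_inner_self_nonneg[of lam "S - p"] by simp
  also have "\<dots> \<le> B" using p by (intro integral_real_bounded) (auto simp: d_def)
  finally show ?thesis .
qed

text \<open>Differentiate the first relation, then eliminate the derivative of \<open>Q0\<close> by
  the second and \<open>Q0\<close> by the first. This gives the eigenvalue equation times 1 - x^2,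
  which cancels in the polynomial ring. Only the product of \<alpha> and \<gamma> enters, so the two
  normalisations, which split it differently, are both covered.\<close>

lemma sl_op_of_ladder:
  assumes "\<And>x. (1 - x\<^sup>2) * poly (pderiv Q) x = \<alpha> * poly Q0 x - n * x * poly Q x"
    and "\<And>x. (1 - x\<^sup>2) * poly (pderiv Q0) x = (n + 2 * lam - 1) * x * poly Q0 x - \<gamma> * poly Q x"
    and ag: "\<alpha> * \<gamma> = n * (n + 2 * lam - 1)"
  shows "sl_op lam Q = smult (- (n * (n + 2 * lam))) Q"
proof -
  have d: "(1 - x\<^sup>2) * poly (pderiv (pderiv Q)) x - 2 * x * poly (pderiv Q) x
     = \<alpha> * poly (pderiv Q0) x - n * (poly Q x + x * poly (pderiv Q) x)" for x
  proof (rule DERIV_unique)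
    show "((\<lambda>x. (1 - x\<^sup>2) * poly (pderiv Q) x) has_real_derivative
      (1 - x\<^sup>2) * poly (pderiv (pderiv Q)) x - 2 * x * poly (pderiv Q) x) (at x)"
      by (auto intro!: derivative_eq_intros)
    show "((\<lambda>x. (1 - x\<^sup>2) * poly (pderiv Q) x) has_real_derivative
      \<alpha> * poly (pderiv Q0) x - n * (poly Q x + x * poly (pderiv Q) x)) (at x)"
      unfolding assms(1) by (auto intro!: derivative_eq_intros simp: algebra_simps)
  qed
  have "(1 - x\<^sup>2) * (poly (sl_op lam Q) x + n * (n + 2 * lam) * poly Q x) = 0" for x
  proof -
    have q: "\<alpha> * poly Q0 x = (1 - x\<^sup>2) * poly (pderiv Q) x + n * x * poly Q x"
      using assms(1)[of x] by simp
    have "\<alpha> * ((1 - x\<^sup>2) * poly (pderiv Q0) x) = (n + 2 * lam - 1) * x * (\<alpha> * poly Q0 x) - (\<alpha> * \<gamma>) * poly Q x"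
      unfolding assms(2) by (simp add: algebra_simps)
    also have "\<dots> = (n + 2 * lam - 1) * x * ((1 - x\<^sup>2) * poly (pderiv Q) x + n * x * poly Q x) - n * (n + 2 * lam - 1) * poly Q x"
      unfolding q ag ..
    finally have q0: "\<alpha> * ((1 - x\<^sup>2) * poly (pderiv Q0) x) = \<dots>" .
    have "(1 - x\<^sup>2) * ((1 - x\<^sup>2) * poly (pderiv (pderiv Q)) x - 2 * x * poly (pderiv Q) x)
      = \<alpha> * ((1 - x\<^sup>2) * poly (pderiv Q0) x) - n * (1 - x\<^sup>2) * (poly Q x + x * poly (pderiv Q) x)"
      unfolding d by (simp add: algebra_simps)
    then show ?thesis unfolding poly_sl_op q0 by (simp add: algebra_simps power2_eq_square)
  qed
  then have "[:1, 0, -1:] * (sl_op lam Q + smult (n * (n + 2 * lam)) Q) = 0"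
    by (intro poly_eq_poly_eq_iff[THEN iffD1]) (simp add: fun_eq_iff power2_eq_square algebra_simps)
  then have "sl_op lam Q + smult (n * (n + 2 * lam)) Q = 0" by (subst (asm) mult_eq_0_iff) simp
  then show ?thesis by (simp add: eq_neg_iff_add_eq_0)
qed

section \<open>The recurrences in the polynomial ring\<close>

fun gegenbauer_poly :: "real \<Rightarrow> nat \<Rightarrow> real poly" where
  "gegenbauer_poly lam 0 = 1"
| "gegenbauer_poly lam (Suc 0) = [:0, 2 * lam:]"
| "gegenbauer_poly lam (Suc (Suc n)) = smult (1 / (real n + 2))
     (smult (2 * (real n + 1 + lam)) ([:0, 1:] * gegenbauer_poly lam (Suc n))
       - smult (real n + 2 * lam) (gegenbauer_poly lam n))"

lemma poly_gegenbauer_poly: "poly (gegenbauer_poly lam n) x = gegenbauer lam n x"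
  by (induction lam n x rule: gegenbauer.induct) (simp_all add: mult_ac)

fun chebyshev_poly :: "nat \<Rightarrow> real poly" where
  "chebyshev_poly 0 = 1"
| "chebyshev_poly (Suc 0) = [:0, 1:]"
| "chebyshev_poly (Suc (Suc n)) = smult 2 ([:0, 1:] * chebyshev_poly (Suc n)) - chebyshev_poly n"

lemma poly_chebyshev_poly: "poly (chebyshev_poly n) x = chebyshev_T n x"
  by (induction n x rule: chebyshev_T.induct) (simp_all add: mult_ac)

text \<open>The recurrence multiplies the leading coefficient by
  \<open>2 * (n + 1 + lam) / (n + 2)\<close>; the coefficient \<open>2 * lam\<close> of the linear
  polynomial is where \<open>lam \<noteq> 0\<close> enters.\<close>

lemma degree_gegenbauer_poly:
  assumes "lam > - 1/2" "lam \<noteq> 0"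
  shows "degree (gegenbauer_poly lam n) \<le> n \<and> coeff (gegenbauer_poly lam n) n \<noteq> 0"
proof (induction n rule: induct_nat_012)
  case (ge2 n)
  have "degree (gegenbauer_poly lam (Suc (Suc n))) \<le> Suc (Suc n)"
    using ge2 by (auto intro!: order_trans[OF degree_smult_le] degree_diff_le order_trans[OF degree_pCons_le])
  moreover have "coeff (gegenbauer_poly lam n) (Suc (Suc n)) = 0"
    using ge2 by (intro coeff_eq_0) auto
  ultimately show ?case using ge2 assms by auto
qed (use assms in auto)

lemma degree_chebyshev_poly: "degree (chebyshev_poly n) \<le> n \<and> coeff (chebyshev_poly n) n \<noteq> 0"
proof (induction n rule: induct_nat_012)
  case (ge2 n)
  have "degree (chebyshev_poly (Suc (Suc n))) \<le> Suc (Suc n)"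
    using ge2 by (auto intro!: order_trans[OF degree_smult_le] degree_diff_le order_trans[OF degree_pCons_le])
  moreover have "coeff (chebyshev_poly n) (Suc (Suc n)) = 0"
    using ge2 by (intro coeff_eq_0) auto
  ultimately show ?case using ge2 by auto
qed auto

section \<open>Gegenbauer and Chebyshev polynomials\<close>

lemma gegenbauer_poly_rec:
  "(real n + 2) * poly (gegenbauer_poly lam (Suc (Suc n))) x =
     2 * (real n + 1 + lam) * x * poly (gegenbauer_poly lam (Suc n)) x
       - (real n + 2 * lam) * poly (gegenbauer_poly lam n) x"
proof -
  have "poly (gegenbauer_poly lam (Suc (Suc n))) x =
    (2 * (real n + 1 + lam) * x * poly (gegenbauer_poly lam (Suc n)) x
       - (real n + 2 * lam) * poly (gegenbauer_poly lam n) x) / (real n + 2)"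
    by (simp add: mult_ac)
  moreover have "real n + 2 \<noteq> 0" by simp
  ultimately show ?thesis by (metis nonzero_mult_div_cancel_left times_divide_eq_right)
qed

lemma pderiv_gegenbauer_poly_rec:
  "(real n + 2) * poly (pderiv (gegenbauer_poly lam (Suc (Suc n)))) x =
     2 * (real n + 1 + lam) * (poly (gegenbauer_poly lam (Suc n)) x + x * poly (pderiv (gegenbauer_poly lam (Suc n))) x)
       - (real n + 2 * lam) * poly (pderiv (gegenbauer_poly lam n)) x"
proof (rule DERIV_unique)
  show "((\<lambda>x. (real n + 2) * poly (gegenbauer_poly lam (Suc (Suc n))) x) has_real_derivative
    (real n + 2) * poly (pderiv (gegenbauer_poly lam (Suc (Suc n)))) x) (at x)"
    by (intro DERIV_cmult poly_DERIV)
  show "((\<lambda>x. (real n + 2) * poly (gegenbauer_poly lam (Suc (Suc n))) x) has_real_derivative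
     2 * (real n + 1 + lam) * (poly (gegenbauer_poly lam (Suc n)) x + x * poly (pderiv (gegenbauer_poly lam (Suc n))) x)
       - (real n + 2 * lam) * poly (pderiv (gegenbauer_poly lam n)) x) (at x)"
    unfolding gegenbauer_poly_rec
    by (auto intro!: derivative_eq_intros simp: algebra_simps simp del: gegenbauer_poly.simps)
qed

text \<open>The two relations support each other: the second for \<open>Suc n\<close> is the first
  for \<open>n\<close> with the oldest polynomial eliminated by the recurrence, and the first for
  \<open>Suc n\<close> comes from the differentiated recurrence and both relations for
  \<open>n\<close>.\<close>

lemma gegenbauer_ladder:
  "(1 - x\<^sup>2) * poly (pderiv (gegenbauer_poly lam (Suc n))) x =
     (real n + 2 * lam) * poly (gegenbauer_poly lam n) x - (real n + 1) * x * poly (gegenbauer_poly lam (Suc n)) x \<and>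
   (1 - x\<^sup>2) * poly (pderiv (gegenbauer_poly lam n)) x =
     (real n + 2 * lam) * x * poly (gegenbauer_poly lam n) x - (real n + 1) * poly (gegenbauer_poly lam (Suc n)) x"
proof (induction n)
  case 0
  show ?case by (simp add: pderiv_pCons algebra_simps power2_eq_square)
next
  case (Suc n)
  define c0 c1 c2 d0 d1 d2 where "c0 = poly (gegenbauer_poly lam n) x"
    and "c1 = poly (gegenbauer_poly lam (Suc n)) x"
    and "c2 = poly (gegenbauer_poly lam (Suc (Suc n))) x"
    and "d0 = poly (pderiv (gegenbauer_poly lam n)) x"
    and "d1 = poly (pderiv (gegenbauer_poly lam (Suc n))) x"
    and "d2 = poly (pderiv (gegenbauer_poly lam (Suc (Suc n)))) x"
  note defs = this
  define k w where "k = real n" and "w = 1 - x\<^sup>2"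
  have IH: "w * d1 = (k + 2 * lam) * c0 - (k + 1) * x * c1" "w * d0 = (k + 2 * lam) * x * c0 - (k + 1) * c1"
    using Suc.IH unfolding defs k_def w_def by auto
  have r: "(k + 2) * c2 = 2 * (k + 1 + lam) * x * c1 - (k + 2 * lam) * c0"
    unfolding defs k_def by (rule gegenbauer_poly_rec)
  have dr: "(k + 2) * d2 = 2 * (k + 1 + lam) * (c1 + x * d1) - (k + 2 * lam) * d0"
    unfolding defs k_def by (rule pderiv_gegenbauer_poly_rec)
  have B: "w * d1 = (k + 1 + 2 * lam) * x * c1 - (k + 2) * c2"
    unfolding IH r by (simp add: algebra_simps)
  \<comment> \<open>The factor \<open>k + 2\<close> lets the recurrences for \<open>c2\<close> and
    \<open>d2\<close> apply without division; it is cancelled at the end.\<close>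
  have "(k + 2) * (w * d2) = w * ((k + 2) * d2)" by (simp only: mult_ac)
  also have "\<dots> = 2 * (k + 1 + lam) * (w * c1 + x * (w * d1)) - (k + 2 * lam) * (w * d0)"
    unfolding dr by (simp add: algebra_simps)
  also have "\<dots> = (k + 2) * ((k + 1 + 2 * lam) * c1 - x * ((k + 2) * c2))"
    unfolding IH r by (simp add: w_def algebra_simps power2_eq_square)
  finally have "(k + 2) * (w * d2) = (k + 2) * ((k + 1 + 2 * lam) * c1 - x * ((k + 2) * c2))" .
  moreover have "k + 2 \<noteq> 0" by (simp add: k_def)
  ultimately have "w * d2 = (k + 1 + 2 * lam) * c1 - x * ((k + 2) * c2)" by (metis mult_left_cancel)
  with B show ?case unfolding defs k_def w_def by (simp add: mult_ac add_ac del: gegenbauer_poly.simps)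
qed

lemma sl_op_const: "sl_op lam 1 = 0"
  by (simp add: sl_op_def)

lemma sl_family_gegenbauer:
  assumes "lam > - 1/2" "lam \<noteq> 0"
  shows "sl_family lam (gegenbauer_poly lam)"
  unfolding sl_family_def
proof (intro allI conjI)
  fix n
  note D = degree_gegenbauer_poly[OF assms, of n]
  then show "degree (gegenbauer_poly lam n) = n" by (meson le_antisym le_degree)
  show "gegenbauer_poly lam n \<noteq> 0" using D by auto
  show "sl_op lam (gegenbauer_poly lam n) = smult (- (real n * (real n + 2 * lam))) (gegenbauer_poly lam n)"
  proof (cases n)
    case 0
    then show ?thesis by (simp add: sl_op_const)
  next
    case (Suc k)
    show ?thesis
      unfolding Suc
      by (rule sl_op_of_ladder[where ?Q0.0 = "gegenbauer_poly lam k" and \<alpha> = "real k + 2 * lam" and \<gamma> = "real k + 1"])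
        (use gegenbauer_ladder[of _ lam k] in \<open>auto simp: algebra_simps simp del: gegenbauer_poly.simps\<close>)
  qed
qed

lemma chebyshev_poly_rec:
  "poly (chebyshev_poly (Suc (Suc n))) x = 2 * x * poly (chebyshev_poly (Suc n)) x - poly (chebyshev_poly n) x"
  by simp

lemma pderiv_chebyshev_poly_rec:
  "poly (pderiv (chebyshev_poly (Suc (Suc n)))) x =
     2 * (poly (chebyshev_poly (Suc n)) x + x * poly (pderiv (chebyshev_poly (Suc n))) x)
       - poly (pderiv (chebyshev_poly n)) x"
proof (rule DERIV_unique)
  show "(poly (chebyshev_poly (Suc (Suc n))) has_real_derivative
    poly (pderiv (chebyshev_poly (Suc (Suc n)))) x) (at x)" by (rule poly_DERIV)
  show "(poly (chebyshev_poly (Suc (Suc n))) has_real_derivative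
     2 * (poly (chebyshev_poly (Suc n)) x + x * poly (pderiv (chebyshev_poly (Suc n))) x)
       - poly (pderiv (chebyshev_poly n)) x) (at x)"
    unfolding chebyshev_poly_rec[abs_def]
    by (auto intro!: derivative_eq_intros simp: algebra_simps simp del: chebyshev_poly.simps)
qed

text \<open>This does not follow by setting \<open>lam = 0\<close> in the Gegenbauer relations,
  where the polynomials of positive index vanish; the induction is the same.\<close>

lemma chebyshev_ladder:
  "(1 - x\<^sup>2) * poly (pderiv (chebyshev_poly (Suc n))) x =
     (real n + 1) * poly (chebyshev_poly n) x - (real n + 1) * x * poly (chebyshev_poly (Suc n)) x \<and>
   (1 - x\<^sup>2) * poly (pderiv (chebyshev_poly n)) x =
     real n * x * poly (chebyshev_poly n) x - real n * poly (chebyshev_poly (Suc n)) x"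
proof (induction n)
  case 0
  show ?case by (simp add: pderiv_pCons algebra_simps power2_eq_square)
next
  case (Suc n)
  define c0 c1 c2 d0 d1 d2 where "c0 = poly (chebyshev_poly n) x"
    and "c1 = poly (chebyshev_poly (Suc n)) x"
    and "c2 = poly (chebyshev_poly (Suc (Suc n))) x"
    and "d0 = poly (pderiv (chebyshev_poly n)) x"
    and "d1 = poly (pderiv (chebyshev_poly (Suc n))) x"
    and "d2 = poly (pderiv (chebyshev_poly (Suc (Suc n)))) x"
  note defs = this
  define k w where "k = real n" and "w = 1 - x\<^sup>2"
  have IH: "w * d1 = (k + 1) * c0 - (k + 1) * x * c1" "w * d0 = k * x * c0 - k * c1"
    using Suc.IH unfolding defs k_def w_def by auto
  have r: "c2 = 2 * x * c1 - c0"
    unfolding defs k_def by (rule chebyshev_poly_rec)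
  have dr: "d2 = 2 * (c1 + x * d1) - d0"
    unfolding defs k_def by (rule pderiv_chebyshev_poly_rec)
  have B: "w * d1 = (k + 1) * x * c1 - (k + 1) * c2"
    unfolding IH r by (simp add: algebra_simps)
  have "w * d2 = 2 * (w * c1 + x * (w * d1)) - w * d0"
    unfolding dr by (simp add: algebra_simps)
  also have "\<dots> = (k + 2) * c1 - (k + 2) * x * c2"
    unfolding IH r by (simp add: w_def algebra_simps power2_eq_square)
  finally have "w * d2 = (k + 2) * c1 - (k + 2) * x * c2" .
  with B show ?case unfolding defs k_def w_def by (simp add: add_ac del: chebyshev_poly.simps)
qed

lemma sl_family_chebyshev: "sl_family 0 chebyshev_poly"
  unfolding sl_family_def
proof (intro allI conjI)
  fix n
  note D = degree_chebyshev_poly[of n]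
  then show "degree (chebyshev_poly n) = n" by (meson le_antisym le_degree)
  show "chebyshev_poly n \<noteq> 0" using D by auto
  show "sl_op 0 (chebyshev_poly n) = smult (- (real n * (real n + 2 * 0))) (chebyshev_poly n)"
  proof (cases n)
    case 0
    then show ?thesis by (simp add: sl_op_const)
  next
    case (Suc k)
    show ?thesis
      unfolding Suc
      by (rule sl_op_of_ladder[where ?Q0.0 = "chebyshev_poly k" and \<alpha> = "real k + 1" and \<gamma> = "real k"])
        (use chebyshev_ladder[of _ k] in \<open>auto simp: algebra_simps simp del: chebyshev_poly.simps\<close>)
  qed
qed

text \<open>At 1 and -1 both sides are 0, by the conventions for powers of 0 and for division by 0,
  so there are no exceptional points.\<close>

lemma weight_0: "x \<in> {-1..1} \<Longrightarrow> gegenbauer_weight 0 x = 1 / sqrt (1 - x\<^sup>2)"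
  by (simp add: gegenbauer_weight_def powr_minus_divide powr_half_sqrt abs_square_le_1 abs_le_iff)

lemma poly_inner_one_0: "poly_inner 0 1 1 = pi"
proof -
  have si: "set_integrable lborel {-1..1} (gegenbauer_weight 0)"
    using weight_integrable[of 0] by (simp add: set_integrable_def)
  have "(gegenbauer_weight 0 has_integral (arcsin 1 - arcsin (-1))) {-1..1}"
  proof (rule fundamental_theorem_of_calculus_interior)
    show "continuous_on {-1..1} arcsin" by (rule continuous_on_arcsin')
    fix x :: real assume x: "x \<in> {-1<..<1}"
    then have "(arcsin has_real_derivative inverse (sqrt (1 - x\<^sup>2))) (at x)" by (intro DERIV_arcsin) auto
    then show "(arcsin has_vector_derivative gegenbauer_weight 0 x) (at x)"
      using x by (simp add: weight_0 has_real_derivative_iff_has_vector_derivative inverse_eq_divide)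
  qed simp
  from integral_unique[OF this] have "integral {-1..1} (gegenbauer_weight 0) = pi" by simp
  then show ?thesis
    unfolding poly_inner_def by (subst integral_gegenbauer_measure, simp) (simp add: set_borel_integral_eq_integral[OF si])
qed

text \<open>The identity \<open>n\<^sup>2 T\<^sub>n\<^sup>2 + (1 - x\<^sup>2) T\<^sub>n'\<^sup>2 = n\<^sup>2\<close> makes \<open>T\<^sub>n\<close> and \<open>T\<^sub>n'\<close>, which have equal norms
  up to the factor \<open>n\<close>, share the total mass \<open>\<pi>\<close>.\<close>

lemma poly_inner_chebyshev_self:
  assumes "n > 0"
  shows "poly_inner 0 (chebyshev_poly n) (chebyshev_poly n) = pi / 2"
proof -
  define T where "T = chebyshev_poly n"
  define E where "E = smult ((real n)\<^sup>2) (T * T) + [:1, 0, -1:] * (pderiv T * pderiv T)"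
  have pE: "poly E x = (real n)\<^sup>2 * (poly T x)\<^sup>2 + (1 - x\<^sup>2) * (poly (pderiv T) x)\<^sup>2" for x
    by (simp add: E_def power2_eq_square algebra_simps)
  have T1: "poly (chebyshev_poly n) 1 = 1" for n
    by (induction n rule: chebyshev_poly.induct) auto
  have ode: "(1 - x\<^sup>2) * poly (pderiv (pderiv T)) x - x * poly (pderiv T) x = - (real n)\<^sup>2 * poly T x" for x
  proof -
    have "sl_op 0 T = smult (- (real n * (real n + 2 * 0))) T"
      using sl_family_chebyshev unfolding sl_family_def T_def by blast
    then show ?thesis using poly_sl_op[of 0 T x] by (simp add: power2_eq_square)
  qed
  have "poly (pderiv E) x = 0" for x
  proof (rule DERIV_unique[OF poly_DERIV])
    have "(poly E has_real_derivative
      2 * poly (pderiv T) x * ((real n)\<^sup>2 * poly T x + ((1 - x\<^sup>2) * poly (pderiv (pderiv T)) x - x * poly (pderiv T) x))) (at x)"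
      unfolding pE[abs_def] by (auto intro!: derivative_eq_intros simp: algebra_simps power2_eq_square)
    then show "(poly E has_real_derivative 0) (at x)" unfolding ode by simp
  qed
  then have "pderiv E = 0" by (simp add: poly_eq_poly_eq_iff[symmetric] fun_eq_iff)
  then obtain k where k: "E = [:k:]" using pderiv_iszero by blast
  \<comment> \<open>At 1 the term with the derivative drops out, so the value of \<open>T\<close> at
    1 identifies the constant.\<close>
  have "poly E 1 = (real n)\<^sup>2" by (simp add: pE T_def T1)
  with k have E: "E = [:(real n)\<^sup>2:]" by simp
  have l: "(0::real) > - 1/2" "(1::real) > - 1/2" by simp_all
  have "poly_inner 1 (pderiv T) (pderiv T) = integral\<^sup>L (gegenbauer_measure 0) (\<lambda>x. (1 - x\<^sup>2) * poly (pderiv T * pderiv T) x)"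
  proof -
    have w: "gegenbauer_weight 1 x = gegenbauer_weight 0 x * (1 - x\<^sup>2)" if "x \<in> {-1..1}" for x
    proof (cases "1 - x\<^sup>2 = 0")
      case False
      moreover have "1 - x\<^sup>2 \<ge> 0" using that by (simp add: abs_square_le_1 abs_le_iff)
      ultimately show ?thesis
        using powr_add[of "1 - x\<^sup>2" "- 1/2" 1] by (simp add: gegenbauer_weight_def)
    qed (simp add: gegenbauer_weight_def)
    show ?thesis unfolding poly_inner_def
      by (subst (1 2) integral_gegenbauer_measure) (auto intro!: set_lebesgue_integral_cong simp: w)
  qed
  moreover have "integral\<^sup>L (gegenbauer_measure 0) (poly E) = (real n)\<^sup>2 * poly_inner 0 T T
      + integral\<^sup>L (gegenbauer_measure 0) (\<lambda>x. (1 - x\<^sup>2) * poly (pderiv T * pderiv T) x)"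
  proof -
    have "poly E = (\<lambda>x. (real n)\<^sup>2 * poly (T * T) x + (1 - x\<^sup>2) * poly (pderiv T * pderiv T) x)"
      by (simp add: pE fun_eq_iff power2_eq_square)
    moreover have "(\<lambda>x. (1 - x\<^sup>2) * poly (pderiv T * pderiv T) x) = poly ([:1, 0, -1:] * (pderiv T * pderiv T))"
      by (simp add: fun_eq_iff power2_eq_square algebra_simps)
    then have "integrable (gegenbauer_measure 0) (\<lambda>x. (1 - x\<^sup>2) * poly (pderiv T * pderiv T) x)"
      using integrable_gegenbauer_measure_poly[OF l(1)] by metis
    ultimately show ?thesis using integrable_gegenbauer_measure_poly[OF l(1), of "T * T"] by (simp add: poly_inner_def del: poly_mult)
  qed
  moreover have "integral\<^sup>L (gegenbauer_measure 0) (poly E) = (real n)\<^sup>2 * pi"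
    using poly_inner_smult_left[of 0 "(real n)\<^sup>2" 1 1] poly_inner_one_0 by (simp add: poly_inner_def E)
  moreover have "poly_inner 1 (pderiv T) (pderiv T) = (real n)\<^sup>2 * poly_inner 0 T T"
    using poly_inner_pderiv_family[OF sl_family_chebyshev l(1), of n T] by (simp add: T_def power2_eq_square)
  ultimately have "(real n)\<^sup>2 * (2 * poly_inner 0 T T) = (real n)\<^sup>2 * pi" by simp
  then show ?thesis using assms by (simp add: T_def)
qed

section \<open>Convergence rates\<close>

lemma weighted_L2_norm_gegenbauer:
  assumes [measurable]: "u \<in> borel_measurable borel"
  shows "weighted_L2_norm (gegenbauer_weight lam) u = sqrt (integral\<^sup>L (gegenbauer_measure lam) (\<lambda>x. (u x)\<^sup>2))"
  unfolding weighted_L2_norm_def by (subst integral_gegenbauer_measure) auto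

lemma projection_rate:
  assumes P: "sl_family lam P" and lam: "lam > - 1/2"
    and f [measurable]: "f \<in> borel_measurable borel"
    and rate: "approx_rate lam (\<lambda>N. f) (\<lambda>N. real N powr (- (2 * k)) * ln (real N) ^ (2 * nu))"
    and a: "\<And>n. a n = integral\<^sup>L (gegenbauer_measure lam) (\<lambda>x. f x * poly (P n) x) / poly_inner lam (P n) (P n)"
  shows "(\<lambda>N. weighted_L2_norm (gegenbauer_weight lam) (\<lambda>x. f x - (\<Sum>n\<le>N. a n * poly (P n) x)))
    \<in> O(\<lambda>N. real N powr (- k) * ln (real N) ^ nu)"
proof -
  obtain C where C: "C \<ge> 0" "\<forall>\<^sub>F N in sequentially. \<exists>p. degree p \<le> N \<and>
     (\<integral>\<^sup>+x. ennreal ((f x - poly p x)\<^sup>2) \<partial>gegenbauer_measure lam) \<le> ennreal (C * (real N powr (- (2 * k)) * ln (real N) ^ (2 * nu)))"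
    using rate by (auto simp: approx_rate_def)
  show ?thesis
  proof (rule bigoI[where c = "sqrt C"])
    show "\<forall>\<^sub>F N in sequentially. norm (weighted_L2_norm (gegenbauer_weight lam) (\<lambda>x. f x - (\<Sum>n\<le>N. a n * poly (P n) x)))
       \<le> sqrt C * norm (real N powr (- k) * ln (real N) ^ nu)"
      using C(2) eventually_ge_at_top[of 1]
    proof eventually_elim
      case (elim N)
      define X where "X = real N powr (- k) * ln (real N) ^ nu"
      have X: "X \<ge> 0" using elim by (simp add: X_def)
      have "real N powr (- (2 * k)) * ln (real N) ^ (2 * nu) = X\<^sup>2"
        unfolding X_def power_mult_distrib power_even_eq
        by (simp add: power2_eq_square powr_add[symmetric])
      then obtain p where p: "degree p \<le> N" "(\<integral>\<^sup>+x. ennreal ((f x - poly p x)\<^sup>2) \<partial>gegenbauer_measure lam) \<le> ennreal (C * X\<^sup>2)"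
        using elim by auto
      have "integral\<^sup>L (gegenbauer_measure lam) (\<lambda>x. (f x - (\<Sum>n\<le>N. a n * poly (P n) x))\<^sup>2) \<le> C * X\<^sup>2"
        using C(1) by (intro projection_error_le[OF P lam f a p]) auto
      then have "sqrt (integral\<^sup>L (gegenbauer_measure lam) (\<lambda>x. (f x - (\<Sum>n\<le>N. a n * poly (P n) x))\<^sup>2)) \<le> sqrt C * X"
        using X real_sqrt_le_mono by (fastforce simp: real_sqrt_mult)
      then show ?case
        using X unfolding X_def[symmetric]
        by (subst weighted_L2_norm_gegenbauer) (auto intro!: integral_nonneg_AE)
    qed
  qed
qed

text \<open>The function \<open>f\<close> is arbitrary outside the interval and possibly not
  measurable there. Coefficients and norms do not see those values, so \<open>f\<close> may be
  truncated.\<close>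

lemma error_restrict:
  "gegenbauer_error lam (\<lambda>x. if x \<in> {-1..1} then f x else 0) = gegenbauer_error lam f"
  "chebyshev_error (\<lambda>x. if x \<in> {-1..1} then f x else 0) = chebyshev_error f"
proof -
  let ?f = "\<lambda>x. if x \<in> {-1..1} then f x else 0"
  have "gegenbauer_coeff lam ?f n = gegenbauer_coeff lam f n" for n
    unfolding gegenbauer_coeff_def by (intro arg_cong2[of _ _ _ _ "(*)"] set_lebesgue_integral_cong refl) auto
  then show "gegenbauer_error lam ?f = gegenbauer_error lam f"
    unfolding gegenbauer_error_def gegenbauer_proj_def weighted_L2_norm_def
    by (intro ext arg_cong[of _ _ sqrt] set_lebesgue_integral_cong) auto
  have "chebyshev_coeff ?f n = chebyshev_coeff f n" for n
    unfolding chebyshev_coeff_def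
    by (cases "n = 0") (auto intro!: set_lebesgue_integral_cong)
  then show "chebyshev_error ?f = chebyshev_error f"
    unfolding chebyshev_error_def chebyshev_proj_def weighted_L2_norm_def
    by (intro ext arg_cong[of _ _ sqrt] set_lebesgue_integral_cong) auto
qed

lemma gegenbauer_error_rate:
  assumes lam: "lam > - 1/2" "lam \<noteq> 0" and f [measurable]: "f \<in> borel_measurable borel"
    and rate: "approx_rate lam (\<lambda>N. f) (\<lambda>N. real N powr (- (2 * k)) * ln (real N) ^ (2 * nu))"
  shows "gegenbauer_error lam f \<in> O(\<lambda>N. real N powr (- k) * ln (real N) ^ nu)"
proof -
  let ?P = "gegenbauer_poly lam"
  have "gegenbauer_coeff lam f n = integral\<^sup>L (gegenbauer_measure lam) (\<lambda>x. f x * poly (?P n) x) / poly_inner lam (?P n) (?P n)" for n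
  proof -
    have m: "(\<lambda>x. f x * poly (?P n) x) \<in> borel_measurable borel" by measurable
    show ?thesis
      unfolding gegenbauer_coeff_def gegenbauer_h_def poly_inner_def integral_gegenbauer_measure[OF m] integral_gegenbauer_measure[OF borel_poly]
      by (simp add: gegenbauer_weight_def poly_gegenbauer_poly power2_eq_square mult_ac)
  qed
  from projection_rate[OF sl_family_gegenbauer[OF lam] lam(1) f rate this]
  show ?thesis
    by (simp add: gegenbauer_error_def[abs_def] gegenbauer_proj_def poly_gegenbauer_poly atMost_atLeast0)
qed

text \<open>The factors \<open>1 / pi\<close> and \<open>2 / pi\<close> of the coefficients are the
  reciprocal squared norms of the Chebyshev polynomials.\<close>

lemma chebyshev_error_rate:
  assumes f [measurable]: "f \<in> borel_measurable borel"
    and rate: "approx_rate 0 (\<lambda>N. f) (\<lambda>N. real N powr (- (2 * k)) * ln (real N) ^ (2 * nu))"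
  shows "chebyshev_error f \<in> O(\<lambda>N. real N powr (- k) * ln (real N) ^ nu)"
proof -
  have int: "integral\<^sup>L (gegenbauer_measure 0) (\<lambda>x. f x * poly (chebyshev_poly n) x) =
      (LINT x:{-1..1}|lborel. f x * chebyshev_T n x / sqrt (1 - x\<^sup>2))" for n
  proof -
    have m: "(\<lambda>x. f x * poly (chebyshev_poly n) x) \<in> borel_measurable borel" by measurable
    show ?thesis
      unfolding integral_gegenbauer_measure[OF m]
      by (intro set_lebesgue_integral_cong) (auto simp: weight_0 poly_chebyshev_poly)
  qed
  have "chebyshev_coeff f n = integral\<^sup>L (gegenbauer_measure 0) (\<lambda>x. f x * poly (chebyshev_poly n) x)
      / poly_inner 0 (chebyshev_poly n) (chebyshev_poly n)" for n
  proof (cases "n = 0")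
    case True
    then show ?thesis using int[of 0] by (simp add: chebyshev_coeff_def poly_inner_one_0)
  next
    case False
    then show ?thesis unfolding int by (simp add: chebyshev_coeff_def poly_inner_chebyshev_self)
  qed
  from projection_rate[OF sl_family_chebyshev _ f rate this]
  have "(\<lambda>N. weighted_L2_norm (gegenbauer_weight 0) (\<lambda>x. f x - (\<Sum>n\<le>N. chebyshev_coeff f n * poly (chebyshev_poly n) x)))
    \<in> O(\<lambda>N. real N powr (- k) * ln (real N) ^ nu)" by simp
  moreover have "gegenbauer_weight 0 = chebyshev_weight"
    by (simp add: fun_eq_iff gegenbauer_weight_def chebyshev_weight_def)
  ultimately show ?thesis
    by (simp add: chebyshev_error_def[abs_def] chebyshev_proj_def poly_chebyshev_poly atMost_atLeast0)
qed

section \<open>Endpoint and interior singularities\<close>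

lemma weight_boundary:
  assumes "c = 1 \<or> c = -1" "x \<in> {-1..1}"
  shows "gegenbauer_weight lam x = ((2 - \<bar>x - c\<bar>) * \<bar>x - c\<bar>) powr (lam - 1/2)"
proof -
  have "1 - x\<^sup>2 = (2 - \<bar>x - c\<bar>) * \<bar>x - c\<bar>"
    using assms by (auto simp: abs_if power2_eq_square algebra_simps)
  then show ?thesis by (simp add: gegenbauer_weight_def)
qed

text \<open>The weight behaves like the power \<open>lam - 1/2\<close> of the distance to
  \<open>c\<close>, so the balance equation has the solution \<theta> = 2. This is why
  \<open>a\<close> counts twice in the rate.\<close>

lemma approx_rate_boundary:
  fixes c a :: real
  assumes P: "sl_family lam P" and lam: "lam > - 1/2" and G: "smooth_chain G" and c: "c = 1 \<or> c = -1"
    and a: "lam + 2 * a > - 1/2"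
    and f: "\<And>x. x \<in> {-1..1} \<Longrightarrow> x \<noteq> c \<Longrightarrow> f x = \<bar>x - c\<bar> powr a * ln \<bar>x - c\<bar> ^ mu * G 0 x"
    and nu: "nu = mu \<or> (mu = Suc nu \<and> smooth_chain G' \<and>
        (\<forall>x\<in>{-1..1}. x \<noteq> c \<longrightarrow> \<bar>x - c\<bar> powr a * G 0 x = G' 0 x))"
  shows "approx_rate lam (\<lambda>N. f) (\<lambda>N. real N powr (- (2 * (lam + 2 * a + 1/2))) * ln (real N) ^ (2 * nu))"
proof -
  \<comment> \<open>Large enough for the convergence condition, which reads
    \<open>m > lam + 2 * a + 5/2\<close>; and \<open>m \<ge> 1\<close> keeps the exponent
    \<open>lam + m - 1/2\<close> nonnegative.\<close>
  obtain m0 :: nat where "2 * a + lam + 4 < real m0" using reals_Archimedean2 by blast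
  then have m: "2 * a + lam + 4 < real (Suc m0)" "Suc m0 \<ge> 1" by simp_all
  define m where "m = Suc m0"
  note m = m[folded m_def]
  define \<beta> where "\<beta> = lam - 1/2"
  have ci: "c \<in> {-1..1}" using c by auto
  \<comment> \<open>The exponent is written with the factor \<open>- 2\<close> so that \<theta> is
    found by unification.\<close>
  have "approx_rate lam (\<lambda>N. f) (\<lambda>N. real N powr (- 2 * (2 * a + (lam - 1/2) + 1)) * ln (real N) ^ (2 * nu))"
  proof (rule approx_rate_singular[OF P lam G ci, where r = 1 and K = "2 powr \<bar>\<beta>\<bar>" and m = m
        and Km = "2 powr \<bar>\<beta> + m\<bar>" and em = "lam - 1/2 + m" and G' = G'])
    fix x :: real assume x: "x \<in> {-1..1}" "x \<noteq> c"
    have le2: "(2 - \<bar>x - c\<bar>) \<le> 2" "0 \<le> 2 - \<bar>x - c\<bar>" using x c by auto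
    \<comment> \<open>Distance at most 1 keeps \<open>2 - \<bar>x - c\<bar>\<close> in [1, 2], away
      from the other endpoint, so its power is bounded for either sign of \<beta>.\<close>
    show "gegenbauer_weight lam x \<le> 2 powr \<bar>\<beta>\<bar> * \<bar>x - c\<bar> powr (lam - 1/2)" if "\<bar>x - c\<bar> \<le> 1"
    proof -
      have "(2 - \<bar>x - c\<bar>) powr \<beta> \<le> (2 - \<bar>x - c\<bar>) powr \<bar>\<beta>\<bar>" using that by (intro powr_mono) auto
      also have "\<dots> \<le> 2 powr \<bar>\<beta>\<bar>" using that by (intro powr_mono2) auto
      finally show ?thesis
        using le2 unfolding weight_boundary[OF c x(1)] \<beta>_def by (simp add: powr_mult mult_right_mono)
    qed
    show "gegenbauer_weight (lam + m) x \<le> 2 powr \<bar>\<beta> + m\<bar> * \<bar>x - c\<bar> powr (lam - 1/2 + m)"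
    proof -
      have "(2 - \<bar>x - c\<bar>) powr (\<beta> + m) \<le> 2 powr (\<beta> + m)"
        using le2 lam m by (intro powr_mono2) (auto simp: \<beta>_def)
      moreover have "\<beta> + m \<ge> 0" using lam m by (simp add: \<beta>_def)
      moreover have eq: "lam + m - 1/2 = \<beta> + m" "lam - 1/2 + m = \<beta> + m" by (simp_all add: \<beta>_def)
      ultimately show ?thesis
        using le2(2) unfolding weight_boundary[OF c x(1)] eq by (simp add: powr_mult mult_right_mono del: of_nat_Suc)
    qed
    show "f x = \<bar>x - c\<bar> powr a * ln \<bar>x - c\<bar> ^ mu * G 0 x" using f x by blast
  next
    show "nu = mu \<or> (mu = Suc nu \<and> smooth_chain G' \<and> (\<forall>x\<in>{-1..1}. x \<noteq> c \<longrightarrow> \<bar>x - c\<bar> powr a * G 0 x = G' 0 x))"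
      by (rule nu)
  qed (use lam a m in \<open>auto simp: algebra_simps\<close>)
  moreover have "- 2 * (2 * a + (lam - 1/2) + 1) = - (2 * (lam + 2 * a + 1/2))" by simp
  ultimately show ?thesis by (simp only:)
qed

text \<open>Both weights have order 0: the one for \<open>lam\<close> is bounded near
  \<open>c\<close>, the one for \<open>lam + m\<close> is at most 1 everywhere. The balance gives
  \<theta> = 1, and \<open>lam\<close> drops out of the rate.\<close>

lemma approx_rate_interior:
  fixes c a :: real
  assumes P: "sl_family lam P" and lam: "lam > - 1/2" and G: "smooth_chain G" and c: "-1 < c" "c < 1"
    and a: "a > - 1/2"
    and f: "\<And>x. x \<in> {-1..1} \<Longrightarrow> x \<noteq> c \<Longrightarrow> f x = \<bar>x - c\<bar> powr a * ln \<bar>x - c\<bar> ^ mu * G 0 x"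
  shows "approx_rate lam (\<lambda>N. f) (\<lambda>N. real N powr (- (2 * (a + 1/2))) * ln (real N) ^ (2 * mu))"
proof -
  obtain m0 :: nat where "a + 3 < real m0" using reals_Archimedean2 by blast
  then have m: "a + 3 < real (Suc m0)" "Suc m0 \<ge> 1" by simp_all
  define m where "m = Suc m0"
  note m = m[folded m_def]
  define \<beta> where "\<beta> = lam - 1/2"
  \<comment> \<open>Half the distance from \<open>c\<close> to the nearer endpoint, since the weight
    may blow up there.\<close>
  define r where "r = (1 - \<bar>c\<bar>) / 2"
  have r: "r > 0" "r < 1" using c by (auto simp: r_def)
  have ci: "c \<in> {-1..1}" using c by auto
  have sq: "0 \<le> 1 - x\<^sup>2" "1 - x\<^sup>2 \<le> 1" if "x \<in> {-1..1}" for x :: real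
    using that by (auto simp: abs_square_le_1 abs_le_iff)
  have "approx_rate lam (\<lambda>N. f) (\<lambda>N. real N powr (- 1 * (2 * a + 0 + 1)) * ln (real N) ^ (2 * mu))"
  proof (rule approx_rate_singular[OF P lam G ci, where r = r and K = "1 + r powr \<beta>" and m = m
        and Km = 1 and em = 0])
    fix x :: real assume x: "x \<in> {-1..1}" "x \<noteq> c"
    show "gegenbauer_weight lam x \<le> (1 + r powr \<beta>) * \<bar>x - c\<bar> powr 0" if xr: "\<bar>x - c\<bar> \<le> r"
    proof -
      have "\<bar>x\<bar> \<le> 1 - r" using xr c by (simp add: r_def abs_if field_simps split: if_splits)
      then have "x\<^sup>2 \<le> (1 - r)\<^sup>2" using r by (intro power2_le_iff_abs_le[THEN iffD2]) auto
      also have "(1 - r)\<^sup>2 \<le> 1 - r" using r by (simp add: power2_eq_square mult_left_le)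
      finally have rx: "r \<le> 1 - x\<^sup>2" by simp
      have "(1 - x\<^sup>2) powr \<beta> \<le> 1 + r powr \<beta>"
      proof (cases "\<beta> \<ge> 0")
        case True
        then have "(1 - x\<^sup>2) powr \<beta> \<le> 1 powr \<beta>" using sq[OF x(1)] by (intro powr_mono2) auto
        then show ?thesis by (simp add: add_increasing2)
      next
        case False
        then have "(1 - x\<^sup>2) powr \<beta> \<le> r powr \<beta>" using rx r by (intro powr_mono2') auto
        then show ?thesis by simp
      qed
      then show ?thesis using x by (simp add: gegenbauer_weight_def \<beta>_def)
    qed
    show "gegenbauer_weight (lam + m) x \<le> 1 * \<bar>x - c\<bar> powr 0"
    proof -
      have "(1 - x\<^sup>2) powr (lam + m - 1/2) \<le> 1 powr (lam + m - 1/2)"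
        using sq[OF x(1)] lam m by (intro powr_mono2) auto
      then show ?thesis using x by (simp add: gegenbauer_weight_def)
    qed
    show "f x = \<bar>x - c\<bar> powr a * ln \<bar>x - c\<bar> ^ mu * G 0 x" using f x by blast
  qed (use a m r in \<open>auto simp: algebra_simps\<close>)
  moreover have "- 1 * (2 * a + 0 + 1) = - (2 * (a + 1/2))" by simp
  ultimately show ?thesis by (simp only:)
qed

text \<open>Setting the witness to 0 outside the interval makes \<open>H 0\<close> Borel measurable
  and leaves the derivatives within the interval unchanged.\<close>

lemma smooth_on_interval_chain:
  assumes "smooth_on_interval g"
  obtains G where "smooth_chain G" "\<And>x. x \<in> {-1..1} \<Longrightarrow> G 0 x = g x"
proof -
  obtain G where G: "\<And>x. x \<in> {-1..1} \<Longrightarrow> G 0 x = g x"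
    "\<And>k x. x \<in> {-1..1} \<Longrightarrow> (G k has_real_derivative G (Suc k) x) (at x within {-1..1})"
    using assms unfolding smooth_on_interval_def by blast
  define H where "H = (\<lambda>k x. if x \<in> {-1..1} then G k x else (0::real))"
  have "(H k has_real_derivative H (Suc k) x) (at x within {-1..1})" if "x \<in> {-1..1}" for k x
    using G(2)[OF that, of k] that
    by (subst has_field_derivative_cong_eventually[where g = "G k"]) (auto simp: H_def eventually_at_filter)
  moreover have "H 0 \<in> borel_measurable borel"
    unfolding H_def using DERIV_continuous_on[of "{-1..1}" "G 0" "G (Suc 0)"] G(2)
    by (intro borel_measurable_continuous_on_if) auto
  ultimately have "smooth_chain H" by (simp add: smooth_chain_def)
  then show ?thesis by (rule that) (simp add: H_def G(1))
qed

text \<open>This supplies the smooth function for the improved logarithm: at an endpoint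
  \<open>c\<close>, the power \<open>\<bar>x - c\<bar> ^ k\<close> is a power of a linear polynomial
  on the interval.\<close>

lemma smooth_chain_linear_power:
  assumes "smooth_chain G"
  shows "\<exists>G'. smooth_chain G' \<and> (\<forall>x. G' 0 x = (\<alpha> + \<beta> * x) ^ k * G 0 x)"
proof (induction k)
  case 0
  then show ?case using assms by (intro exI[of _ G]) simp
next
  case (Suc k)
  then obtain G' where G': "smooth_chain G'" "\<And>x. G' 0 x = (\<alpha> + \<beta> * x) ^ k * G 0 x" by blast
  \<comment> \<open>The Leibniz formula, in which a linear factor leaves only two terms. For
    \<open>j = 0\<close> the truncated index \<open>j - 1\<close> is harmless because its
    coefficient is 0.\<close>
  define H where "H = (\<lambda>j x. (\<alpha> + \<beta> * x) * G' j x + real j * \<beta> * G' (j - 1) x)"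
  have "(H j has_real_derivative H (Suc j) x) (at x within {-1..1})" if x: "x \<in> {-1..1}" for j x
  proof -
    have d: "(G' j has_real_derivative G' (Suc j) x) (at x within {-1..1})" for j
      using G'(1) x by (simp add: smooth_chain_def)
    have d': "((\<lambda>x. real j * \<beta> * G' (j - 1) x) has_real_derivative real j * \<beta> * G' j x) (at x within {-1..1})"
      using DERIV_cmult[OF d[of "j - 1"], of "real j * \<beta>"] by (cases j) auto
    have "((\<lambda>x. (\<alpha> + \<beta> * x) * G' j x) has_real_derivative \<beta> * G' j x + (\<alpha> + \<beta> * x) * G' (Suc j) x) (at x within {-1..1})"
      by (rule derivative_eq_intros d refl)+ simp
    from DERIV_add[OF this d'] show ?thesis by (simp add: H_def algebra_simps)
  qed
  moreover have "H 0 \<in> borel_measurable borel"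
  proof -
    have [measurable]: "G' 0 \<in> borel_measurable borel" using G'(1) by (simp add: smooth_chain_def)
    show ?thesis unfolding H_def by simp
  qed
  ultimately have "smooth_chain H" by (simp add: smooth_chain_def)
  moreover have "H 0 x = (\<alpha> + \<beta> * x) ^ Suc k * G 0 x" for x by (simp add: H_def G'(2))
  ultimately show ?case by blast
qed

text \<open>The value of \<open>f\<close> at the singularity is arbitrary, so measurability needs an argument.\<close>

lemma singular_measurable:
  fixes f :: "real \<Rightarrow> real"
  assumes "\<And>x. x \<in> {-1..1} \<Longrightarrow> x \<noteq> c \<Longrightarrow> f x = \<bar>x - c\<bar> powr a * ln \<bar>x - c\<bar> ^ mu * G 0 x" and "smooth_chain G"
  shows "(\<lambda>x. if x \<in> {-1..1} then f x else 0) \<in> borel_measurable borel"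
proof -
  have [measurable]: "G 0 \<in> borel_measurable borel" using assms(2) by (simp add: smooth_chain_def)
  have "(\<lambda>x. if x \<in> {-1..1} then f x else 0) =
    (\<lambda>x. if x = c then if c \<in> {-1..1} then f c else 0
      else if x \<in> {-1..1} then \<bar>x - c\<bar> powr a * ln \<bar>x - c\<bar> ^ mu * G 0 x else 0)"
    using assms(1) by auto
  also have "\<dots> \<in> borel_measurable borel" by measurable
  finally show ?thesis .
qed

lemma boundary_rates:
  fixes c a :: real
  assumes lam: "lam > - 1/2" and G: "smooth_chain G" and c: "c = 1 \<or> c = -1"
    and a: "lam + 2 * a > - 1/2"
    and f: "\<And>x. x \<in> {-1..1} \<Longrightarrow> x \<noteq> c \<Longrightarrow> f x = \<bar>x - c\<bar> powr a * ln \<bar>x - c\<bar> ^ mu * G 0 x"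
    and nu: "nu = mu \<or> (mu = Suc nu \<and> a \<in> \<int> \<and> a \<ge> 0)"
  shows "lam \<noteq> 0 \<Longrightarrow> gegenbauer_error lam f \<in> O(\<lambda>N. real N powr (- lam - 2 * a - 1/2) * ln (real N) ^ nu)"
    and "lam = 0 \<Longrightarrow> chebyshev_error f \<in> O(\<lambda>N. real N powr (- 1/2 - 2 * a) * ln (real N) ^ nu)"
proof -
  define f' where "f' = (\<lambda>x. if x \<in> {-1..1} then f x else 0)"
  have f'_meas: "f' \<in> borel_measurable borel"
    unfolding f'_def by (rule singular_measurable[OF f G])
  have "\<exists>G'. nu = mu \<or> (mu = Suc nu \<and> smooth_chain G' \<and>
        (\<forall>x\<in>{-1..1}. x \<noteq> c \<longrightarrow> \<bar>x - c\<bar> powr a * G 0 x = G' 0 x))"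
  proof (cases "nu = mu")
    case False
    with nu obtain k :: nat where k: "a = real k" "mu = Suc nu"
      by (metis Ints_cases nonneg_int_cases of_int_0_le_iff of_int_of_nat_eq)
    obtain G' where G': "smooth_chain G'" "\<And>x. G' 0 x = (1 + (- c) * x) ^ k * G 0 x"
      using smooth_chain_linear_power[OF G, of 1 "- c" k] by blast
    have "\<bar>x - c\<bar> powr a * G 0 x = G' 0 x" if "x \<in> {-1..1}" "x \<noteq> c" for x
    proof -
      have "\<bar>x - c\<bar> = 1 + (- c) * x" using c that(1) by auto
      moreover have "\<bar>x - c\<bar> powr a = \<bar>x - c\<bar> ^ k" unfolding k(1) using that by (intro powr_realpow) auto
      ultimately show ?thesis by (simp add: G'(2))
    qed
    with G'(1) k(2) show ?thesis by blast
  qed simp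
  then obtain G' where G': "nu = mu \<or> (mu = Suc nu \<and> smooth_chain G' \<and>
        (\<forall>x\<in>{-1..1}. x \<noteq> c \<longrightarrow> \<bar>x - c\<bar> powr a * G 0 x = G' 0 x))" by blast
  have rate: "approx_rate lam (\<lambda>N. f') (\<lambda>N. real N powr (- (2 * (lam + 2 * a + 1/2))) * ln (real N) ^ (2 * nu))"
    if "sl_family lam P" for P
    by (rule approx_rate_boundary[OF that lam G c a _ G']) (use f in \<open>auto simp: f'_def\<close>)
  have err: "gegenbauer_error lam f = gegenbauer_error lam f'" "chebyshev_error f = chebyshev_error f'"
    unfolding f'_def error_restrict by (rule refl)+
  show "gegenbauer_error lam f \<in> O(\<lambda>N. real N powr (- lam - 2 * a - 1/2) * ln (real N) ^ nu)" if "lam \<noteq> 0"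
    using gegenbauer_error_rate[OF lam that f'_meas rate[OF sl_family_gegenbauer[OF lam that]]]
    by (simp add: err algebra_simps)
  show "chebyshev_error f \<in> O(\<lambda>N. real N powr (- 1/2 - 2 * a) * ln (real N) ^ nu)" if "lam = 0"
  proof -
    have "approx_rate 0 (\<lambda>N. f') (\<lambda>N. real N powr (- (2 * (2 * a + 1/2))) * ln (real N) ^ (2 * nu))"
      using rate[of chebyshev_poly] that sl_family_chebyshev by simp
    from chebyshev_error_rate[OF f'_meas this]
    have "chebyshev_error f \<in> O(\<lambda>N. real N powr (- (2 * a + 1/2)) * ln (real N) ^ nu)"
      unfolding err .
    moreover have "- (2 * a + 1/2) = - 1/2 - 2 * a" by simp
    ultimately show ?thesis by (simp only:)
  qed
qed

lemma interior_rates: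
  fixes c a :: real
  assumes lam: "lam > - 1/2" and G: "smooth_chain G" and c: "-1 < c" "c < 1" and a: "a > - 1/2"
    and f: "\<And>x. x \<in> {-1..1} \<Longrightarrow> x \<noteq> c \<Longrightarrow> f x = \<bar>x - c\<bar> powr a * ln \<bar>x - c\<bar> ^ mu * G 0 x"
  shows "lam \<noteq> 0 \<Longrightarrow> gegenbauer_error lam f \<in> O(\<lambda>N. real N powr (- a - 1/2) * ln (real N) ^ mu)"
    and "lam = 0 \<Longrightarrow> chebyshev_error f \<in> O(\<lambda>N. real N powr (- a - 1/2) * ln (real N) ^ mu)"
proof -
  define f' where "f' = (\<lambda>x. if x \<in> {-1..1} then f x else 0)"
  have f'_meas: "f' \<in> borel_measurable borel"
    unfolding f'_def by (rule singular_measurable[OF f G])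
  have rate: "approx_rate lam (\<lambda>N. f') (\<lambda>N. real N powr (- (2 * (a + 1/2))) * ln (real N) ^ (2 * mu))"
    if "sl_family lam P" for P
    by (rule approx_rate_interior[OF that lam G c a]) (use f in \<open>auto simp: f'_def\<close>)
  have err: "gegenbauer_error lam f = gegenbauer_error lam f'" "chebyshev_error f = chebyshev_error f'"
    unfolding f'_def error_restrict by (rule refl)+
  have e: "- (a + 1/2) = - a - 1/2" by simp
  show "gegenbauer_error lam f \<in> O(\<lambda>N. real N powr (- a - 1/2) * ln (real N) ^ mu)" if "lam \<noteq> 0"
    using gegenbauer_error_rate[OF lam that f'_meas rate[OF sl_family_gegenbauer[OF lam that]]]
    unfolding err e .
  show "chebyshev_error f \<in> O(\<lambda>N. real N powr (- a - 1/2) * ln (real N) ^ mu)" if "lam = 0"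
    using chebyshev_error_rate[OF f'_meas rate[OF sl_family_chebyshev[folded that], unfolded that]]
    unfolding err e .
qed

text \<open>In the Gegenbauer case the condition on the minimum admits negative integers \<gamma>
  once \<open>lam > 3/2\<close>. Then \<open>(1 - x) powr \<gamma>\<close> has a pole, and the
  removal of one logarithm, which rests on its smoothness, breaks down; hence the condition
  \<open>\<gamma> \<ge> 0\<close> there, and likewise for \<delta>. In the Chebyshev case the
  condition on the minimum already excludes negative integers.\<close>

theorem corollary4:
  fixes mu :: nat and g :: "real \<Rightarrow> real" and lam :: real
  assumes "smooth_on_interval g" and "lam > - 1/2"
  shows
    "(lam \<noteq> 0 \<longrightarrow>
       (\<forall>\<gamma> f.
          min (lam + \<gamma>) (lam + 2 * \<gamma>) > - 1/2 \<longrightarrow>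
          (\<forall>x\<in>{-1..<1}. f x = (1 - x) powr \<gamma> * ln (1 - x) ^ mu * g x) \<longrightarrow>
          (gegenbauer_error lam f \<in> O(\<lambda>N. real N powr (- lam - 2 * \<gamma> - 1/2) * ln (real N) ^ mu)) \<and>
          (mu \<ge> 1 \<and> \<gamma> \<in> \<int> \<and> \<gamma> \<ge> 0 \<longrightarrow>
            gegenbauer_error lam f \<in> O(\<lambda>N. real N powr (- lam - 2 * \<gamma> - 1/2) * ln (real N) ^ (mu - 1)))) \<and>
       (\<forall>z0 s f.
          - 1 < z0 \<and> z0 < 1 \<and> s > - 1/2 \<and> lam \<ge> 0 \<longrightarrow>
          (\<forall>x\<in>{-1..1} - {z0}. f x = \<bar>x - z0\<bar> powr s * ln \<bar>x - z0\<bar> ^ mu * g x) \<longrightarrow>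
          gegenbauer_error lam f \<in> O(\<lambda>N. real N powr (- s - 1/2) * ln (real N) ^ mu)) \<and>
       (\<forall>\<delta> f.
          min (lam + \<delta>) (lam + 2 * \<delta>) > - 1/2 \<longrightarrow>
          (\<forall>x\<in>{-1<..1}. f x = (1 + x) powr \<delta> * ln (1 + x) ^ mu * g x) \<longrightarrow>
          (gegenbauer_error lam f \<in> O(\<lambda>N. real N powr (- lam - 2 * \<delta> - 1/2) * ln (real N) ^ mu)) \<and>
          (mu \<ge> 1 \<and> \<delta> \<in> \<int> \<and> \<delta> \<ge> 0 \<longrightarrow>
            gegenbauer_error lam f \<in> O(\<lambda>N. real N powr (- lam - 2 * \<delta> - 1/2) * ln (real N) ^ (mu - 1)))))
     \<and>
     ((\<forall>\<gamma> f.
          min \<gamma> (2 * \<gamma>) > - 1/2 \<longrightarrow>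
          (\<forall>x\<in>{-1..<1}. f x = (1 - x) powr \<gamma> * ln (1 - x) ^ mu * g x) \<longrightarrow>
          (chebyshev_error f \<in> O(\<lambda>N. real N powr (- 1/2 - 2 * \<gamma>) * ln (real N) ^ mu)) \<and>
          (mu \<ge> 1 \<and> \<gamma> \<in> \<int> \<longrightarrow>
            chebyshev_error f \<in> O(\<lambda>N. real N powr (- 1/2 - 2 * \<gamma>) * ln (real N) ^ (mu - 1)))) \<and>
       (\<forall>z0 s f.
          - 1 < z0 \<and> z0 < 1 \<and> s > - 1/2 \<longrightarrow>
          (\<forall>x\<in>{-1..1} - {z0}. f x = \<bar>x - z0\<bar> powr s * ln \<bar>x - z0\<bar> ^ mu * g x) \<longrightarrow>
          chebyshev_error f \<in> O(\<lambda>N. real N powr (- s - 1/2) * ln (real N) ^ mu)) \<and>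
       (\<forall>\<delta> f.
          min \<delta> (2 * \<delta>) > - 1/2 \<longrightarrow>
          (\<forall>x\<in>{-1<..1}. f x = (1 + x) powr \<delta> * ln (1 + x) ^ mu * g x) \<longrightarrow>
          (chebyshev_error f \<in> O(\<lambda>N. real N powr (- 1/2 - 2 * \<delta>) * ln (real N) ^ mu)) \<and>
          (mu \<ge> 1 \<and> \<delta> \<in> \<int> \<longrightarrow>
            chebyshev_error f \<in> O(\<lambda>N. real N powr (- 1/2 - 2 * \<delta>) * ln (real N) ^ (mu - 1)))))"
proof -
  obtain G where G: "smooth_chain G" and Gg: "\<And>x. x \<in> {-1..1} \<Longrightarrow> G 0 x = g x"
    using smooth_on_interval_chain[OF assms(1)] by blast
  note lam = assms(2)
  \<comment> \<open>The Chebyshev part is independent of \<open>lam\<close>; the rates are applied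
    once more with parameter 0.\<close>
  have zero: "(0::real) > - 1/2" by simp
  have right: "f x = \<bar>x - 1\<bar> powr \<gamma> * ln \<bar>x - 1\<bar> ^ mu * G 0 x"
    if "\<forall>x\<in>{-1..<1}. f x = (1 - x) powr \<gamma> * ln (1 - x) ^ mu * g x" "x \<in> {-1..1}" "x \<noteq> 1" for f \<gamma> x
    using that Gg[of x] by (simp add: abs_if)
  have left: "f x = \<bar>x - (-1)\<bar> powr \<gamma> * ln \<bar>x - (-1)\<bar> ^ mu * G 0 x"
    if "\<forall>x\<in>{-1<..1}. f x = (1 + x) powr \<gamma> * ln (1 + x) ^ mu * g x" "x \<in> {-1..1}" "x \<noteq> -1" for f \<gamma> x
    using that Gg[of x] by (simp add: abs_if add.commute)
  have inner: "f x = \<bar>x - z\<bar> powr s * ln \<bar>x - z\<bar> ^ mu * G 0 x"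
    if "\<forall>x\<in>{-1..1} - {z}. f x = \<bar>x - z\<bar> powr s * ln \<bar>x - z\<bar> ^ mu * g x" "x \<in> {-1..1}" "x \<noteq> z" for f s z x
    using that Gg[of x] by simp
  have pos: "\<gamma> \<ge> 0" if min: "min \<gamma> (2 * \<gamma>) > - 1/2" and int: "\<gamma> \<in> \<int>" for \<gamma> :: real
  proof -
    from int obtain k :: int where k: "\<gamma> = of_int k" by (rule Ints_cases)
    with min have "real_of_int (-1) < of_int k" by simp
    then have "k \<ge> 0" unfolding of_int_less_iff by simp
    then show ?thesis using k by simp
  qed
  have geg: "gegenbauer_error lam f \<in> O(\<lambda>N. real N powr (- lam - 2 * \<gamma> - 1/2) * ln (real N) ^ mu) \<and>
      (mu \<ge> 1 \<and> \<gamma> \<in> \<int> \<and> \<gamma> \<ge> 0 \<longrightarrow>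
        gegenbauer_error lam f \<in> O(\<lambda>N. real N powr (- lam - 2 * \<gamma> - 1/2) * ln (real N) ^ (mu - 1)))"
    if "lam \<noteq> 0" "min (lam + \<gamma>) (lam + 2 * \<gamma>) > - 1/2" "c = 1 \<or> c = -1"
      and f: "\<And>x. x \<in> {-1..1} \<Longrightarrow> x \<noteq> c \<Longrightarrow> f x = \<bar>x - c\<bar> powr \<gamma> * ln \<bar>x - c\<bar> ^ mu * G 0 x" for f \<gamma> c
    using boundary_rates(1)[OF lam G that(3) _ f, where nu = mu] boundary_rates(1)[OF lam G that(3) _ f, where nu = "mu - 1"] that
    by auto
  have cheb: "chebyshev_error f \<in> O(\<lambda>N. real N powr (- 1/2 - 2 * \<gamma>) * ln (real N) ^ mu) \<and>
      (mu \<ge> 1 \<and> \<gamma> \<in> \<int> \<longrightarrow>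
        chebyshev_error f \<in> O(\<lambda>N. real N powr (- 1/2 - 2 * \<gamma>) * ln (real N) ^ (mu - 1)))"
    if "min \<gamma> (2 * \<gamma>) > - 1/2" "c = 1 \<or> c = -1"
      and f: "\<And>x. x \<in> {-1..1} \<Longrightarrow> x \<noteq> c \<Longrightarrow> f x = \<bar>x - c\<bar> powr \<gamma> * ln \<bar>x - c\<bar> ^ mu * G 0 x" for f \<gamma> c
    using boundary_rates(2)[OF zero G that(2) _ f, where nu = mu] boundary_rates(2)[OF zero G that(2) _ f, where nu = "mu - 1"]
      that(1) pos[of \<gamma>]
    by auto
  show ?thesis
  proof (rule conjI, rule impI, rule conjI[OF _ conjI])
    assume nz: "lam \<noteq> 0"
    show "\<forall>\<gamma> f. min (lam + \<gamma>) (lam + 2 * \<gamma>) > - 1/2 \<longrightarrow>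
          (\<forall>x\<in>{-1..<1}. f x = (1 - x) powr \<gamma> * ln (1 - x) ^ mu * g x) \<longrightarrow>
          (gegenbauer_error lam f \<in> O(\<lambda>N. real N powr (- lam - 2 * \<gamma> - 1/2) * ln (real N) ^ mu)) \<and>
          (mu \<ge> 1 \<and> \<gamma> \<in> \<int> \<and> \<gamma> \<ge> 0 \<longrightarrow>
            gegenbauer_error lam f \<in> O(\<lambda>N. real N powr (- lam - 2 * \<gamma> - 1/2) * ln (real N) ^ (mu - 1)))"
      by (intro allI impI geg[OF nz _ _ right]) auto
    show "\<forall>z0 s f. - 1 < z0 \<and> z0 < 1 \<and> s > - 1/2 \<and> lam \<ge> 0 \<longrightarrow>
          (\<forall>x\<in>{-1..1} - {z0}. f x = \<bar>x - z0\<bar> powr s * ln \<bar>x - z0\<bar> ^ mu * g x) \<longrightarrow>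
          gegenbauer_error lam f \<in> O(\<lambda>N. real N powr (- s - 1/2) * ln (real N) ^ mu)"
      by (intro allI impI interior_rates(1)[OF lam G _ _ _ inner nz]) auto
    show "\<forall>\<delta> f. min (lam + \<delta>) (lam + 2 * \<delta>) > - 1/2 \<longrightarrow>
          (\<forall>x\<in>{-1<..1}. f x = (1 + x) powr \<delta> * ln (1 + x) ^ mu * g x) \<longrightarrow>
          (gegenbauer_error lam f \<in> O(\<lambda>N. real N powr (- lam - 2 * \<delta> - 1/2) * ln (real N) ^ mu)) \<and>
          (mu \<ge> 1 \<and> \<delta> \<in> \<int> \<and> \<delta> \<ge> 0 \<longrightarrow>
            gegenbauer_error lam f \<in> O(\<lambda>N. real N powr (- lam - 2 * \<delta> - 1/2) * ln (real N) ^ (mu - 1)))"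
      by (intro allI impI geg[OF nz _ _ left]) auto
  next
    show "(\<forall>\<gamma> f. min \<gamma> (2 * \<gamma>) > - 1/2 \<longrightarrow>
          (\<forall>x\<in>{-1..<1}. f x = (1 - x) powr \<gamma> * ln (1 - x) ^ mu * g x) \<longrightarrow>
          (chebyshev_error f \<in> O(\<lambda>N. real N powr (- 1/2 - 2 * \<gamma>) * ln (real N) ^ mu)) \<and>
          (mu \<ge> 1 \<and> \<gamma> \<in> \<int> \<longrightarrow>
            chebyshev_error f \<in> O(\<lambda>N. real N powr (- 1/2 - 2 * \<gamma>) * ln (real N) ^ (mu - 1)))) \<and>
       (\<forall>z0 s f. - 1 < z0 \<and> z0 < 1 \<and> s > - 1/2 \<longrightarrow>
          (\<forall>x\<in>{-1..1} - {z0}. f x = \<bar>x - z0\<bar> powr s * ln \<bar>x - z0\<bar> ^ mu * g x) \<longrightarrow>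
          chebyshev_error f \<in> O(\<lambda>N. real N powr (- s - 1/2) * ln (real N) ^ mu)) \<and>
       (\<forall>\<delta> f. min \<delta> (2 * \<delta>) > - 1/2 \<longrightarrow>
          (\<forall>x\<in>{-1<..1}. f x = (1 + x) powr \<delta> * ln (1 + x) ^ mu * g x) \<longrightarrow>
          (chebyshev_error f \<in> O(\<lambda>N. real N powr (- 1/2 - 2 * \<delta>) * ln (real N) ^ mu)) \<and>
          (mu \<ge> 1 \<and> \<delta> \<in> \<int> \<longrightarrow>
            chebyshev_error f \<in> O(\<lambda>N. real N powr (- 1/2 - 2 * \<delta>) * ln (real N) ^ (mu - 1))))"
      (is "?A \<and> ?B \<and> ?C")
    proof (rule conjI[OF _ conjI])
      show ?A by (intro allI impI cheb[OF _ _ right]) auto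
      show ?B by (intro allI impI interior_rates(2)[OF zero G _ _ _ inner refl]) auto
      show ?C by (intro allI impI cheb[OF _ _ left]) auto
    qed
  qed
qed

end
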